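(* Let $h\colon \mathbb{N}\to\mathbb{R}$ be a multiplicative function. For $N\in\mathbb{N}$ define $\mathcal{T}_N = |\{n\le N : h(n)\neq 0\}|$, and suppose that $\frac{N}{\mathcal{T}_N}\ll 1$ (i.e. $N/\mathcal{T}_N$ is bounded by a constant independent of $N$). For each integer $\ell$ define $g_\ell\colon\mathbb{N}\to\mathbb{C}$ by $g_\ell(n)=e^{2\pi i \ell \log_{10}|h(n)|}$ if $h(n)\neq 0$, and $g_\ell(n)=0$ if $h(n)=0$. Then $\{h(n)\}_{n\ge 1}$ is a strong Benford sequence if and only if $\mathbb{D}(g_\ell, n^{i\alpha};\infty)=\infty$ for all $\alpha\in\mathbb{R}$ and all integers $\ell\neq 0$.
   Context: $\mathbb{N}$ is the set of positive integers. A multiplicative function $h\colon\mathbb{N}\to\mathbb{R}$ is a function satisfying $h(mn)=h(m)h(n)$ whenever $\gcd(m,n)=1$. Strong Benford: Every positive real $a$ is written $a=10^{M}\sum_{j\ge 0} d_j 10^{-j}$ with $M\in\mathbb{Z}$, $1\le d_0\le 9$, $0\le d_j\le 9$ for $j\ge 1$ (usual convention: the digits are not eventually all $9$); the $d_j$ are the digits of $a$. A sequence $\{a_k\}_{k\ge1}$ of positive reals is strong Benford if for every positive integer $K$ and every digit string $S=d_0d_1\cdots d_{K-1}$ with $d_0\ne 0$, $$\lim_{N\to\infty}\frac{\#\{k\le N: \text{the first } K \text{ digits of } a_k \text{ are } d_0,\dots,d_{K-1}\}}{N}=\log_{10}(r+10^{-K+1})-\log_{10} r,\qquad r=\sum_{j=0}^{K-1}d_j10^{-j}.$$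 For a sequence of real numbers, one removes all zero terms, takes absolute values of the remaining terms, and calls the original sequence strong Benford if the resulting sequence of positive reals is strong Benford. Distance: for multiplicative functions $f,g$ with values in $\{z\in\mathbb{C}:|z|\le 1\}$, $\mathbb{D}(f,g;x)=\Big(\sum_{p\le x}\frac{1-\mathrm{Re}(f(p)\overline{g(p)})}{p}\Big)^{1/2}$, the sum being over primes $p$; $\mathbb{D}(f,g;\infty)$ is the (possibly infinite) limit as $x\to\infty$, i.e. the sum over all primes. Here $n^{i\alpha}$ denotes the function $n\mapsto n^{i\alpha}$. *)

theory Defs
  imports "HOL-Analysis.Analysis" "HOL-Computational_Algebra.Primes" "HOL-Library.Infinite_Set"
begin

text \<open>
  Arithmetic functions on the positive integers are modelled as functions on \<^typ>\<open>nat\<close>;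
  none of the notions below depends on the value at \<open>0\<close>.
\<close>

definition multiplicative :: "(nat \<Rightarrow> real) \<Rightarrow> bool" where
  "multiplicative h \<longleftrightarrow> (\<forall>m>0. \<forall>n>0. coprime m n \<longrightarrow> h (m * n) = h m * h n)"

text \<open>
  The last conjunct (digits not eventually all 9) makes \<open>M\<close> and \<open>d\<close> unique for each \<open>a > 0\<close>.
\<close>

definition decimal_expansion :: "real \<Rightarrow> int \<Rightarrow> (nat \<Rightarrow> nat) \<Rightarrow> bool" where
  "decimal_expansion a M d \<longleftrightarrow>
     a = 10 powi M * (\<Sum>j. real (d j) / 10 ^ j) \<and>
     1 \<le> d 0 \<and> (\<forall>j. d j \<le> 9) \<and> \<not> (\<exists>J. \<forall>j\<ge>J. d j = 9)"

definition first_digits :: "real \<Rightarrow> nat list \<Rightarrow> bool" where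
  "first_digits a S \<longleftrightarrow> (\<exists>M d. decimal_expansion a M d \<and> (\<forall>j<length S. d j = S ! j))"

definition digit_string_value :: "nat list \<Rightarrow> real" where
  "digit_string_value S = (\<Sum>j<length S. real (S ! j) / 10 ^ j)"

text \<open>Strong Benford property of a sequence \<open>a 1, a 2, \<dots>\<close> of positive reals.\<close>

definition strong_benford_pos :: "(nat \<Rightarrow> real) \<Rightarrow> bool" where
  "strong_benford_pos a \<longleftrightarrow>
     (\<forall>S. S \<noteq> [] \<and> set S \<subseteq> {0..9} \<and> hd S \<noteq> 0 \<longrightarrow>
        (\<lambda>N. real (card {k \<in> {1..N}. first_digits (a k) S}) / real N)
          \<longlonglongrightarrow> log 10 (digit_string_value S + 10 powi (1 - int (length S)))
               - log 10 (digit_string_value S))"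

text \<open>
  For a real sequence \<open>a 1, a 2, \<dots>\<close> the zero terms are deleted, so that the \<open>k\<close>-th remaining term
  is the one at the \<open>k\<close>-th smallest index with \<open>a n \<noteq> 0\<close> (\<^const>\<open>enumerate\<close> counts from \<open>0\<close>).
  If only finitely many terms remain, there is no remaining infinite sequence and the
  property is false.
\<close>

definition strong_benford :: "(nat \<Rightarrow> real) \<Rightarrow> bool" where
  "strong_benford a \<longleftrightarrow>
     infinite {n. 0 < n \<and> a n \<noteq> 0} \<and>
     strong_benford_pos (\<lambda>k. \<bar>a (enumerate {n. 0 < n \<and> a n \<noteq> 0} (k - 1))\<bar>)"

definition pretentious_dist :: "(nat \<Rightarrow> complex) \<Rightarrow> (nat \<Rightarrow> complex) \<Rightarrow> real \<Rightarrow> real" where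
  "pretentious_dist f g x =
     sqrt (\<Sum>p | prime p \<and> real p \<le> x. (1 - Re (f p * cnj (g p))) / real p)"

text \<open>
  For \<open>f\<close> and \<open>g\<close> with values in the closed unit disc the distance is nondecreasing in \<open>x\<close>,
  so this limit always exists in the extended reals.
\<close>

definition pretentious_dist_inf :: "(nat \<Rightarrow> complex) \<Rightarrow> (nat \<Rightarrow> complex) \<Rightarrow> ereal" where
  "pretentious_dist_inf f g = Lim at_top (\<lambda>x. ereal (pretentious_dist f g x))"

definition nonzero_count :: "(nat \<Rightarrow> real) \<Rightarrow> nat \<Rightarrow> nat" where
  "nonzero_count h N = card {n \<in> {1..N}. h n \<noteq> 0}"

definition benford_twist :: "(nat \<Rightarrow> real) \<Rightarrow> int \<Rightarrow> nat \<Rightarrow> complex" where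
  "benford_twist h l n =
     (if h n \<noteq> 0
      then exp (2 * complex_of_real pi * \<i> * of_int l * complex_of_real (log 10 \<bar>h n\<bar>))
      else 0)"

end

theory Submission
  imports Defs "HOL-Number_Theory.Prime_Powers" "HOL-Probability.Probability"
begin

text \<open>
  By Weyl's criterion, \<open>h\<close> is strong Benford iff each \<open>g\<^sub>l\<close> with \<open>l \<noteq> 0\<close> has mean value \<open>0\<close>;
  passing between averages over all \<open>n\<close> and over the \<open>n\<close> with \<open>h n \<noteq> 0\<close> is harmless since the latter
  have positive lower density.

  If all distances are infinite, the mean value is \<open>0\<close> by the qualitative form of Halasz's theorem.
  Writing \<open>F\<close> for the Dirichlet series of \<open>f = g\<^sub>l\<close>, the Euler product and compactness give
  \<open>F (\<sigma> + i t) = o (1 / (\<sigma> - 1))\<close> uniformly for bounded \<open>t\<close>. Convolving twice with the von Mangoldt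
  function, a smoothed partial sum of \<open>f\<close> up to \<open>N\<close> times \<open>(log N)\<^sup>2\<close> becomes a trilinear sum, hence by
  Fourier inversion an integral of \<open>E * L * F\<close> on the line \<open>\<sigma> = 1 + 1 / log N\<close>, where \<open>E\<close> and \<open>L\<close> are
  Dirichlet polynomials supported on prime powers. Their mean squares are \<open>O (log N)\<close> by Chebyshev's
  bound, so that only the supremum of \<open>F\<close> matters.

  If the distance from \<open>g\<^sub>l\<close> to \<open>n\<^sup>i\<^sup>\<alpha>\<close> is finite, the Euler product shows that \<open>F (\<sigma> + i \<alpha>)\<close> has exact order
  \<open>1 / (\<sigma> - 1)\<close>, which is incompatible with mean value \<open>0\<close>, unless the local factor at \<open>2\<close> vanishes.
  In that case \<open>g\<^sub>l (2\<^sup>k) = - 2\<^sup>k\<^sup>i\<^sup>\<alpha>\<close> for all \<open>k \<ge> 1\<close>, and the argument applies to \<open>2 l\<close> and \<open>2 \<alpha>\<close> instead.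
\<close>

section \<open>Chebyshev and Mertens bounds for the von Mangoldt function\<close>

text \<open>Two von Mangoldt factors are taken because mean squares alone must carry the integral: a
  single convolution would set one such factor against \<open>F\<close>, whose mean square would
  then have to be small as well. With two of them the weighted integral of \<open>E * L\<close> is
  O(log N) against (log N)^2 on the left, so a supremum o(log N) of \<open>F\<close> suffices. The
  price is a division by ln (N / d), which degenerates for d close to N; that range is cut off and
  estimated trivially by Mertens-type bounds. The bound for \<open>F\<close> is uniform only for
  bounded t; the quadratic decay of the transform of the cutoff covers the rest, and this is what
  the smoothing buys. \<open>F\<close> is always compared with zeta at the same real \<sigma>,
  factor by factor, so that the comparison itself needs no asymptotics for primes and no
  continuation to the line \<sigma> = 1. Only p = 2 is exceptional in the lower bound: the terms
  beyond the leading 1 in a local factor have total size at most 1 / (p - 1), which reaches 1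
  exactly there.\<close>

abbreviation Lam :: "nat \<Rightarrow> real" where "Lam \<equiv> mangoldt"

text \<open>Reindexing by n = d * m. Both uses unfold ln as the Dirichlet convolution of
  \<open>Lam\<close> with 1: once summed plainly, once under a smooth weight.\<close>

lemma sum_divisors_swap:
  fixes F :: "nat \<Rightarrow> nat \<Rightarrow> 'a :: comm_monoid_add"
  shows "(\<Sum>n=1..N. \<Sum>d | d dvd n. F d (n div d)) = (\<Sum>d=1..N. \<Sum>m=1..N div d. F d m)"
proof -
  have "(\<Sum>n=1..N. \<Sum>d | d dvd n. F d (n div d)) =
        (\<Sum>(n,d)\<in>(SIGMA n:{1..N}. {d. d dvd n}). F d (n div d))"
    by (subst sum.Sigma) auto
  also have "\<dots> = (\<Sum>(d,m)\<in>(SIGMA d:{1..N}. {1..N div d}). F d m)"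
    by (rule sum.reindex_bij_witness[where i="\<lambda>(d,m). (d*m, d)" and j="\<lambda>(n,d). (d, n div d)"])
      (auto simp: div_le_mono dvd_imp_le less_eq_div_iff_mult_less_eq mult.commute Suc_le_eq
            dvd_div_eq_0_iff intro: dvd_pos_nat order.trans[OF dvd_imp_le])
  also have "\<dots> = (\<Sum>d=1..N. \<Sum>m=1..N div d. F d m)"
    by (subst sum.Sigma) auto
  finally show ?thesis .
qed

text \<open>Legendre's formula in logarithmic form, from summing ln n over its decomposition into
  \<open>Lam d\<close> with d dvd n. The Chebyshev and Mertens bounds below are extracted from
  it.\<close>

lemma ln_fact_eq_sum_mangoldt: "ln (fact N) = (\<Sum>d=1..N. Lam d * real (N div d))"
proof -
  have "ln (fact N) = (\<Sum>n=1..N. ln (real n))"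
    by (auto simp: fact_prod intro!: ln_prod)
  also have "\<dots> = (\<Sum>n=1..N. \<Sum>d | d dvd n. Lam d)"
    by (intro sum.cong refl) (subst mangoldt_sum, auto)
  also have "\<dots> = (\<Sum>d=1..N. \<Sum>m=1..N div d. Lam d)"
    by (rule sum_divisors_swap[where F="\<lambda>d m. Lam d"])
  finally show ?thesis by (simp add: mult.commute)
qed

lemma ln_fact_le: "ln (fact N) \<le> real N * ln (real N)"
proof (cases "N = 0")
  case False
  have "ln (fact N) \<le> ln (real (N ^ N))"
    using fact_le_power[of N, where ?'a = real] False
    by (subst ln_le_cancel_iff) auto
  also have "\<dots> = real N * ln (real N)"
    using False by (simp add: ln_realpow)
  finally show ?thesis .
qed auto

text \<open>A crude Stirling bound; the induction step is N * ln (1 + 1 / N) <= 1.\<close>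

lemma ln_fact_ge: "ln (fact N) \<ge> real N * ln (real N) - real N"
proof (induction N)
  case (Suc N)
  show ?case
  proof (cases "N = 0")
    case False
    have "ln (1 + 1 / real N) \<le> 1 / real N"
      by (rule ln_add_one_self_le_self) auto
    hence "real N * ln (1 + 1 / real N) \<le> 1"
      using False by (simp add: field_simps)
    moreover have "ln (1 + 1 / real N) = ln (real (Suc N)) - ln (real N)"
      using False ln_div[of "real (Suc N)" "real N"] by (simp add: add_divide_distrib add.commute)
    ultimately have "real N * ln (real (Suc N)) - real N * ln (real N) \<le> 1"
      by (simp add: algebra_simps)
    moreover have "ln (fact (Suc N)) = ln (real (Suc N)) + ln (fact N)"
      by (simp add: ln_mult add.commute)
    ultimately show ?thesis using Suc.IH by (simp add: algebra_simps)
  qed auto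
qed auto

text \<open>For \<open>n < d \<le> 2 n\<close> one has \<open>2 n div d - 2 (n div d) = 1\<close>, so the sum is at most the logarithm of the
  central binomial coefficient.\<close>

lemma sum_mangoldt_double: "(\<Sum>d\<in>{n<..2*n}. Lam d) \<le> 2 * real n * ln 2"
proof -
  have "(\<Sum>d\<in>{n<..2*n}. Lam d) \<le> (\<Sum>d=1..2*n. Lam d * (real (2*n div d) - 2 * real (n div d)))"
  proof -
    have "(\<Sum>d\<in>{n<..2*n}. Lam d) = (\<Sum>d\<in>{n<..2*n}. Lam d * (real (2*n div d) - 2 * real (n div d)))"
    proof (intro sum.cong refl)
      fix d assume d: "d \<in> {n<..2*n}"
      have "2 * n div d = 1" using d by (intro div_nat_eqI) auto
      thus "Lam d = Lam d * (real (2*n div d) - 2 * real (n div d))" using d by simp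
    qed
    also have "\<dots> \<le> (\<Sum>d=1..2*n. Lam d * (real (2*n div d) - 2 * real (n div d)))"
    proof (intro sum_mono2)
      fix d
      have "2 * (n div d) \<le> 2 * n div d"
        by (cases "d = 0") (auto simp: less_eq_div_iff_mult_less_eq)
      thus "0 \<le> Lam d * (real (2*n div d) - 2 * real (n div d))"
        by (intro mult_nonneg_nonneg mangoldt_nonneg)
          (use of_nat_mono[of "2 * (n div d)" "2 * n div d", where ?'a = real] in simp)
    qed auto
    finally show ?thesis .
  qed
  also have "\<dots> = ln (fact (2*n)) - 2 * ln (fact n)"
  proof -
    have "(\<Sum>d=1..n. Lam d * real (n div d)) = (\<Sum>d=1..2*n. Lam d * real (n div d))"
      by (intro sum.mono_neutral_left) auto
    thus ?thesis
      unfolding ln_fact_eq_sum_mangoldt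
      by (simp add: sum_subtractf right_diff_distrib sum_distrib_left mult_ac)
  qed
  also have "\<dots> = ln (real ((2*n) choose n))"
    by (subst binomial_fact) (auto simp: ln_div ln_mult)
  also have "\<dots> \<le> ln (real (2 ^ (2*n)))"
  proof -
    have "(2*n) choose n > 0" by simp
    moreover have "(2*n) choose n \<le> 2 ^ (2*n)" by (rule binomial_le_pow2)
    ultimately show ?thesis by (subst ln_le_cancel_iff) (auto simp del: of_nat_power)
  qed
  also have "\<dots> = 2 * real n * ln 2" by (simp add: ln_realpow)
  finally show ?thesis .
qed

text \<open>Chebyshev's bound by halving: N is rounded up to 2 * n, and the upper half of {1..2*n}
  costs at most 2 * n * ln 2. The constant 4 leaves room for the rounding.\<close>

lemma sum_mangoldt_le: "(\<Sum>d=1..N. Lam d) \<le> 4 * real N"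
proof (induction N rule: less_induct)
  case (less N)
  consider "N = 0" | "N = 1" | "N \<ge> 2" by linarith
  thus ?case
  proof cases
    case 3
    define n where "n = (N + 1) div 2"
    have n: "n < N" "N \<le> 2 * n" "2 * n \<le> N + 1" using 3 unfolding n_def by auto
    have "(\<Sum>d=1..N. Lam d) \<le> (\<Sum>d=1..2*n. Lam d)"
      using n by (intro sum_mono2) (auto simp: mangoldt_nonneg)
    also have "{1..2*n} = {1..n} \<union> {n<..2*n}" by auto
    also have "(\<Sum>d\<in>{1..n} \<union> {n<..2*n}. Lam d) = (\<Sum>d=1..n. Lam d) + (\<Sum>d\<in>{n<..2*n}. Lam d)"
      by (intro sum.union_disjoint) auto
    also have "\<dots> \<le> 4 * real n + 2 * real n * ln 2"
      using less.IH[OF n(1)] sum_mangoldt_double[of n] by simp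
    also have "\<dots> \<le> 4 * real n + 2 * real n * (25/36)"
      using ln2_le_25_over_36 by (intro add_left_mono mult_left_mono) auto
    also have "\<dots> \<le> 4 * real N"
    \<comment> \<open>With 2 * n <= N + 1 the claim becomes (97/36) * (N + 1) <= 4 * N, which is
      comfortable for N >= 4; the values 2 and 3 are inserted directly.\<close>
    proof (cases "N \<ge> 4")
      case True
      have "2 * real n \<le> real N + 1" using n(3) by linarith
      moreover have "real N \<ge> 4" using True by simp
      ultimately show ?thesis by linarith
    next
      case False
      hence "N = 2 \<or> N = 3" using 3 by auto
      thus ?thesis unfolding n_def by auto
    qed
    finally show ?thesis .
  qed (auto simp: mangoldt_def)
qed

text \<open>Half of Mertens' first theorem: in Legendre's formula N / d replaces its integer part,
  at a cost of at most one \<open>Lam d\<close> per term, which Chebyshev's bound controls. For the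
  opposite half, rounding down is already favourable.\<close>

lemma sum_mangoldt_over_le:
  assumes "N \<ge> 1"
  shows "(\<Sum>d=1..N. Lam d / real d) \<le> ln (real N) + 4"
proof -
  have "real N * (\<Sum>d=1..N. Lam d / real d) = (\<Sum>d=1..N. Lam d * (real N / real d))"
    by (simp add: sum_distrib_left mult_ac)
  also have "\<dots> \<le> (\<Sum>d=1..N. Lam d * (real (N div d) + 1))"
  proof (intro sum_mono mult_left_mono mangoldt_nonneg)
    fix d assume "d \<in> {1..N}"
    show "real N / real d \<le> real (N div d) + 1"
      using floor_divide_of_nat_eq[of N d, where ?'a = real] real_of_int_floor_add_one_ge[of "real N / real d"]
      by simp
  qed
  also have "\<dots> = ln (fact N) + (\<Sum>d=1..N. Lam d)"
    by (simp add: ln_fact_eq_sum_mangoldt algebra_simps sum.distrib)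
  also have "\<dots> \<le> real N * ln (real N) + 4 * real N"
    using ln_fact_le[of N] sum_mangoldt_le[of N] by simp
  also have "\<dots> = real N * (ln (real N) + 4)" by (simp add: algebra_simps)
  finally show ?thesis using assms by simp
qed

lemma sum_mangoldt_over_ge:
  assumes "N \<ge> 1"
  shows "(\<Sum>d=1..N. Lam d / real d) \<ge> ln (real N) - 1"
proof -
  have "real N * (ln (real N) - 1) \<le> ln (fact N)"
    using ln_fact_ge[of N] by (simp add: algebra_simps)
  also have "\<dots> \<le> (\<Sum>d=1..N. Lam d * (real N / real d))"
    unfolding ln_fact_eq_sum_mangoldt
    by (intro sum_mono mult_left_mono mangoldt_nonneg of_nat_div_le_of_nat)
  also have "\<dots> = real N * (\<Sum>d=1..N. Lam d / real d)"
    by (simp add: sum_distrib_left mult_ac)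
  finally show ?thesis using assms by simp
qed

text \<open>The main terms of the two one-sided bounds nearly cancel, so a range Y < d <= N with Y =
  N^(1-\<eta>) has weight about \<eta> log N. This pays for those d at which ln (N / d) is too small
  to divide by.\<close>

lemma sum_mangoldt_over_range:
  assumes "1 \<le> Y" "Y \<le> N"
  shows "(\<Sum>d\<in>{Y<..N}. Lam d / real d) \<le> ln (real N / real Y) + 5"
proof -
  have "{1..N} = {1..Y} \<union> {Y<..N}" using assms by auto
  hence "(\<Sum>d=1..N. Lam d / real d) = (\<Sum>d=1..Y. Lam d / real d) + (\<Sum>d\<in>{Y<..N}. Lam d / real d)"
    by (simp only:) (rule sum.union_disjoint, auto)
  thus ?thesis
    using sum_mangoldt_over_le[of N] sum_mangoldt_over_ge[of Y] assms by (simp add: ln_div)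
qed

lemma ln_le_2_sqrt: "x > 0 \<Longrightarrow> ln x \<le> 2 * sqrt (x :: real)"
  using ln_le_minus_one[of "sqrt x"] by (simp add: ln_sqrt)

text \<open>Measures how often f (e * m) = f e * f m can fail for prime powers e = p^k: only if p
  divides m, which has density 1 / p. The sum over k is of size ln p / p^2, hence the total is
  bounded.\<close>

lemma sum_mangoldt_over_apd_bounded:
  "\<exists>K\<ge>0. \<forall>N. (\<Sum>d=1..N. Lam d / (real d * real (aprimedivisor d))) \<le> K"
proof -
  have sm: "summable (\<lambda>n. real n powr (-3/2))"
    by (subst summable_real_powr_iff) auto
  \<comment> \<open>One factor 2 comes from the geometric series in 1 / p, the other from ln p <= 2
    * sqrt p; the exponent is 1/2 - 2.\<close>
  define K where "K = 4 * (\<Sum>n. real n powr (-3/2))"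
  have "K \<ge> 0" unfolding K_def by (intro mult_nonneg_nonneg suminf_nonneg sm) auto
  moreover have "(\<Sum>d=1..N. Lam d / (real d * real (aprimedivisor d))) \<le> K" for N
  proof -
    define A where "A = {d\<in>{1..N}. primepow d}"
    define B where "B = (SIGMA p:{p\<in>{2..N}. prime p}. {1..N})"
    have finB: "finite B" unfolding B_def by auto
    have sub: "A \<subseteq> (\<lambda>(p,j). p ^ j) ` B"
    proof
      fix d assume d: "d \<in> A"
      then obtain p k where pk: "prime p" "k > 0" "d = p ^ k"
        unfolding A_def primepow_def by (auto simp: )
      have p2: "p \<ge> 2" using pk prime_ge_2_nat by blast
      have "p ^ 1 \<le> p ^ k" using pk p2 by (intro power_increasing) auto
      moreover have "k < p ^ k" using p2 by (intro less_exp[THEN less_le_trans] power_mono) auto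
      ultimately have "(p,k) \<in> B" using pk d p2 unfolding A_def B_def by auto
      thus "d \<in> (\<lambda>(p,j). p ^ j) ` B" using pk by force
    qed
    have "(\<Sum>d=1..N. Lam d / (real d * real (aprimedivisor d))) =
          (\<Sum>d\<in>A. Lam d / (real d * real (aprimedivisor d)))"
      unfolding A_def by (intro sum.mono_neutral_right) (auto simp: mangoldt_def)
    also have "\<dots> \<le> (\<Sum>d\<in>(\<lambda>(p,j). p ^ j) ` B. Lam d / (real d * real (aprimedivisor d)))"
      using sub finB by (intro sum_mono2) (auto intro!: divide_nonneg_nonneg mangoldt_nonneg)
    also have "\<dots> \<le> (\<Sum>(p,j)\<in>B. Lam (p^j) / (real (p^j) * real (aprimedivisor (p^j))))"
      using finB by (intro order.trans[OF sum_image_le] ) 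
        (auto intro!: divide_nonneg_nonneg mangoldt_nonneg simp: case_prod_unfold)
    also have "\<dots> = (\<Sum>(p,j)\<in>B. ln (real p) / (real p ^ j * real p))"
      by (intro sum.cong refl) (auto simp: B_def aprimedivisor_prime_power)
    also have "\<dots> = (\<Sum>p\<in>{p\<in>{2..N}. prime p}. \<Sum>j=1..N. ln (real p) / (real p ^ j * real p))"
      unfolding B_def by (subst sum.Sigma) auto
    also have "\<dots> \<le> (\<Sum>p\<in>{p\<in>{2..N}. prime p}. 4 * real p powr (-3/2))"
    proof (intro sum_mono)
      fix p assume p: "p \<in> {p\<in>{2..N}. prime p}"
      have p2: "real p \<ge> 2" using p by auto
      have "(\<Sum>j=1..N. ln (real p) / (real p ^ j * real p)) = ln (real p) / real p * (\<Sum>j=1..N. (1 / real p) ^ j)"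
        by (simp add: sum_distrib_left power_divide mult_ac)
      also have "(\<Sum>j=1..N. (1 / real p) ^ j) \<le> 2 / real p"
      proof -
        have "(\<Sum>j=1..N. (1 / real p) ^ j) = (1 / real p) * (\<Sum>j<N. (1 / real p) ^ j)"
          by (subst sum_distrib_left) (rule sum.reindex_bij_witness[of _ Suc "\<lambda>j. j - 1"],
              auto simp: power_Suc[symmetric] simp del: power_Suc)
        also have "(\<Sum>j<N. (1 / real p) ^ j) \<le> (\<Sum>j. (1 / real p) ^ j)"
          using p2 by (intro sum_le_suminf summable_geometric) auto
        also have "(\<Sum>j. (1 / real p) ^ j) = 1 / (1 - 1 / real p)"
          using p2 by (intro suminf_geometric) auto
        also have "\<dots> \<le> 2" using p2 by (simp add: field_simps)
        finally show ?thesis using p2 by (simp add: field_simps)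
      qed
      also have "ln (real p) \<le> 2 * sqrt (real p)" using p2 by (intro ln_le_2_sqrt) auto
      finally have "(\<Sum>j=1..N. ln (real p) / (real p ^ j * real p)) \<le> 2 * sqrt (real p) / real p * (2 / real p)"
        using p2 by (simp add: divide_right_mono mult_right_mono)
      also have "\<dots> = 4 * (sqrt (real p) / real p ^ 2)"
        using p2 by (simp add: power2_eq_square)
      also have "sqrt (real p) / real p ^ 2 = real p powr (-3/2)"
      proof -
        have "sqrt (real p) / real p ^ 2 = real p powr (1/2) / real p powr 2"
          using p2 by (simp add: powr_half_sqrt powr_numeral)
        also have "\<dots> = real p powr (1/2 - 2)" by (rule powr_diff [symmetric])
        finally show ?thesis by simp
      qed
      finally show "(\<Sum>j=1..N. ln (real p) / (real p ^ j * real p)) \<le> 4 * real p powr (-3/2)" .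
    qed
    also have "\<dots> \<le> K"
      unfolding K_def sum_distrib_left[symmetric]
      by (intro mult_left_mono sum_le_suminf sm) auto
    finally show ?thesis .
  qed
  ultimately show ?thesis by blast
qed

section \<open>Mean squares of Dirichlet polynomials\<close>

lemma exp_neg_square_le: "exp (- (x^2) / 2) \<le> exp (1/2) * exp (- \<bar>x::real\<bar>)"
proof -
  have "(\<bar>x\<bar> - 1)^2 \<ge> 0" by simp
  hence "- (x^2) / 2 \<le> 1/2 - \<bar>x\<bar>" by (simp add: power2_diff)
  thus ?thesis by (simp flip: exp_add)
qed

text \<open>The window is majorised by a Gaussian, whose Fourier transform is dominated by \<open>exp (- \<bar>u\<bar>)\<close>.\<close>

lemma mean_square_window:
  fixes a :: "'i \<Rightarrow> complex" and u :: "'i \<Rightarrow> real" and \<tau> :: real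
  assumes fin: "finite I"
  shows "integral {\<tau>..\<tau>+1} (\<lambda>t. (norm (\<Sum>i\<in>I. a i * cis (- (t * u i))))^2) \<le>
           sqrt (2 * pi) * exp 1 * (\<Sum>i\<in>I. \<Sum>j\<in>I. norm (a i) * norm (a j) * exp (- \<bar>u i - u j\<bar>))"
proof -
  define E where "E t = (\<Sum>i\<in>I. a i * cis (- (t * u i)))" for t
  have contE: "continuous_on UNIV E" unfolding E_def by (intro continuous_intros)
  have measE [measurable]: "E \<in> borel_measurable borel"
    using contE by (rule borel_measurable_continuous_onI)
  define \<nu> where "\<nu> = std_normal_distribution"
  interpret \<nu>: real_distribution \<nu> unfolding \<nu>_def by (rule real_dist_normal_dist)
  define Q where "Q = (\<Sum>i\<in>I. \<Sum>j\<in>I. norm (a i) * norm (a j) * exp (- \<bar>u i - u j\<bar>))"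
  have boundE: "norm (E t) \<le> (\<Sum>i\<in>I. norm (a i))" for t
    unfolding E_def by (rule order.trans[OF norm_sum]) (simp add: norm_mult)
  \<comment> \<open>Opening the square around \<tau> makes each cross term a fixed coefficient times
    a character in t - \<tau>, whose Gaussian mean is a value of \<open>char\<close>.\<close>
  have sq_expand: "complex_of_real ((norm (E t))^2) =
      (\<Sum>i\<in>I. \<Sum>j\<in>I. a i * cnj (a j) * cis (- (\<tau> * (u i - u j))) * iexp ((u j - u i) * (t - \<tau>)))" for t
  proof -
    have "complex_of_real ((norm (E t))^2) = E t * cnj (E t)"
      using complex_norm_square[of "E t"] by simp
    also have "\<dots> = (\<Sum>i\<in>I. \<Sum>j\<in>I. (a i * cis (- (t * u i))) * cnj (a j * cis (- (t * u j))))"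
      unfolding E_def by (simp add: sum_product)
    also have "\<dots> = (\<Sum>i\<in>I. \<Sum>j\<in>I. a i * cnj (a j) * cis (- (\<tau> * (u i - u j))) * iexp ((u j - u i) * (t - \<tau>)))"
    proof (intro sum.cong refl)
      fix i j
      have "cis (- (t * u i)) * cis (t * u j) = cis (- (\<tau> * (u i - u j))) * iexp ((u j - u i) * (t - \<tau>))"
        unfolding cis_conv_exp [symmetric] cis_mult by (intro arg_cong[where f=cis]) (simp add: algebra_simps)
      thus "(a i * cis (- (t * u i))) * cnj (a j * cis (- (t * u j))) =
            a i * cnj (a j) * cis (- (\<tau> * (u i - u j))) * iexp ((u j - u i) * (t - \<tau>))"
        by (simp add: cis_cnj mult_ac)
    qed
    finally show ?thesis .
  qed
  have int_term: "integrable \<nu> (\<lambda>x. c * iexp (v * x))" for c :: complex and v :: real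
    by (intro \<nu>.integrable_const_bound[where B="norm c"]) (auto simp: norm_mult)
  have "complex_of_real (LINT x|\<nu>. (norm (E (\<tau> + x)))^2) = (CLINT x|\<nu>. complex_of_real ((norm (E (\<tau> + x)))^2))"
    by (rule integral_complex_of_real [symmetric])
  also have "\<dots> = (CLINT x|\<nu>. (\<Sum>i\<in>I. \<Sum>j\<in>I. a i * cnj (a j) * cis (- (\<tau> * (u i - u j))) * iexp ((u j - u i) * x)))"
    by (subst sq_expand) simp
  also have "\<dots> = (\<Sum>i\<in>I. \<Sum>j\<in>I. CLINT x|\<nu>. a i * cnj (a j) * cis (- (\<tau> * (u i - u j))) * iexp ((u j - u i) * x))"
    by (subst Bochner_Integration.integral_sum,
        intro Bochner_Integration.integrable_sum int_term,
        intro sum.cong refl Bochner_Integration.integral_sum int_term)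
  also have "\<dots> = (\<Sum>i\<in>I. \<Sum>j\<in>I. a i * cnj (a j) * cis (- (\<tau> * (u i - u j))) * char \<nu> (u j - u i))"
    by (intro sum.cong refl, subst integral_mult_right_zero) (simp add: char_def)
  also have "\<dots> = (\<Sum>i\<in>I. \<Sum>j\<in>I. a i * cnj (a j) * cis (- (\<tau> * (u i - u j))) * complex_of_real (exp (- ((u j - u i)^2) / 2)))"
    unfolding \<nu>_def by (subst char_std_normal_distribution) simp
  finally have eq: "complex_of_real (LINT x|\<nu>. (norm (E (\<tau> + x)))^2) = \<dots>" .
  have "LINT x|\<nu>. (norm (E (\<tau> + x)))^2 \<le> norm (complex_of_real (LINT x|\<nu>. (norm (E (\<tau> + x)))^2))"
    by simp
  also have "\<dots> \<le> (\<Sum>i\<in>I. \<Sum>j\<in>I. norm (a i) * norm (a j) * exp (- ((u j - u i)^2) / 2))"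
    unfolding eq
    by (intro sum_norm_le order.trans[OF norm_sum]) (simp add: norm_mult sum_mono)
  also have "\<dots> \<le> (\<Sum>i\<in>I. \<Sum>j\<in>I. norm (a i) * norm (a j) * (exp (1/2) * exp (- \<bar>u j - u i\<bar>)))"
    by (intro sum_mono mult_left_mono exp_neg_square_le) auto
  also have "\<dots> = exp (1/2) * Q"
    unfolding Q_def by (simp add: sum_distrib_left mult_ac abs_minus_commute)
  finally have gauss: "LINT x|\<nu>. (norm (E (\<tau> + x)))^2 \<le> exp (1/2) * Q" .
  have "integrable \<nu> (\<lambda>x. (norm (E (\<tau> + x)))^2)"
    using boundE by (intro \<nu>.integrable_const_bound[where B="(\<Sum>i\<in>I. norm (a i))^2"])
      (auto intro!: power_mono simp: \<nu>_def)
  hence int1: "integrable lborel (\<lambda>x. std_normal_density x * (norm (E (\<tau> + x)))^2)"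
    unfolding \<nu>_def by (subst (asm) integrable_density) (auto simp: normal_density_nonneg)
  have int2: "set_integrable lborel {\<tau>..\<tau>+1} (\<lambda>t. (norm (E t))^2)"
    by (intro borel_integrable_atLeastAtMost' continuous_intros continuous_on_subset[OF contE]) auto
  have "integral {\<tau>..\<tau>+1} (\<lambda>t. (norm (E t))^2) = (LBINT t:{\<tau>..\<tau>+1}. (norm (E t))^2)"
    using int2 by (rule set_borel_integral_eq_integral(2)[symmetric])
  also have "\<dots> = (LBINT t. indicator {\<tau>..\<tau>+1} t * (norm (E t))^2)"
    by (simp add: set_lebesgue_integral_def)
  also have "\<dots> = (LBINT x. indicator {\<tau>..\<tau>+1} (\<tau> + 1 * x) * (norm (E (\<tau> + 1 * x)))^2)"
    by (subst lborel_integral_real_affine[where c=1 and t=\<tau>]) auto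
  also have "\<dots> = (LBINT x. indicator {0..1} x * (norm (E (\<tau> + x)))^2)"
    by (intro Bochner_Integration.integral_cong refl) (auto simp: indicator_def)
  \<comment> \<open>The constant is the reciprocal of the density at x = 1, its least value on
    [0,1]. The further factor exp (1/2) in the final bound stems from replacing the Gaussian by the
    exponential of -|v|.\<close>
  also have "\<dots> \<le> (LBINT x. sqrt (2 * pi) * exp (1/2) * (std_normal_density x * (norm (E (\<tau> + x)))^2))"
  proof (rule integral_mono)
    have "integrable lborel (\<lambda>x. indicator {\<tau>..\<tau>+1} (\<tau> + 1 * x) * (norm (E (\<tau> + 1 * x)))^2)"
      using int2 by (intro lborel_integrable_real_affine) (auto simp: set_integrable_def)
    also have "(\<lambda>x. indicator {\<tau>..\<tau>+1} (\<tau> + 1 * x) * (norm (E (\<tau> + 1 * x)))^2) =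
                 (\<lambda>x. indicator {0..1} x * (norm (E (\<tau> + x)))^2)"
      by (auto simp: indicator_def fun_eq_iff)
    finally show "integrable lborel (\<lambda>x. indicator {0..1} x * (norm (E (\<tau> + x)))^2)" .
    show "integrable lborel (\<lambda>x. sqrt (2 * pi) * exp (1/2) * (std_normal_density x * (norm (E (\<tau> + x)))^2))"
      using int1 by (rule integrable_mult_right)
    fix x :: real
    show "indicator {0..1} x * (norm (E (\<tau> + x)))^2 \<le>
        sqrt (2 * pi) * exp (1/2) * (std_normal_density x * (norm (E (\<tau> + x)))^2)"
    proof (cases "x \<in> {0..1}")
      case True
      have "x^2 \<le> 1" using True by (auto simp: power_le_one)
      hence "1 \<le> exp (1/2 - x^2/2)" by simp
      also have "\<dots> = sqrt (2 * pi) * exp (1/2) * std_normal_density x"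
        by (simp add: std_normal_density_def field_simps real_sqrt_mult flip: exp_add)
      finally have "1 * (norm (E (\<tau> + x)))^2 \<le> sqrt (2 * pi) * exp (1/2) * std_normal_density x * (norm (E (\<tau> + x)))^2"
        by (intro mult_right_mono) auto
      thus ?thesis using True by (simp add: mult_ac)
    qed (auto simp: normal_density_nonneg)
  qed
  also have "\<dots> = sqrt (2 * pi) * exp (1/2) * (LINT x|\<nu>. (norm (E (\<tau> + x)))^2)"
    unfolding \<nu>_def by (subst integral_density) (auto simp: normal_density_nonneg)
  also have "\<dots> \<le> sqrt (2 * pi) * exp (1/2) * (exp (1/2) * Q)"
    using gauss by (intro mult_left_mono) auto
  also have "\<dots> = sqrt (2 * pi) * exp 1 * Q"
    using exp_add[of "1/2::real" "1/2"] by (simp add: mult_ac)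
  finally show ?thesis unfolding E_def Q_def .
qed

text \<open>This is n^(-s) with s = \<sigma> + i t, split into modulus and phase so that t enters
  only through the frequency ln n. It is 0 at n = 0, because \<open>0 powr x = 0\<close>, so sums
  may include or omit that index.\<close>

definition dpow :: "real \<Rightarrow> real \<Rightarrow> nat \<Rightarrow> complex" where
  "dpow \<sigma> t n = complex_of_real (real n powr - \<sigma>) * cis (- (t * ln (real n)))"

lemma dpow_mult: "dpow \<sigma> t (m * n) = dpow \<sigma> t m * dpow \<sigma> t n"
proof (cases "m = 0 \<or> n = 0")
  case False
  thus ?thesis
    by (auto simp: dpow_def powr_mult ln_mult cis_mult algebra_simps)
qed (auto simp: dpow_def)

lemma norm_dpow [simp]: "norm (dpow \<sigma> t n) = real n powr - \<sigma>"
  by (simp add: dpow_def norm_mult)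

lemma dpow_1 [simp]: "dpow \<sigma> t (Suc 0) = 1" "dpow \<sigma> t 1 = 1"
  by (simp_all add: dpow_def)

lemma continuous_on_dpow [continuous_intros]: "continuous_on A (\<lambda>t. dpow \<sigma> t n)"
  unfolding dpow_def by (intro continuous_intros)

text \<open>By symmetry one may take n <= m, where the exponential is n / m. The factor n cancels
  n^(-\<sigma>), so Chebyshev's bound for the sum over n leaves a multiple of
  \<open>Lam m / m\<close>, to be summed by Mertens.\<close>

lemma mangoldt_double_sum_le:
  assumes \<sigma>: "\<sigma> \<ge> 1" and N: "N \<ge> 1"
  shows "(\<Sum>m=1..N. \<Sum>n=1..N. Lam m * real m powr -\<sigma> * (Lam n * real n powr -\<sigma>) * 
            exp (- \<bar>ln (real m) - ln (real n)\<bar>)) \<le> 8 * (ln (real N) + 4)"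
proof -
  define G where "G m n = Lam m * real m powr -\<sigma> * (Lam n * real n powr -\<sigma>) * 
            exp (- \<bar>ln (real m) - ln (real n)\<bar>)" for m n
  have G_sym: "G m n = G n m" for m n unfolding G_def by (simp add: abs_minus_commute mult_ac)
  have G_nonneg: "G m n \<ge> 0" for m n
    unfolding G_def by (intro mult_nonneg_nonneg mangoldt_nonneg) auto
  have "(\<Sum>m=1..N. \<Sum>n=1..N. G m n) \<le> (\<Sum>m=1..N. \<Sum>n=1..N. (if m \<le> n then G m n else 0) + (if n \<le> m then G m n else 0))"
    using G_nonneg by (intro sum_mono) auto
  also have "\<dots> = (\<Sum>m=1..N. \<Sum>n=1..N. (if m \<le> n then G m n else 0)) + (\<Sum>m=1..N. \<Sum>n=1..N. (if n \<le> m then G n m else 0))"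
    unfolding sum.distrib by (intro arg_cong2[of _ _ _ _ "(+)"] sum.cong refl if_cong G_sym)
  also have "(\<Sum>m=1..N. \<Sum>n=1..N. (if m \<le> n then G m n else 0)) = (\<Sum>m=1..N. \<Sum>n=1..N. (if n \<le> m then G n m else 0))"
    by (rule sum.swap)
  also have "\<dots> + \<dots> = 2 * (\<Sum>m=1..N. \<Sum>n=1..N. (if n \<le> m then G n m else 0))" by simp
  also have "(\<Sum>m=1..N. \<Sum>n=1..N. (if n \<le> m then G n m else 0)) \<le> (\<Sum>m=1..N. 4 * (Lam m / real m))"
  proof (rule sum_mono)
    fix m assume m: "m \<in> {1..N}"
    have "(\<Sum>n=1..N. (if n \<le> m then G n m else 0)) = (\<Sum>n=1..m. G n m)"
      using m by (intro sum.mono_neutral_cong_right) auto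
    also have "\<dots> \<le> (\<Sum>n=1..m. Lam n * (Lam m / real m ^ 2))"
    proof (rule sum_mono)
      fix n assume n: "n \<in> {1..m}"
      have "exp (- \<bar>ln (real n) - ln (real m)\<bar>) = real n / real m"
        using n m by (cases "n = m") (auto simp: abs_if exp_diff)
      hence "G n m = Lam n * Lam m * (real n powr -\<sigma> * real n) * (real m powr -\<sigma> / real m)"
        unfolding G_def by simp
      also have "\<dots> \<le> Lam n * Lam m * 1 * (1 / real m ^ 2)"
      proof (intro mult_mono mult_nonneg_nonneg mangoldt_nonneg order.refl)
        have "real n powr -\<sigma> \<le> real n powr - 1" using n \<sigma> by (intro powr_mono) auto
        hence "real n powr -\<sigma> * real n \<le> real n powr -1 * real n" by (intro mult_right_mono) auto
        thus "real n powr -\<sigma> * real n \<le> 1" using n by (simp add: powr_minus)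
        have "real m powr -\<sigma> \<le> real m powr - 1" using m \<sigma> by (intro powr_mono) auto
        also have "\<dots> = 1 / real m" using m by (simp add: powr_minus field_simps)
        finally show "real m powr -\<sigma> / real m \<le> 1 / real m ^ 2" 
          using m by (simp add: field_simps power2_eq_square)
      qed auto
      finally show "G n m \<le> Lam n * (Lam m / real m ^ 2)" by simp
    qed
    also have "\<dots> = (\<Sum>n=1..m. Lam n) * (Lam m / real m ^ 2)" by (rule sum_distrib_right [symmetric])
    also have "\<dots> \<le> 4 * real m * (Lam m / real m ^ 2)"
      by (intro mult_right_mono sum_mangoldt_le) (auto intro!: divide_nonneg_nonneg mangoldt_nonneg)
    also have "\<dots> = 4 * (Lam m / real m)" using m by (simp add: power2_eq_square)
    finally show "(\<Sum>n=1..N. (if n \<le> m then G n m else 0)) \<le> 4 * (Lam m / real m)" .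
  qed
  also have "2 * (\<Sum>m=1..N. 4 * (Lam m / real m)) = 8 * (\<Sum>m=1..N. Lam m / real m)"
    by (simp add: sum_distrib_left)
  also have "\<dots> \<le> 8 * (ln (real N) + 4)"
    using sum_mangoldt_over_le[OF N] by simp
  finally show ?thesis unfolding G_def by simp
qed

text \<open>The coefficients are arbitrary in the unit disc, since both f and auxiliary signs have
  to fit, and the bound is the same for every window position \<tau>.\<close>

lemma mean_square_mangoldt:
  assumes \<sigma>: "\<sigma> \<ge> 1" and N: "N \<ge> 1" and c: "\<And>n. norm (c n) \<le> 1"
  shows "integral {\<tau>..\<tau>+1} (\<lambda>t. (norm (\<Sum>n=1..N. of_real (Lam n) * c n * dpow \<sigma> t n))^2) \<le>
           sqrt (2 * pi) * exp 1 * (8 * (ln (real N) + 4))"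
proof -
  define a where "a n = complex_of_real (Lam n) * c n * of_real (real n powr - \<sigma>)" for n
  have na: "norm (a n) \<le> Lam n * real n powr -\<sigma>" for n
    using mult_right_mono[OF c[of n], of "Lam n * real n powr -\<sigma>"]
    by (simp add: a_def norm_mult mangoldt_nonneg mult_ac)
  have "integral {\<tau>..\<tau>+1} (\<lambda>t. (norm (\<Sum>n=1..N. of_real (Lam n) * c n * dpow \<sigma> t n))^2) =
        integral {\<tau>..\<tau>+1} (\<lambda>t. (norm (\<Sum>n=1..N. a n * cis (- (t * ln (real n)))))^2)"
    by (simp add: a_def dpow_def mult_ac)
  also have "\<dots> \<le> sqrt (2 * pi) * exp 1 * 
     (\<Sum>m=1..N. \<Sum>n=1..N. norm (a m) * norm (a n) * exp (- \<bar>ln (real m) - ln (real n)\<bar>))"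
    by (rule mean_square_window) auto
  also have "\<dots> \<le> sqrt (2 * pi) * exp 1 * (\<Sum>m=1..N. \<Sum>n=1..N. Lam m * real m powr -\<sigma> * (Lam n * real n powr -\<sigma>) * 
            exp (- \<bar>ln (real m) - ln (real n)\<bar>))"
    by (intro mult_left_mono sum_mono mult_mono na mult_nonneg_nonneg mangoldt_nonneg) auto
  also have "\<dots> \<le> sqrt (2 * pi) * exp 1 * (8 * (ln (real N) + 4))"
    by (intro mult_left_mono mangoldt_double_sum_le \<sigma> N) auto
  finally show ?thesis .
qed

text \<open>Three quarters of the kernel 1 / (1 + t^2): still summable over unit windows, since it
  decays like |t|^(-3/2), while the remaining power -1/4 is free to beat the trivial bound for the
  Dirichlet series at large t.\<close>

definition decay_weight :: "real \<Rightarrow> real" where "decay_weight t = (1 + t^2) powr (-3/4)"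

lemma continuous_on_decay_weight [continuous_intros]: "continuous_on A decay_weight"
  unfolding decay_weight_def by (intro continuous_intros) (auto simp: add_nonneg_eq_0_iff)

lemma decay_weight_pos: "decay_weight t > 0"
  unfolding decay_weight_def using zero_le_power2[of t] by (auto simp: add_nonneg_eq_0_iff)

lemma decay_weight_antimono: "\<bar>s\<bar> \<le> \<bar>t\<bar> \<Longrightarrow> decay_weight t \<le> decay_weight s"
  unfolding decay_weight_def by (intro powr_mono2') (auto simp: abs_le_square_iff add_pos_nonneg)

lemma summable_decay_weight: "summable (\<lambda>j. decay_weight (real j))"
proof (rule summable_comparison_test_ev)
  show "summable (\<lambda>n. real n powr (-3/2))" by (subst summable_real_powr_iff) auto
  show "\<forall>\<^sub>F n in sequentially. norm (decay_weight (real n)) \<le> real n powr (-3/2)"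
    using eventually_gt_at_top[of 0]
  proof eventually_elim
    case (elim n)
    have "decay_weight (real n) \<le> (real n ^ 2) powr (-3/4)"
      unfolding decay_weight_def using elim by (intro powr_mono2') auto
    also have "\<dots> = real n powr (-3/2)"
      using elim by (simp add: powr_powr flip: powr_numeral)
    finally show ?case using decay_weight_pos[of "real n"] by simp
  qed
qed

text \<open>The line is cut at the integers: the two unit windows at distance j from 0 carry weight
  at most \<open>decay_weight\<close> of j, whence the factor 2 and a bound free of T.\<close>

lemma weighted_integral_le:
  assumes cont: "continuous_on UNIV g" and nonneg: "\<And>t. g t \<ge> (0::real)"
    and win: "\<And>\<tau>. integral {\<tau>..\<tau>+1} g \<le> M"
  shows "integral {- real T..real T} (\<lambda>t. g t * decay_weight t) \<le> 2 * (\<Sum>j. decay_weight (real j)) * M"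
proof -
  have M: "M \<ge> 0"
    using win[of 0] integral_nonneg[of g "{0..0+1}"] nonneg
      integrable_continuous_real[OF continuous_on_subset[OF cont], of 0 1] by force
  have int: "(\<lambda>t. g t * decay_weight t) integrable_on {a..b}" for a b
    by (intro integrable_continuous_real continuous_intros continuous_on_subset[OF cont]) auto
  have intg: "g integrable_on {a..b}" for a b
    by (intro integrable_continuous_real continuous_intros continuous_on_subset[OF cont]) auto
  have "integral {- real T..real T} (\<lambda>t. g t * decay_weight t) \<le> 2 * M * (\<Sum>j<T. decay_weight (real j))"
  proof (induction T)
    case (Suc T)
    have 1: "integral {a..a+1} (\<lambda>t. g t * decay_weight t) \<le> M * decay_weight (real T)"
      if "\<And>t. t \<in> {a..a+1} \<Longrightarrow> \<bar>real T\<bar> \<le> \<bar>t\<bar>" for a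
    proof -
      have "integral {a..a+1} (\<lambda>t. g t * decay_weight t) \<le> integral {a..a+1} (\<lambda>t. g t * decay_weight (real T))"
        using intg that nonneg by (intro integral_le int integrable_on_mult_left mult_left_mono decay_weight_antimono) auto
      also have "\<dots> = integral {a..a+1} g * decay_weight (real T)" by simp
      also have "\<dots> \<le> M * decay_weight (real T)" using win[of a] decay_weight_pos[of "real T"] by (intro mult_right_mono) auto
      finally show ?thesis .
    qed
    have "integral {- real (Suc T)..real (Suc T)} (\<lambda>t. g t * decay_weight t) = 
       integral {- real T - 1..- real T} (\<lambda>t. g t * decay_weight t) + 
       (integral {- real T..real T} (\<lambda>t. g t * decay_weight t) + integral {real T..real T + 1} (\<lambda>t. g t * decay_weight t))"
      using Henstock_Kurzweil_Integration.integral_combine[where a="- real T - 1" and c="-real T" and b="real T + 1", OF _ _ int]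
            Henstock_Kurzweil_Integration.integral_combine[where a="- real T" and c="real T" and b="real T + 1", OF _ _ int]
      by (simp add: add.commute minus_diff_commute diff_diff_eq algebra_simps)
    also have "\<dots> \<le> M * decay_weight (real T) + (2 * M * (\<Sum>j<T. decay_weight (real j)) + M * decay_weight (real T))"
      using 1[of "- real T - 1"] 1[of "real T"] Suc.IH by (intro add_mono) auto
    finally show ?case by (simp add: algebra_simps)
  qed auto
  also have "\<dots> \<le> 2 * M * (\<Sum>j. decay_weight (real j))"
    using M by (intro mult_left_mono sum_le_suminf summable_decay_weight) (auto simp: less_imp_le[OF decay_weight_pos])
  finally show ?thesis by (simp add: mult_ac)
qed

text \<open>On each window 2 x y <= x^2 + y^2 takes the place of Cauchy-Schwarz. The constant K
  depends neither on the coefficients nor on \<sigma>, N or T.\<close>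

lemma bilinear_mean_value:
  obtains K where "K > 0" and
    "\<And>\<sigma> N c c' T. \<sigma> \<ge> 1 \<Longrightarrow> N \<ge> 1 \<Longrightarrow> (\<And>n. norm (c n) \<le> 1) \<Longrightarrow> (\<And>n. norm (c' n) \<le> 1) \<Longrightarrow>
      integral {- real T..real T} (\<lambda>t. norm (\<Sum>n=1..N. of_real (Lam n) * c n * dpow \<sigma> t n) *
         norm (\<Sum>n=1..N. of_real (Lam n) * c' n * dpow \<sigma> t n) * decay_weight t) \<le> K * (ln (real N) + 4)"
proof -
  define K where "K = 2 * (\<Sum>j. decay_weight (real j)) * (sqrt (2 * pi) * exp 1 * 8)"
  have Kpos: "K > 0" unfolding K_def
    by (intro mult_pos_pos suminf_pos summable_decay_weight decay_weight_pos) auto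
  show ?thesis
  proof (rule that[OF Kpos])
    fix \<sigma> :: real and N :: nat and c c' :: "nat \<Rightarrow> complex" and T :: nat
    assume \<sigma>: "\<sigma> \<ge> 1" and N: "N \<ge> 1" and c: "\<And>n. norm (c n) \<le> 1" and c': "\<And>n. norm (c' n) \<le> 1"
    define P where "P c t = norm (\<Sum>n=1..N. of_real (Lam n) * c n * dpow \<sigma> t n)" for c :: "nat \<Rightarrow> complex" and t
    have cont: "continuous_on A (P c)" for A c
      unfolding P_def by (intro continuous_intros)
    have "integral {\<tau>..\<tau>+1} (\<lambda>t. P c t * P c' t) \<le> sqrt (2 * pi) * exp 1 * (8 * (ln (real N) + 4))" for \<tau>
    proof -
      have "integral {\<tau>..\<tau>+1} (\<lambda>t. P c t * P c' t) \<le> integral {\<tau>..\<tau>+1} (\<lambda>t. (P c t)^2 / 2 + (P c' t)^2 / 2)"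
      proof (intro integral_le integrable_continuous_real continuous_intros cont)
        fix t show "P c t * P c' t \<le> (P c t)^2 / 2 + (P c' t)^2 / 2"
          using sum_squares_bound[of "P c t" "P c' t"] by simp
      qed auto
      also have "\<dots> = integral {\<tau>..\<tau>+1} (\<lambda>t. (P c t)^2) / 2 + integral {\<tau>..\<tau>+1} (\<lambda>t. (P c' t)^2) / 2"
        by (subst Henstock_Kurzweil_Integration.integral_add)
           (auto intro!: integrable_continuous_real continuous_intros cont)
      also have "\<dots> \<le> sqrt (2 * pi) * exp 1 * (8 * (ln (real N) + 4)) / 2 + sqrt (2 * pi) * exp 1 * (8 * (ln (real N) + 4)) / 2"
        unfolding P_def by (intro add_mono divide_right_mono mean_square_mangoldt \<sigma> N c c') auto
      finally show ?thesis by (simp add: mult_ac)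
    qed
    hence "integral {- real T..real T} (\<lambda>t. (P c t * P c' t) * decay_weight t) \<le> 
             2 * (\<Sum>j. decay_weight (real j)) * (sqrt (2 * pi) * exp 1 * (8 * (ln (real N) + 4)))"
      by (intro weighted_integral_le continuous_intros cont) (auto simp: P_def)
    thus "integral {- real T..real T} (\<lambda>t. norm (\<Sum>n=1..N. of_real (Lam n) * c n * dpow \<sigma> t n) *
         norm (\<Sum>n=1..N. of_real (Lam n) * c' n * dpow \<sigma> t n) * decay_weight t) \<le> K * (ln (real N) + 4)"
      unfolding P_def K_def by (simp add: mult_ac distrib_left)
  qed
qed

section \<open>A smooth cutoff via Levy inversion\<close>

text \<open>The density decays like exp (-\<sigma> u), which cancels the factor exp (\<sigma> u)
  that appears on the line with real part \<sigma>; Fourier inversion can then be borrowed from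
  probability theory.\<close>

definition expo_distr :: "real \<Rightarrow> real measure" where
  "expo_distr \<sigma> = density lborel (exponential_density \<sigma>)"

lemma real_distribution_expo_distr: "\<sigma> > 0 \<Longrightarrow> real_distribution (expo_distr \<sigma>)"
  unfolding expo_distr_def real_distribution_def real_distribution_axioms_def
  by (auto intro: prob_space_exponential_density)

text \<open>Absence of atoms at both ends of the interval, as Levy inversion demands.\<close>

lemma measure_expo_distr_singleton: assumes "\<sigma> > 0" shows "measure (expo_distr \<sigma>) {a} = 0"
proof -
  have "emeasure (expo_distr \<sigma>) {a} = (\<integral>\<^sup>+x. ennreal (exponential_density \<sigma> x) * indicator {a} x \<partial>lborel)"
    unfolding expo_distr_def by (intro emeasure_density) auto
  also have "\<dots> = 0"
    by (subst nn_integral_0_iff_AE) (auto intro!: AE_I[where N="{a}"] simp: indicator_def)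
  finally show ?thesis by (simp add: measure_def)
qed

lemma measure_expo_distr_Iic:
  assumes s: "\<sigma> > 0" shows "measure (expo_distr \<sigma>) {..a} = (if a < 0 then 0 else 1 - exp (- \<sigma> * a))"
proof (cases "a < 0")
  case True
  have "emeasure (expo_distr \<sigma>) {..a} = (\<integral>\<^sup>+x. ennreal (exponential_density \<sigma> x) * indicator {..a} x \<partial>lborel)"
    unfolding expo_distr_def by (intro emeasure_density) auto
  also have "\<dots> = 0" using True
    by (subst nn_integral_0_iff_AE) (auto simp: indicator_def exponential_density_def)
  finally show ?thesis using True by (simp add: measure_def)
next
  case False
  interpret real_distribution "expo_distr \<sigma>" using s by (rule real_distribution_expo_distr)
  have "distributed (expo_distr \<sigma>) lborel (\<lambda>x. x) (exponential_density \<sigma>)"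
    unfolding distributed_def expo_distr_def
    using distr_id2[of lborel "density lborel (exponential_density \<sigma>)"] by auto
  from exponential_distributedD_le[OF this _ s, of a] False
  have "measure (expo_distr \<sigma>) {x\<in>space (expo_distr \<sigma>). x \<le> a} = 1 - exp (- a * \<sigma>)" by simp
  also have "{x\<in>space (expo_distr \<sigma>). x \<le> a} = {..a}" by (auto simp: expo_distr_def)
  finally show ?thesis using False by (simp add: mult.commute)
qed

lemma char_expo_distr:
  assumes s: "\<sigma> > 0" shows "char (expo_distr \<sigma>) t = \<sigma> / (\<sigma> - \<i> * t)"
proof -
  define c where "c = \<i> * complex_of_real t - complex_of_real \<sigma>"
  have c0: "c \<noteq> 0" and Rec: "Re c = - \<sigma>" using s by (auto simp: c_def complex_eq_iff)
  have nrm: "norm (exp (c * complex_of_real x)) = exp (- \<sigma> * x)" for x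
    by (simp add: Rec norm_exp_eq_Re)
  have "integrable lborel (exponential_density \<sigma>)"
    using prob_space_exponential_density[OF s]
    by (auto intro!: integrableI_nonneg simp: exponential_density_nonneg[OF s] prob_space.emeasure_space_1
         dest!: prob_space.emeasure_space_1 simp: emeasure_density)
  hence int: "set_integrable lborel {0<..} (\<lambda>x. \<sigma> * exp (c * complex_of_real x))"
    unfolding set_integrable_def
    by (rule Bochner_Integration.integrable_bound)
       (use s in \<open>auto simp: indicator_def norm_mult nrm exponential_density_def mult.commute[of _ \<sigma>]
           simp del: norm_exp_eq_Re intro!: AE_I2\<close>)
  have "char (expo_distr \<sigma>) t = (CLBINT x. exponential_density \<sigma> x *\<^sub>R iexp (t * x))"
    unfolding char_def expo_distr_def
    by (subst integral_density) (auto simp: exponential_density_nonneg[OF s])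
  \<comment> \<open>The density is already positive at x = 0, whereas the improper integral runs
    over the open half line; the two integrands differ on a null set only.\<close>
  also have "\<dots> = (CLBINT x. indicator {0<..} x *\<^sub>R (\<sigma> * exp (c * complex_of_real x)))"
  proof (rule integral_cong_AE)
    have "exponential_density \<sigma> x *\<^sub>R iexp (t * x) = indicator {0<..} x *\<^sub>R (\<sigma> * exp (c * complex_of_real x))"
      if "x \<noteq> 0" for x
    proof (cases "x > 0")
      case True
      have "exp (c * complex_of_real x) = complex_of_real (exp (- x * \<sigma>)) * iexp (t * x)"
        unfolding exp_of_real [symmetric] exp_add [symmetric]
        by (intro arg_cong[where f=exp]) (simp add: c_def algebra_simps)
      thus ?thesis using True by (simp add: exponential_density_def scaleR_conv_of_real)
    qed (use that in \<open>auto simp: exponential_density_def\<close>)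
    thus "AE x in lborel. exponential_density \<sigma> x *\<^sub>R iexp (t * x) = 
        indicator {0<..} x *\<^sub>R (\<sigma> * exp (c * complex_of_real x))"
      by (intro AE_I[where N="{0}"]) auto
  qed auto
  also have "\<dots> = (CLBINT x=0..\<infinity>. \<sigma> * exp (c * complex_of_real x))"
    unfolding interval_lebesgue_integral_def set_lebesgue_integral_def zero_ereal_def
    by (simp only: einterval_eq_Ici ereal_less_eq if_True)
  also have "\<dots> = 0 - \<sigma> / c"
  proof (rule interval_integral_FTC_integrable[where F="\<lambda>x. \<sigma> / c * exp (c * complex_of_real x)"])
    fix x :: real
    show "((\<lambda>x. \<sigma> / c * exp (c * complex_of_real x)) has_vector_derivative \<sigma> * exp (c * complex_of_real x)) (at x)"
      using c0 by (auto intro!: derivative_eq_intros has_vector_derivative_real_field)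
    show "isCont (\<lambda>x. \<sigma> * exp (c * complex_of_real x)) x" by (intro continuous_intros)
  next
    show "set_integrable lborel (einterval 0 \<infinity>) (\<lambda>x. \<sigma> * exp (c * complex_of_real x))"
      using int by (simp add: zero_ereal_def)
    show "(((\<lambda>x. \<sigma> / c * exp (c * complex_of_real x)) \<circ> real_of_ereal) \<longlongrightarrow> \<sigma> / c) (at_right 0)"
      unfolding zero_ereal_def ereal_tendsto_simps
      by (rule tendsto_eq_intros refl | simp)+
    show "(((\<lambda>x. \<sigma> / c * exp (c * complex_of_real x)) \<circ> real_of_ereal) \<longlongrightarrow> 0) (at_left \<infinity>)"
      unfolding ereal_tendsto_simps
    proof (rule tendsto_norm_zero_cancel)
      have "((\<lambda>x. \<sigma> / norm c * exp (- \<sigma> * x)) \<longlongrightarrow> \<sigma> / norm c * 0) at_top"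
        using s by (intro tendsto_intros filterlim_compose[OF exp_at_bot]
             filterlim_tendsto_neg_mult_at_bot[OF tendsto_const] filterlim_ident) auto
      thus "((\<lambda>x. norm (\<sigma> / c * exp (c * complex_of_real x))) \<longlongrightarrow> 0) at_top"
        using s by (simp add: norm_mult norm_divide nrm del: norm_exp_eq_Re)
    qed
  qed auto
  also have "\<dots> = \<sigma> / (\<sigma> - \<i> * t)" using c0 by (simp add: c_def field_simps) 
  finally show ?thesis .
qed

text \<open>Up to the factor \<open>exp (\<sigma> * u)\<close>, this is the mass that the exponential distribution gives to
  \<open>{u - h<..u}\<close>; this choice makes the cutoff constant for \<open>u \<ge> h\<close>.\<close>

definition cutoff :: "real \<Rightarrow> real \<Rightarrow> real \<Rightarrow> real" where
  "cutoff \<sigma> h u = (if u \<le> 0 then 0 else if u \<le> h then exp (\<sigma> * u) - 1 else exp (\<sigma> * h) - 1)"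

lemma cutoff_conv_measure:
  assumes s: "\<sigma> > 0" and h: "h > 0"
  shows "cutoff \<sigma> h u = exp (\<sigma> * u) * measure (expo_distr \<sigma>) {u - h<..u}"
proof -
  interpret real_distribution "expo_distr \<sigma>" using s by (rule real_distribution_expo_distr)
  have "measure (expo_distr \<sigma>) {u - h<..u} = measure (expo_distr \<sigma>) ({..u} - {..u-h})"
    by (intro arg_cong[where f="measure _"]) auto
  also have "\<dots> = measure (expo_distr \<sigma>) {..u} - measure (expo_distr \<sigma>) {..u-h}"
    using h by (intro finite_measure_Diff) auto
  finally have eq: "measure (expo_distr \<sigma>) {u - h<..u} = measure (expo_distr \<sigma>) {..u} - measure (expo_distr \<sigma>) {..u-h}" .
  have e: "exp (\<sigma> * u) * exp (- \<sigma> * u) = 1" "exp (\<sigma> * u) * exp (- \<sigma> * (u - h)) = exp (\<sigma> * h)"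
    by (simp_all add: algebra_simps flip: exp_add)
  show ?thesis using h e unfolding eq
    by (auto simp: measure_expo_distr_Iic[OF s] cutoff_def right_diff_distrib)
qed

lemma norm_iexp_diff_le: "norm (iexp x - 1) \<le> \<bar>x\<bar>" "norm (iexp x - 1) \<le> 2"
proof -
  show "norm (iexp x - 1) \<le> \<bar>x\<bar>" using iexp_approx1[of x 0] by simp
  show "norm (iexp x - 1) \<le> 2" using norm_triangle_ineq4[of "iexp x" 1] by simp
qed

text \<open>The kernel of Levy's formula for an interval of length h, times the characteristic
  function, with the phase depending on u taken out. Division by zero gives the value 0 at t = 0,
  which no integral notices.\<close>

definition cutoff_transform :: "real \<Rightarrow> real \<Rightarrow> real \<Rightarrow> complex" where
  "cutoff_transform \<sigma> h t = (iexp (t * h) - 1) / (\<i> * t) * (\<sigma> / (\<sigma> - \<i> * t))"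

text \<open>For |t| <= 1 the kernel is at most h and the characteristic function at most 1; for
  larger |t| each of the two factors is at most 2 / |t|, and their product gives the quadratic
  decay.\<close>

lemma norm_cutoff_transform_le:
  assumes s: "1 \<le> \<sigma>" "\<sigma> \<le> 2" and h: "h > 0"
  shows "norm (cutoff_transform \<sigma> h t) \<le> (2 * h + 8) / (1 + t^2)"
proof (cases "t = 0")
  case False
  define m where "m = norm (complex_of_real \<sigma> - \<i> * t)"
  have m: "m \<ge> \<sigma>" "m \<ge> \<bar>t\<bar>"
    using abs_Re_le_cmod[of "complex_of_real \<sigma> - \<i> * t"] abs_Im_le_cmod[of "complex_of_real \<sigma> - \<i> * t"] s
    by (auto simp: m_def)
  have eq: "norm (cutoff_transform \<sigma> h t) = norm (iexp (t * h) - 1) / \<bar>t\<bar> * (\<sigma> / m)"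
    using s unfolding cutoff_transform_def m_def by (simp add: norm_mult norm_divide)
  have pos: "1 + t^2 > 0" by (simp add: add_pos_nonneg)
  show ?thesis
  proof (cases "\<bar>t\<bar> \<le> 1")
    case True
    have "t^2 \<le> 1" using True by (simp add: abs_square_le_1)
    have "norm (cutoff_transform \<sigma> h t) \<le> (\<bar>t * h\<bar> / \<bar>t\<bar>) * (\<sigma> / \<sigma>)"
      unfolding eq using s m by (intro mult_mono divide_right_mono divide_left_mono norm_iexp_diff_le) auto
    also have "\<dots> = h" using False s h by (simp add: abs_mult)
    also have "h \<le> (2 * h + 8) / (1 + t^2)"
    proof -
      have "h * (1 + t^2) \<le> h * 2" using h \<open>t^2 \<le> 1\<close> by (intro mult_left_mono) auto
      thus ?thesis using pos by (simp add: field_simps)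
    qed
    finally show ?thesis .
  next
    case False
    have t2: "t^2 \<ge> 1" using False abs_le_square_iff[of 1 t] by simp
    have "norm (cutoff_transform \<sigma> h t) \<le> (2 / \<bar>t\<bar>) * (2 / \<bar>t\<bar>)"
      unfolding eq using s m False by (intro mult_mono frac_le norm_iexp_diff_le) auto
    also have "\<dots> = 4 / t^2" by (simp add: power2_eq_square)
    also have "\<dots> = 8 / (2 * t^2)" by simp
    also have "\<dots> \<le> 8 / (1 + t^2)" using t2 pos by (intro frac_le) auto
    also have "\<dots> \<le> (2 * h + 8) / (1 + t^2)" using h pos by (intro divide_right_mono) auto
    finally show ?thesis .
  qed
qed (use h in \<open>auto simp: cutoff_transform_def\<close>)

text \<open>Levy inversion is applied to each \<open>u i\<close> and summed, which brings the
  exponential sum under the integral. A bound for all truncations T passes to the limit, so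
  integrability over the whole line is not an issue.\<close>

lemma cutoff_sum_le:
  fixes a :: "'i \<Rightarrow> complex" and u :: "'i \<Rightarrow> real"
  assumes s: "1 \<le> \<sigma>" "\<sigma> \<le> 2" and h: "h > 0" and fin: "finite I"
    and B: "\<And>T::nat. integral {- real T..real T} 
        (\<lambda>t. norm (\<Sum>i\<in>I. a i * exp (\<sigma> * u i) * cis (t * u i)) * ((2 * h + 8) / (1 + t^2))) \<le> B"
  shows "norm (\<Sum>i\<in>I. a i * cutoff \<sigma> h (u i)) \<le> B"
proof -
  interpret real_distribution "expo_distr \<sigma>" using s by (intro real_distribution_expo_distr) auto
  \<comment> \<open>Levy's formula contains the phase -t u, the hypothesis the phase t u. Since the
    cutoff is real, conjugating the coefficients exchanges them without changing any norm.\<close>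
  define b where "b i = cnj (a i)" for i
  define P where "P t = (\<Sum>i\<in>I. b i * exp (\<sigma> * u i) * cis (- (t * u i)))" for t
  have normP: "norm (P t) = norm (\<Sum>i\<in>I. a i * exp (\<sigma> * u i) * cis (t * u i))" for t
  proof -
    have "P t = cnj (\<Sum>i\<in>I. a i * exp (\<sigma> * u i) * cis (t * u i))"
      unfolding P_def b_def by (simp add: cis_cnj)
    hence "norm (P t) = norm (cnj (\<Sum>i\<in>I. a i * exp (\<sigma> * u i) * cis (t * u i)))" by (rule arg_cong)
    thus ?thesis by (simp only: complex_mod_cnj)
  qed
  have contP: "continuous_on A P" for A unfolding P_def by (intro continuous_intros)
  have measP [measurable]: "P \<in> borel_measurable borel"
    using contP by (rule borel_measurable_continuous_onI)
  have meas [measurable]: "cutoff_transform \<sigma> h \<in> borel_measurable borel" unfolding cutoff_transform_def by measurable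
  have int: "set_integrable lborel {- real T..real T} (\<lambda>t. Q t * cutoff_transform \<sigma> h t)"
    if Q: "continuous_on UNIV Q" for T :: nat and Q :: "real \<Rightarrow> complex"
  proof -
    have "set_integrable lborel {- real T..real T} (\<lambda>t. norm (Q t) * ((2 * h + 8) / (1 + t^2)))"
      by (intro borel_integrable_atLeastAtMost' continuous_intros continuous_on_subset[OF Q])
         (auto simp: add_nonneg_eq_0_iff)
    moreover have [measurable]: "Q \<in> borel_measurable borel" using Q by (rule borel_measurable_continuous_onI)
    ultimately show ?thesis unfolding set_integrable_def
      by (elim Bochner_Integration.integrable_bound)
         (use h in \<open>auto simp: indicator_def norm_mult simp del: times_divide_eq_right
            intro!: AE_I2 mult_left_mono order.trans[OF norm_cutoff_transform_le[OF s h]] divide_nonneg_nonneg\<close>)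
  qed
  define J where "J i T = (CLBINT t:{- real T..real T}. cis (- (t * u i)) * cutoff_transform \<sigma> h t)" for i and T :: nat
  have lim1: "(\<lambda>T::nat. exp (\<sigma> * u i) * (1 / (2*pi) * J i T))
           \<longlonglongrightarrow> complex_of_real (cutoff \<sigma> h (u i))" for i
  proof -
    have "(\<lambda>T::nat. exp (\<sigma> * u i) * (1 / (2*pi) * J i T))
           \<longlonglongrightarrow> exp (\<sigma> * u i) * complex_of_real (measure (expo_distr \<sigma>) {u i - h<..u i})"
    proof (intro tendsto_mult tendsto_const)
      have "(\<lambda>T. 1 / (2 * pi) * (CLBINT t=-T..T. (iexp (-(t * (u i - h))) - iexp (-(t * u i))) / (\<i> * t) * char (expo_distr \<sigma>) t))
    \<longlonglongrightarrow> measure (expo_distr \<sigma>) {u i - h<..u i}"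
        using h s by (intro Levy_Inversion measure_expo_distr_singleton) auto
      moreover have "(CLBINT t=-T..T. (iexp (-(t * (u i - h))) - iexp (-(t * u i))) / (\<i> * t) * char (expo_distr \<sigma>) t) =
          (CLBINT t:{- real T..real T}. cis (- (t * u i)) * cutoff_transform \<sigma> h t)" for T :: nat
      proof -
        have "(iexp (-(t * (u i - h))) - iexp (-(t * u i))) / (\<i> * t) * char (expo_distr \<sigma>) t =
               cis (- (t * u i)) * cutoff_transform \<sigma> h t" for t :: real
        proof -
          have e: "iexp (-(t * (u i - h))) = iexp (-(t * u i)) * iexp (t * h)"
            unfolding exp_add [symmetric] by (simp add: algebra_simps)
          have alg: "(A * B - A) / D * F = A * ((B - 1) / D * F)" for A B D F :: complex
            by (simp add: right_diff_distrib)
          have "char (expo_distr \<sigma>) t = \<sigma> / (\<sigma> - \<i> * t)" using s by (intro char_expo_distr) auto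
          thus ?thesis unfolding e cutoff_transform_def alg by (simp only: cis_conv_exp of_real_minus)
        qed
        thus ?thesis by (simp add: interval_integral_Icc)
      qed
      ultimately show "(\<lambda>T::nat. 1 / (2*pi) * J i T)
           \<longlonglongrightarrow> complex_of_real (measure (expo_distr \<sigma>) {u i - h<..u i})"
        unfolding J_def by (simp only:)
    qed
    moreover have "\<sigma> > 0" using s by simp
    ultimately show ?thesis by (simp add: cutoff_conv_measure[OF \<open>\<sigma> > 0\<close> h])
  qed
  have lim0: "(\<lambda>T::nat. \<Sum>i\<in>I. b i * (exp (\<sigma> * u i) * (1 / (2*pi) * J i T)))
           \<longlonglongrightarrow> (\<Sum>i\<in>I. b i * complex_of_real (cutoff \<sigma> h (u i)))"
    by (intro tendsto_sum tendsto_mult tendsto_const lim1)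
  have eq: "(\<Sum>i\<in>I. b i * (exp (\<sigma> * u i) * (1 / (2*pi) * J i T))) =
         1 / (2*pi) * (CLBINT t:{- real T..real T}. P t * cutoff_transform \<sigma> h t)" for T
  proof -
    have "(CLBINT t:{- real T..real T}. P t * cutoff_transform \<sigma> h t) = 
          (CLBINT t:{- real T..real T}. (\<Sum>i\<in>I. (b i * exp (\<sigma> * u i)) * (cis (- (t * u i)) * cutoff_transform \<sigma> h t)))"
      unfolding P_def by (simp only: sum_distrib_right mult.assoc)
    also have "\<dots> = (\<Sum>i\<in>I. CLBINT t:{- real T..real T}. (b i * exp (\<sigma> * u i)) * (cis (- (t * u i)) * cutoff_transform \<sigma> h t))"
      unfolding set_lebesgue_integral_def scaleR_sum_right
      by (intro Bochner_Integration.integral_sum, fold set_integrable_def)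
         (intro set_integrable_mult_right int continuous_intros)
    also have "\<dots> = (\<Sum>i\<in>I. (b i * exp (\<sigma> * u i)) * J i T)"
      unfolding J_def by (intro sum.cong refl set_integral_mult_right)
    finally show ?thesis
      by (simp add: sum_distrib_left mult_ac)
  qed
  have lim: "(\<lambda>T. norm (1 / (2*pi) * (CLBINT t:{- real T..real T}. P t * cutoff_transform \<sigma> h t)))
      \<longlonglongrightarrow> norm (\<Sum>i\<in>I. b i * complex_of_real (cutoff \<sigma> h (u i)))"
    using tendsto_norm[OF lim0] unfolding eq .
  have "norm (\<Sum>i\<in>I. b i * complex_of_real (cutoff \<sigma> h (u i))) \<le> B"
  proof (rule LIMSEQ_le_const2[OF lim], intro exI[of _ 0] allI impI)
    fix T :: nat
    have intn: "set_integrable lborel {- real T..real T} (\<lambda>t. norm (P t) * ((2 * h + 8) / (1 + t^2)))"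
      by (intro borel_integrable_atLeastAtMost' continuous_intros contP) (auto simp: add_nonneg_eq_0_iff)
    have 1: "norm (CLBINT t:{- real T..real T}. P t * cutoff_transform \<sigma> h t) \<le> (LBINT t:{- real T..real T}. norm (P t * cutoff_transform \<sigma> h t))"
      by (intro set_integral_norm_bound int contP)
    have 2: "(LBINT t:{- real T..real T}. norm (P t * cutoff_transform \<sigma> h t)) \<le>
             (LBINT t:{- real T..real T}. norm (P t) * ((2 * h + 8) / (1 + t^2)))"
    proof (intro set_integral_mono intn set_integrable_norm int contP)
      fix t show "norm (P t * cutoff_transform \<sigma> h t) \<le> norm (P t) * ((2 * h + 8) / (1 + t^2))"
        unfolding norm_mult by (intro mult_left_mono norm_cutoff_transform_le s h norm_ge_zero)
    qed
    have 3: "(LBINT t:{- real T..real T}. norm (P t) * ((2 * h + 8) / (1 + t^2))) \<le> B"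
      by (rule ord_eq_le_trans[OF set_borel_integral_eq_integral(2)[OF intn]]) (use B[of T] in \<open>simp only: normP\<close>)
    have le: "norm (CLBINT t:{- real T..real T}. P t * cutoff_transform \<sigma> h t) \<le> B"
      using 1 2 3 by (rule order.trans[OF order.trans])
    have "norm (1 / (2*pi) * (CLBINT t:{- real T..real T}. P t * cutoff_transform \<sigma> h t)) = 
            1 / (2*pi) * norm (CLBINT t:{- real T..real T}. P t * cutoff_transform \<sigma> h t)"
      by (simp add: norm_mult norm_divide)
    also have "\<dots> \<le> 1 * norm (CLBINT t:{- real T..real T}. P t * cutoff_transform \<sigma> h t)"
      using pi_gt3 by (intro mult_right_mono) auto
    finally show "norm (1 / (2*pi) * (CLBINT t:{- real T..real T}. P t * cutoff_transform \<sigma> h t)) \<le> B" using le by simp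
  qed
  also have "(\<Sum>i\<in>I. b i * complex_of_real (cutoff \<sigma> h (u i))) = cnj (\<Sum>i\<in>I. a i * complex_of_real (cutoff \<sigma> h (u i)))"
    by (simp add: b_def)
  finally show ?thesis by (simp only: complex_mod_cnj)
qed

section \<open>The smoothed convolution identity\<close>

locale bounded_multiplicative =
  fixes f :: "nat \<Rightarrow> complex"
  assumes f_1 [simp]: "f (Suc 0) = 1"
    and f_mult: "\<And>m n. m > 0 \<Longrightarrow> n > 0 \<Longrightarrow> coprime m n \<Longrightarrow> f (m * n) = f m * f n"
    and norm_f_le: "\<And>n. norm (f n) \<le> 1"

text \<open>Stirling combined with 1 + ln x <= x at x = v / M. Estimating each term by ln v would
  lose a logarithm.\<close>

lemma sum_ln_ratio_le:
  assumes v: "v \<ge> 1"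
  shows "(\<Sum>n=1..nat \<lfloor>v\<rfloor>. ln (v / real n)) \<le> v"
proof -
  define M where "M = nat \<lfloor>v\<rfloor>"
  have M: "M \<ge> 1" "real M \<le> v" using v unfolding M_def by linarith+
  have "(\<Sum>n=1..M. ln (v / real n)) = (\<Sum>n=1..M. ln v - ln (real n))"
    using v by (intro sum.cong refl) (simp add: ln_div)
  also have "\<dots> = real M * ln v - ln (fact M)"
  proof -
    have "ln (fact M) = (\<Sum>n=1..M. ln (real n))" by (auto simp: fact_prod intro!: ln_prod)
    thus ?thesis by (simp add: sum_subtractf)
  qed
  also have "\<dots> \<le> real M * (ln (v / real M) + 1)"
    using ln_fact_ge[of M] M v by (simp add: ln_div algebra_simps)
  also have "\<dots> \<le> real M * (v / real M)"
    using ln_le_minus_one[of "v / real M"] M v by (intro mult_left_mono) auto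
  also have "\<dots> = v" using M by simp
  finally show ?thesis unfolding M_def .
qed

lemma card_multiples_le:
  assumes "p > 0" "x \<ge> 0"
  shows "real (card {m\<in>{1..N}. real m \<le> x \<and> p dvd m}) \<le> x / real p"
proof -
  have "{m\<in>{1..N}. real m \<le> x \<and> p dvd m} \<subseteq> (\<lambda>j. p * j) ` {1..nat \<lfloor>x / real p\<rfloor>}"
  proof
    fix m assume m: "m \<in> {m\<in>{1..N}. real m \<le> x \<and> p dvd m}"
    then obtain j where j: "m = p * j" by auto
    have "real j \<le> x / real p" using m j assms by (auto simp: field_simps)
    hence "j \<le> nat \<lfloor>x / real p\<rfloor>" by (simp add: le_nat_floor)
    moreover have "j \<ge> 1" using m j by (cases j) auto
    ultimately show "m \<in> (\<lambda>j. p * j) ` {1..nat \<lfloor>x / real p\<rfloor>}" using j by auto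
  qed
  hence "card {m\<in>{1..N}. real m \<le> x \<and> p dvd m} \<le> card {1..nat \<lfloor>x / real p\<rfloor>}"
    by (rule surj_card_le[rotated]) simp
  hence "real (card {m\<in>{1..N}. real m \<le> x \<and> p dvd m}) \<le> real (nat \<lfloor>x / real p\<rfloor>)" by simp
  also have "\<dots> \<le> x / real p" using assms by simp
  finally show ?thesis .
qed

text \<open>The weight k takes values in [0,1] and vanishes on u <= 0, so terms of
  \<open>T v\<close> with n >= v are 0 and the fixed range {1..N} is harmless for all v <=
  N.\<close>

locale smoothed_sum = bounded_multiplicative +
  fixes k :: "real \<Rightarrow> real" and N :: nat
  assumes k_nonneg: "\<And>u. k u \<ge> 0" and k_le_1: "\<And>u. k u \<le> 1" and k_0: "\<And>u. u \<le> 0 \<Longrightarrow> k u = 0"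
    and N_pos: "N \<ge> 1"
begin

definition T :: "real \<Rightarrow> complex" where
  "T v = (\<Sum>n=1..N. f n * of_real (k (ln (v / real n))))"

definition V :: "real \<Rightarrow> complex" where
  "V v = (\<Sum>e=1..N. of_real (Lam e) * f e * T (v / real e))"

lemma k_eq_0: "v > 0 \<Longrightarrow> n > 0 \<Longrightarrow> v \<le> real n \<Longrightarrow> k (ln (v / real n)) = 0"
  by (intro k_0) (simp add: ln_div)

lemma norm_f_k_le: "norm (f n * of_real (k u)) \<le> 1"
  using norm_f_le[of n] k_nonneg[of u] k_le_1[of u] by (simp add: norm_mult mult_le_one)

lemma norm_T_le:
  assumes v: "v > 0"
  shows "norm (T v) \<le> v"
proof -
  have "norm (T v) \<le> (\<Sum>n=1..N. if real n \<le> v \<and> 1 dvd n then 1 else 0)"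
    unfolding T_def
  proof (intro sum_norm_le)
    fix n assume n: "n \<in> {1..N}"
    show "norm (f n * of_real (k (ln (v / real n)))) \<le> (if real n \<le> v \<and> 1 dvd n then 1 else 0)"
      using norm_f_k_le[of n] k_eq_0[of v n] v n by auto
  qed
  also have "\<dots> = real (card {m\<in>{1..N}. real m \<le> v \<and> 1 dvd m})"
    by (subst sum.inter_filter [symmetric]) auto
  also have "\<dots> \<le> v / real 1" using v by (intro card_multiples_le) auto
  finally show ?thesis by simp
qed

text \<open>The cost of writing ln n for ln v under the smoothed sum: it is linear in v, hence
  negligible after division by a logarithm.\<close>

lemma weighted_log_sum_le:
  assumes v: "v \<ge> 1" "v \<le> real N"
  shows "norm (\<Sum>n=1..N. f n * of_real (ln (v / real n) * k (ln (v / real n)))) \<le> v"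
proof -
  have "norm (\<Sum>n=1..N. f n * of_real (ln (v / real n) * k (ln (v / real n))))
        \<le> (\<Sum>n=1..N. if real n \<le> v then ln (v / real n) else 0)"
  proof (intro sum_norm_le)
    fix n assume n: "n \<in> {1..N}"
    show "norm (f n * of_real (ln (v / real n) * k (ln (v / real n)))) \<le> (if real n \<le> v then ln (v / real n) else 0)"
    proof (cases "real n \<le> v")
      case True
      hence l: "ln (v / real n) \<ge> 0" using n by simp
      have "norm (f n * of_real (ln (v / real n) * k (ln (v / real n)))) = 
            ln (v / real n) * norm (f n * of_real (k (ln (v / real n))))"
        using l by (simp add: norm_mult)
      also have "\<dots> \<le> ln (v / real n) * 1"
        using l by (intro mult_left_mono norm_f_k_le)
      finally show ?thesis using True by simp
    next
      case False
      thus ?thesis using k_eq_0[of v n] v n by simp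
    qed
  qed
  also have "\<dots> = (\<Sum>n=1..nat \<lfloor>v\<rfloor>. ln (v / real n))"
    using v by (intro sum.mono_neutral_cong_right) (auto simp: le_nat_floor; linarith)+
  also have "\<dots> \<le> v" using v by (intro sum_ln_ratio_le)
  finally show ?thesis .
qed

lemma not_coprime_primepow:
  assumes "primepow (e :: nat)" "\<not> coprime e m"
  shows "aprimedivisor e dvd m"
proof -
  from assms(1) obtain p j where p: "prime p" "j > 0" "e = p ^ j"
    unfolding primepow_def by auto
  hence "\<not> coprime p m" using assms(2) coprime_power_left_iff[of p j m] by blast
  hence "p dvd m" using p(1) by (metis prime_imp_coprime)
  thus ?thesis using p by (simp add: aprimedivisor_prime_power)
qed

text \<open>Expand ln n over the divisors e of n and split f n as f e * f (n div e). The splitting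
  fails only for e = p^k and p dividing the cofactor m; there are at most v / (e p) such m, each
  costing at most 2 * \<open>Lam e\<close>.\<close>

lemma log_sum_convolution:
  assumes v: "v \<ge> 1" "v \<le> real N"
  shows "norm ((\<Sum>n=1..N. f n * of_real (ln (real n) * k (ln (v / real n)))) - V v) \<le>
          2 * v * (\<Sum>e=1..N. Lam e / (real e * real (aprimedivisor e)))"
proof -
  define g where "g e m = of_real (Lam e) * f (e * m) * of_real (k (ln (v / real (e * m))))" for e m
  define g' where "g' e m = of_real (Lam e) * (f e * f m) * of_real (k (ln (v / real (e * m))))" for e m
  have "(\<Sum>n=1..N. f n * of_real (ln (real n) * k (ln (v / real n)))) = (\<Sum>n=1..N. \<Sum>e | e dvd n. g e (n div e))"
  proof (intro sum.cong refl)
    fix n assume n: "n \<in> {1..N}"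
    have "(\<Sum>e | e dvd n. g e (n div e)) = (\<Sum>e | e dvd n. of_real (Lam e) * (f n * of_real (k (ln (v / real n)))))"
      by (intro sum.cong refl) (simp add: g_def del: of_nat_mult)
    also have "\<dots> = of_real (\<Sum>e | e dvd n. Lam e) * (f n * of_real (k (ln (v / real n))))"
      by (simp add: sum_distrib_right)
    also have "(\<Sum>e | e dvd n. Lam e) = ln (real n)"
      using n by (subst mangoldt_sum) auto
    finally show "f n * of_real (ln (real n) * k (ln (v / real n))) = (\<Sum>e | e dvd n. g e (n div e))"
      by simp
  qed
  also have "\<dots> = (\<Sum>e=1..N. \<Sum>m=1..N div e. g e m)" by (rule sum_divisors_swap)
  \<comment> \<open>Pairs with e * m > N >= v have weight 0, so the region under the hyperbola may
    be filled up to a square, which is the shape of \<open>V\<close>.\<close>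
  also have "\<dots> = (\<Sum>e=1..N. \<Sum>m=1..N. g e m)"
  proof (rule sum.cong[OF refl], rule sum.mono_neutral_left, safe)
    fix e m assume e: "e \<in> {1..N}" and m: "m \<in> {1..N}" and "m \<notin> {1..N div e}"
    hence "N div e < m" by auto
    hence "N < e * m" using e by (metis atLeastAtMost_iff div_less_iff_less_mult less_le_trans mult.commute zero_less_one)
    hence "v \<le> real (e * m)" using v by linarith
    thus "g e m = 0" unfolding g_def using k_eq_0[of v "e * m"] v e m by (simp del: of_nat_mult)
  next
    fix e m assume "m \<in> {1..N div e}"
    thus "m \<in> {1..N}" using div_le_dividend[of N e] by (auto intro: order.trans)
  qed
  finally have 1: "(\<Sum>n=1..N. f n * of_real (ln (real n) * k (ln (v / real n)))) = (\<Sum>e=1..N. \<Sum>m=1..N. g e m)" .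
  have 2: "V v = (\<Sum>e=1..N. \<Sum>m=1..N. g' e m)"
    unfolding V_def T_def g'_def by (simp add: sum_distrib_left mult_ac)
  have "norm ((\<Sum>e=1..N. \<Sum>m=1..N. g e m) - (\<Sum>e=1..N. \<Sum>m=1..N. g' e m)) =
        norm (\<Sum>e=1..N. \<Sum>m=1..N. g e m - g' e m)"
    by (simp add: sum_subtractf)
  also have "\<dots> \<le> (\<Sum>e=1..N. 2 * v * (Lam e / (real e * real (aprimedivisor e))))"
  proof (intro sum_norm_le)
    fix e assume e: "e \<in> {1..N}"
    show "norm (\<Sum>m=1..N. g e m - g' e m) \<le> 2 * v * (Lam e / (real e * real (aprimedivisor e)))"
    proof (cases "Lam e = 0")
      case True
      hence "g e m - g' e m = 0" for m unfolding g_def g'_def by (simp only: of_real_0 mult_zero_left diff_self)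
      thus ?thesis using True by simp
    next
    case False
    define p where "p = aprimedivisor e"
    have "primepow e" using False by (auto simp: mangoldt_def split: if_splits)
    hence p0: "p > 0" unfolding p_def by (intro aprimedivisor_pos_nat) (auto dest: primepow_gt_Suc_0)
    have "norm (\<Sum>m=1..N. g e m - g' e m) \<le> (\<Sum>m=1..N. if real m \<le> v / real e \<and> p dvd m then 2 * Lam e else 0)"
    proof (intro sum_norm_le)
      fix m assume m: "m \<in> {1..N}"
      have diff: "g e m - g' e m = of_real (Lam e) * ((f (e * m) - f e * f m) * of_real (k (ln (v / real (e * m)))))"
        by (simp add: g_def g'_def algebra_simps)
      show "norm (g e m - g' e m) \<le> (if real m \<le> v / real e \<and> p dvd m then 2 * Lam e else 0)"
      proof (cases "real m \<le> v / real e \<and> p dvd m")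
        case True
        have "norm (f (e * m) - f e * f m) \<le> 1 + 1 * 1"
          by (intro order.trans[OF norm_triangle_ineq4] add_mono norm_f_le)
             (auto simp: norm_mult intro!: mult_le_one norm_f_le)
        hence "norm (f (e * m) - f e * f m) * norm (k (ln (v / real (e * m)))) \<le> 2 * 1"
          using k_nonneg[of "ln (v / real (e * m))"] k_le_1[of "ln (v / real (e * m))"] by (intro mult_mono) auto
        hence "norm (g e m - g' e m) \<le> Lam e * 2"
          unfolding diff by (simp add: norm_mult mult_left_mono mangoldt_nonneg)
        thus ?thesis using True by simp
      next
        case False
        have "g e m - g' e m = 0"
        proof (cases "real m \<le> v / real e")
          case True
          hence "\<not> p dvd m" using False by auto
          hence "Lam e = 0 \<or> coprime e m"
            unfolding p_def mangoldt_def using not_coprime_primepow[of e m] by auto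
          thus ?thesis unfolding diff using f_mult[of e m] e m by (auto simp del: of_real_mangoldt)
        next
          case False
          hence "v \<le> real (e * m)" using e by (simp add: field_simps)
          thus ?thesis unfolding diff using k_eq_0[of v "e * m"] v e m by (simp del: of_nat_mult)
        qed
        thus ?thesis using False mangoldt_nonneg[of e] by simp
      qed
    qed
    also have "\<dots> = 2 * Lam e * real (card {m\<in>{1..N}. real m \<le> v / real e \<and> p dvd m})"
      by (subst sum.inter_filter [symmetric]) auto
    also have "\<dots> \<le> 2 * Lam e * ((v / real e) / real p)"
      using v e p0 by (intro mult_left_mono card_multiples_le mult_nonneg_nonneg mangoldt_nonneg) auto
    finally show ?thesis
      unfolding p_def by (simp add: mult_ac)
    qed
  qed
  also have "\<dots> = 2 * v * (\<Sum>e=1..N. Lam e / (real e * real (aprimedivisor e)))"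
    by (simp add: sum_distrib_left)
  finally show ?thesis unfolding 1 2 .
qed

text \<open>From ln v = ln n + ln (v / n): the first summand gives a convolution up to the defect of
  multiplicativity, the second is O(v).\<close>

lemma T_recursion:
  assumes v: "v \<ge> 1" "v \<le> real N"
    and K: "(\<Sum>e=1..N. Lam e / (real e * real (aprimedivisor e))) \<le> K"
  shows "norm (of_real (ln v) * T v - V v) \<le> (2 * K + 1) * v"
proof -
  have "of_real (ln v) * T v = (\<Sum>n=1..N. f n * of_real (ln (real n) * k (ln (v / real n)))) +
                     (\<Sum>n=1..N. f n * of_real (ln (v / real n) * k (ln (v / real n))))"
    unfolding T_def sum.distrib [symmetric] sum_distrib_left
    by (intro sum.cong refl) (use v in \<open>auto simp: ln_div algebra_simps\<close>)
  hence "norm (of_real (ln v) * T v - V v) \<le> norm ((\<Sum>n=1..N. f n * of_real (ln (real n) * k (ln (v / real n)))) - V v) + 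
            norm (\<Sum>n=1..N. f n * of_real (ln (v / real n) * k (ln (v / real n))))"
    by (metis (no_types, lifting) add_diff_eq diff_add_eq norm_triangle_ineq)
  also have "\<dots> \<le> 2 * v * (\<Sum>e=1..N. Lam e / (real e * real (aprimedivisor e))) + v"
    by (intro add_mono log_sum_convolution weighted_log_sum_le v)
  also have "\<dots> \<le> 2 * v * K + v" using K v by (intro add_mono mult_left_mono) auto
  finally show ?thesis by (simp add: algebra_simps)
qed

text \<open>The recursion is used at N and again at every N / d. The second use divides by ln (N /
  d) >= \<open>lm\<close>, which is acceptable for d <= Y only; for d > Y the trivial bound N / d is
  summed instead.\<close>

lemma T_bound:
  assumes K: "(\<Sum>e=1..N. Lam e / (real e * real (aprimedivisor e))) \<le> K" "K \<ge> 0"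
    and Y: "1 \<le> Y" "Y < N"
  defines "lm \<equiv> ln (real N / real Y)"
  shows "norm (T (real N)) * ln (real N) \<le>
           ((\<Sum>d=1..Y. Lam d * norm (V (real N / real d))) + (2 * K + 1) * real N * (ln (real N) + 4)) / lm +
           real N * (lm + 5) + (2 * K + 1) * real N"
proof -
  have lm: "lm > 0" unfolding lm_def using Y by simp
  have "norm (T (real N)) * ln (real N) = norm (of_real (ln (real N)) * T (real N))"
    using N_pos by (simp add: norm_mult)
  also have "\<dots> \<le> norm (V (real N)) + (2 * K + 1) * real N"
    using T_recursion[OF _ _ K(1), of "real N"] N_pos norm_triangle_sub[of "of_real (ln (real N)) * T (real N)" "V (real N)"] by simp
  also have "norm (V (real N)) \<le> (\<Sum>d=1..N. Lam d * norm (T (real N / real d)))"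
    unfolding V_def
  proof (intro sum_norm_le)
    fix d
    have "norm (f d) * norm (T (real N / real d)) \<le> 1 * norm (T (real N / real d))"
      by (intro mult_right_mono norm_f_le) auto
    thus "norm (of_real (Lam d) * f d * T (real N / real d)) \<le> Lam d * norm (T (real N / real d))"
      by (simp add: norm_mult mult_left_mono mangoldt_nonneg mult.assoc)
  qed
  also have "{1..N} = {1..Y} \<union> {Y<..N}" using Y by auto
  also have "(\<Sum>d\<in>{1..Y} \<union> {Y<..N}. Lam d * norm (T (real N / real d))) =
       (\<Sum>d=1..Y. Lam d * norm (T (real N / real d))) + (\<Sum>d\<in>{Y<..N}. Lam d * norm (T (real N / real d)))"
    by (intro sum.union_disjoint) auto
  also have "(\<Sum>d\<in>{Y<..N}. Lam d * norm (T (real N / real d))) \<le> (\<Sum>d\<in>{Y<..N}. Lam d * (real N / real d))"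
    using N_pos by (intro sum_mono mult_left_mono norm_T_le mangoldt_nonneg) auto
  also have "\<dots> = real N * (\<Sum>d\<in>{Y<..N}. Lam d / real d)" by (simp add: sum_distrib_left mult_ac)
  also have "\<dots> \<le> real N * (lm + 5)"
    unfolding lm_def using Y by (intro mult_left_mono sum_mangoldt_over_range) auto
  also have "(\<Sum>d=1..Y. Lam d * norm (T (real N / real d))) \<le>
             (\<Sum>d=1..Y. (Lam d * norm (V (real N / real d)) + (2 * K + 1) * real N * (Lam d / real d)) / lm)"
  proof (intro sum_mono)
    fix d assume d: "d \<in> {1..Y}"
    define v where "v = real N / real d"
    have v: "v \<ge> 1" "v \<le> real N" using d Y by (auto simp: v_def field_simps)
    have lv: "lm \<le> ln v" unfolding v_def lm_def using d Y by (simp add: frac_le)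
    have "lm * norm (T v) \<le> ln v * norm (T v)" using lv by (intro mult_right_mono) auto
    also have "\<dots> = norm (of_real (ln v) * T v)" using v by (simp add: norm_mult)
    also have "\<dots> \<le> norm (V v) + (2 * K + 1) * v"
      using T_recursion[OF v K(1)] norm_triangle_sub[of "of_real (ln v) * T v" "V v"] by simp
    finally have "norm (T v) \<le> (norm (V v) + (2 * K + 1) * v) / lm"
      using lm by (simp add: field_simps)
    hence "Lam d * norm (T v) \<le> Lam d * ((norm (V v) + (2 * K + 1) * v) / lm)"
      by (intro mult_left_mono mangoldt_nonneg)
    also have "\<dots> = (Lam d * norm (V v) + (2 * K + 1) * real N * (Lam d / real d)) / lm"
      by (simp add: v_def algebra_simps)
    finally show "Lam d * norm (T (real N / real d)) \<le>
        (Lam d * norm (V (real N / real d)) + (2 * K + 1) * real N * (Lam d / real d)) / lm"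
      unfolding v_def .
  qed
  also have "\<dots> = ((\<Sum>d=1..Y. Lam d * norm (V (real N / real d))) + 
                  (2 * K + 1) * real N * (\<Sum>d=1..Y. Lam d / real d)) / lm"
    by (simp add: sum.distrib sum_distrib_left flip: sum_divide_distrib)
  also have "\<dots> \<le> ((\<Sum>d=1..Y. Lam d * norm (V (real N / real d))) + (2 * K + 1) * real N * (ln (real N) + 4)) / lm"
  proof -
    have "(\<Sum>d=1..Y. Lam d / real d) \<le> ln (real Y) + 4" using Y by (intro sum_mangoldt_over_le)
    also have "\<dots> \<le> ln (real N) + 4" using Y by simp
    finally show ?thesis using K lm by (intro divide_right_mono add_left_mono mult_left_mono) auto
  qed
  finally show ?thesis by simp
qed

end

section \<open>The double convolution as a trilinear sum\<close>

lemma cutoff_bounds: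
  assumes "\<sigma> > 0" "h > 0"
  shows "cutoff \<sigma> h u \<ge> 0" "cutoff \<sigma> h u \<le> exp (\<sigma> * h) - 1"
    "u \<le> 0 \<Longrightarrow> cutoff \<sigma> h u = 0" "u \<ge> h \<Longrightarrow> cutoff \<sigma> h u = exp (\<sigma> * h) - 1"
  using assms by (auto simp: cutoff_def)

lemma triple_sum_product:
  fixes c :: "'a :: comm_semiring_0"
  shows "(\<Sum>(i,j,l)\<in>A \<times> B \<times> C. c * (x i * (y j * z l))) = c * (sum x A * (sum y B * sum z C))"
proof -
  have "c * (sum x A * (sum y B * sum z C)) = c * (sum x A * (\<Sum>j\<in>B. \<Sum>l\<in>C. y j * z l))"
    by (simp only: sum_product)
  also have "\<dots> = (\<Sum>i\<in>A. \<Sum>j\<in>B. \<Sum>l\<in>C. c * (x i * (y j * z l)))"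
    by (subst sum_distrib_right) (simp only: sum_distrib_left)
  finally show ?thesis by (simp add: sum.cartesian_product)
qed

text \<open>The absolute values are linearised by unimodular coefficients \<open>\<epsilon> d\<close>, which turns the left-hand side
  into a single trilinear sum to which the inversion formula for the cutoff applies.\<close>

lemma (in bounded_multiplicative) V_sum_bound:
  obtains K where "K > 0" and
    "\<And>\<sigma> h N M Y G. 1 \<le> \<sigma> \<Longrightarrow> \<sigma> \<le> 2 \<Longrightarrow> h > 0 \<Longrightarrow> N \<ge> 1 \<Longrightarrow> N \<le> M \<Longrightarrow> Y \<le> N \<Longrightarrow>
       (\<And>t. norm (\<Sum>m=1..M. f m * dpow \<sigma> t m) / (1 + t^2) \<le> G * decay_weight t) \<Longrightarrow>
       (\<Sum>d=1..Y. Lam d * norm (smoothed_sum.V f (\<lambda>u. cutoff \<sigma> h u / (exp (\<sigma> * h) - 1)) N (real N / real d)))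
         \<le> (2 * h + 8) / h * real N powr \<sigma> * G * K * (ln (real N) + 4)"
proof -
  obtain K where K: "K > 0" 
    "\<And>\<sigma> N c c' T. \<sigma> \<ge> 1 \<Longrightarrow> N \<ge> 1 \<Longrightarrow> (\<And>n. norm (c n) \<le> 1) \<Longrightarrow> (\<And>n. norm (c' n) \<le> 1) \<Longrightarrow>
      integral {- real T..real T} (\<lambda>t. norm (\<Sum>n=1..N. of_real (Lam n) * c n * dpow \<sigma> t n) *
         norm (\<Sum>n=1..N. of_real (Lam n) * c' n * dpow \<sigma> t n) * decay_weight t) \<le> K * (ln (real N) + 4)"
    by (rule bilinear_mean_value) blast
  show ?thesis
  proof (rule that[OF K(1)])
    fix \<sigma> h G :: real and N M Y :: nat
    assume \<sigma>: "1 \<le> \<sigma>" "\<sigma> \<le> 2" and h: "h > 0" and N: "N \<ge> 1" "N \<le> M" "Y \<le> N"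
      and G: "\<And>t. norm (\<Sum>m=1..M. f m * dpow \<sigma> t m) / (1 + t^2) \<le> G * decay_weight t"
    \<comment> \<open>The height of the plateau of the cutoff, by which the weight is normalised;
      its lower bound h is what enters the result.\<close>
    define D where "D = exp (\<sigma> * h) - 1"
    have D: "D \<ge> h"
    proof -
      have "1 + \<sigma> * h \<le> exp (\<sigma> * h)" by (rule exp_ge_add_one_self)
      moreover have "1 * h \<le> \<sigma> * h" using \<sigma> h by (intro mult_right_mono) auto
      ultimately show ?thesis unfolding D_def by linarith
    qed
    interpret smoothed_sum f "\<lambda>u. cutoff \<sigma> h u / (exp (\<sigma> * h) - 1)" N
      using cutoff_bounds[of \<sigma> h] \<sigma> h N D
      by unfold_locales (auto simp: D_def)
    \<comment> \<open>Setting the sign to 0 beyond Y lets d run over {1..N}, so that both von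
      Mangoldt factors have the same length N in the mean value bound.\<close>
    define \<epsilon> where "\<epsilon> d = (if d \<le> Y then cnj (sgn (V (real N / real d))) else 0)" for d
    have ne: "norm (\<epsilon> d) \<le> 1" for d by (auto simp: \<epsilon>_def norm_sgn)
    have \<epsilon>V: "\<epsilon> d * V (real N / real d) = (if d \<le> Y then of_real (norm (V (real N / real d))) else 0)" for d
    proof (cases "V (real N / real d) = 0")
      case False
      thus ?thesis
        using complex_norm_square[of "V (real N / real d)"]
        by (auto simp: \<epsilon>_def sgn_div_norm scaleR_conv_of_real field_simps power2_eq_square mult.commute)
    qed (auto simp: \<epsilon>_def)
    define I where "I = {1..N} \<times> {1..N} \<times> {1..M}"
    define a where "a = (\<lambda>(d,e,m). of_real (Lam d) * \<epsilon> d * (of_real (Lam e) * f e) * f m)"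
    define u where "u = (\<lambda>(d,e,m). ln (real N / (real d * real e * real m)))"
    have finI: "finite I" unfolding I_def by auto
    \<comment> \<open>Lengthening the range of m from N to M changes nothing, since the cutoff
      vanishes at nonpositive arguments, but it lets the third polynomial be a truncation of the
      Dirichlet series as long as desired.\<close>
    have Text: "T (real N / real d / real e) = (\<Sum>m=1..M. f m * of_real (cutoff \<sigma> h (u (d,e,m)) / D))"
      if "d \<in> {1..N}" "e \<in> {1..N}" for d e
      unfolding T_def D_def u_def prod.case
    proof (intro sum.mono_neutral_cong_left ballI)
      fix m assume m: "m \<in> {1..M} - {1..N}"
      have "real N \<le> 1 * 1 * real m" using m by auto
      also have "\<dots> \<le> real d * real e * real m" using that by (intro mult_right_mono mult_mono) auto
      finally have "ln (real N / (real d * real e * real m)) \<le> 0" using N that m by simp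
      thus "f m * of_real (cutoff \<sigma> h (ln (real N / (real d * real e * real m))) / (exp (\<sigma> * h) - 1)) = 0"
        using cutoff_bounds(3)[of \<sigma> h] \<sigma> h by simp
    qed (use N in \<open>auto simp: mult_ac\<close>)
    have "complex_of_real (\<Sum>d=1..Y. Lam d * norm (V (real N / real d))) = (\<Sum>d=1..N. of_real (Lam d) * (\<epsilon> d * V (real N / real d)))"
      unfolding \<epsilon>V of_real_sum using N by (intro sum.mono_neutral_cong_left) auto
    also have "\<dots> = (\<Sum>d=1..N. \<Sum>e=1..N. \<Sum>m=1..M. a (d,e,m) * cutoff \<sigma> h (u (d,e,m)) / D)"
    proof (intro sum.cong refl)
      fix d assume d: "d \<in> {1..N}"
      have "of_real (Lam d) * (\<epsilon> d * V (real N / real d)) = 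
            of_real (Lam d) * (\<epsilon> d * (\<Sum>e=1..N. of_real (Lam e) * f e * (\<Sum>m=1..M. f m * of_real (cutoff \<sigma> h (u (d,e,m)) / D))))"
        unfolding V_def
        by (intro arg_cong2[of _ _ _ _ "(*)"] sum.cong refl) (rule Text[OF d])
      also have "\<dots> = (\<Sum>e=1..N. \<Sum>m=1..M. a (d,e,m) * cutoff \<sigma> h (u (d,e,m)) / D)"
        unfolding sum_distrib_left by (intro sum.cong refl) (simp add: a_def)
      finally show "of_real (Lam d) * (\<epsilon> d * V (real N / real d)) = (\<Sum>e=1..N. \<Sum>m=1..M. a (d,e,m) * cutoff \<sigma> h (u (d,e,m)) / D)" .
    qed
    also have "\<dots> = (\<Sum>i\<in>I. a i * cutoff \<sigma> h (u i) / D)"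
      unfolding I_def by (simp add: sum.cartesian_product case_prod_unfold)
    also have "\<dots> = (\<Sum>i\<in>I. a i * cutoff \<sigma> h (u i)) / D" by (simp add: sum_divide_distrib)
    finally have eq: "complex_of_real (\<Sum>d=1..Y. Lam d * norm (V (real N / real d))) = (\<Sum>i\<in>I. a i * cutoff \<sigma> h (u i)) / D" .
    define B where "B = (2 * h + 8) * real N powr \<sigma> * G * K * (ln (real N) + 4)"
    define E where "E t = norm (\<Sum>n=1..N. of_real (Lam n) * \<epsilon> n * dpow \<sigma> t n)" for t
    define L where "L t = norm (\<Sum>n=1..N. of_real (Lam n) * f n * dpow \<sigma> t n)" for t
    define F where "F t = norm (\<Sum>m=1..M. f m * dpow \<sigma> t m)" for t
    have cont: "continuous_on A E" "continuous_on A L" "continuous_on A F" for A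
      unfolding E_def L_def F_def by (intro continuous_intros)+
    have pos: "1 + t^2 > 0" "1 + t^2 \<noteq> 0" for t :: real by (auto simp: add_pos_nonneg add_nonneg_eq_0_iff)
    \<comment> \<open>Both exp (\<sigma> u) and cis (t u) are multiplicative in N / (d e m), so the
      sum splits into N^\<sigma> and three Dirichlet polynomials.\<close>
    have factor: "norm (\<Sum>i\<in>I. a i * exp (\<sigma> * u i) * cis (t * u i)) = real N powr \<sigma> * (E t * L t * F t)" for t
    proof -
      have "(\<Sum>i\<in>I. a i * exp (\<sigma> * u i) * cis (t * u i)) =
         (\<Sum>(d,e,m)\<in>I. of_real (real N powr \<sigma>) * cis (t * ln (real N)) * 
            ((of_real (Lam d) * \<epsilon> d * dpow \<sigma> t d) * ((of_real (Lam e) * f e * dpow \<sigma> t e) * (f m * dpow \<sigma> t m))))"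
      proof (intro sum.cong refl, clarify)
        fix d e m assume "(d, e, m) \<in> I"
        hence dem: "d > 0" "e > 0" "m > 0" by (auto simp: I_def)
        have ueq: "u (d,e,m) = ln (real N) - ln (real d) - ln (real e) - ln (real m)"
          using dem N by (simp add: u_def ln_div ln_mult)
        hence 1: "exp (\<sigma> * u (d,e,m)) = real N powr \<sigma> * real d powr -\<sigma> * real e powr -\<sigma> * real m powr -\<sigma>"
          and 2: "cis (t * u (d,e,m)) = cis (t * ln (real N)) * cis (- (t * ln (real d))) * cis (- (t * ln (real e))) * cis (- (t * ln (real m)))"
          unfolding ueq using dem N by (auto simp: powr_def cis_mult algebra_simps simp flip: exp_add)
        show "a (d,e,m) * exp (\<sigma> * u (d,e,m)) * cis (t * u (d,e,m)) = of_real (real N powr \<sigma>) * cis (t * ln (real N)) * 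
            ((of_real (Lam d) * \<epsilon> d * dpow \<sigma> t d) * ((of_real (Lam e) * f e * dpow \<sigma> t e) * (f m * dpow \<sigma> t m)))"
          unfolding 1 2 a_def dpow_def by (simp add: mult_ac)
      qed
      also have "\<dots> = of_real (real N powr \<sigma>) * cis (t * ln (real N)) * 
         ((\<Sum>n=1..N. of_real (Lam n) * \<epsilon> n * dpow \<sigma> t n) * ((\<Sum>n=1..N. of_real (Lam n) * f n * dpow \<sigma> t n) * (\<Sum>m=1..M. f m * dpow \<sigma> t m)))"
        unfolding I_def by (rule triple_sum_product)
      finally show ?thesis unfolding E_def L_def F_def by (simp add: norm_mult)
    qed
    have "norm (\<Sum>i\<in>I. a i * cutoff \<sigma> h (u i)) \<le> B"
    proof (rule cutoff_sum_le[OF \<sigma> h finI])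
      fix T :: nat
      have "integral {- real T..real T} (\<lambda>t. norm (\<Sum>i\<in>I. a i * exp (\<sigma> * u i) * cis (t * u i)) * ((2 * h + 8) / (1 + t^2)))
        \<le> integral {- real T..real T} (\<lambda>t. ((2 * h + 8) * real N powr \<sigma> * G) * (E t * L t * decay_weight t))"
        unfolding factor
      proof (intro integral_le integrable_continuous_real continuous_intros cont)
        fix t :: real
        have "real N powr \<sigma> * (E t * L t * F t) * ((2 * h + 8) / (1 + t^2)) = 
              (2 * h + 8) * real N powr \<sigma> * (E t * L t) * (F t / (1 + t^2))" by simp
        also have "\<dots> \<le> (2 * h + 8) * real N powr \<sigma> * (E t * L t) * (G * decay_weight t)"
          using G[of t] h by (intro mult_left_mono mult_nonneg_nonneg) (auto simp: F_def E_def L_def)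
        finally show "real N powr \<sigma> * (E t * L t * F t) * ((2 * h + 8) / (1 + t^2)) \<le> ((2 * h + 8) * real N powr \<sigma> * G) * (E t * L t * decay_weight t)"
          by (simp add: mult_ac)
      qed (use pos in auto)
      also have "\<dots> = (2 * h + 8) * real N powr \<sigma> * G * integral {- real T..real T} (\<lambda>t. E t * L t * decay_weight t)" by simp
      also have "\<dots> \<le> (2 * h + 8) * real N powr \<sigma> * G * (K * (ln (real N) + 4))"
      proof (intro mult_left_mono mult_nonneg_nonneg)
        \<comment> \<open>The hypothesis at t = 0 forces G to be nonnegative.\<close>
        have "0 \<le> G * decay_weight 0" by (rule order.trans[OF _ G[of 0]]) auto
        thus "G \<ge> 0" using decay_weight_pos[of 0] by (simp add: zero_le_mult_iff)
        show "integral {- real T..real T} (\<lambda>t. E t * L t * decay_weight t) \<le> K * (ln (real N) + 4)"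
          unfolding E_def L_def by (intro K(2) \<sigma> N ne norm_f_le)
      qed (use h in auto)
      finally show "integral {- real T..real T} (\<lambda>t. norm (\<Sum>i\<in>I. a i * exp (\<sigma> * u i) * cis (t * u i)) * ((2 * h + 8) / (1 + t^2))) \<le> B"
        by (simp add: B_def mult_ac)
    qed
    moreover have S: "(\<Sum>d=1..Y. Lam d * norm (V (real N / real d))) \<ge> 0"
      by (intro sum_nonneg mult_nonneg_nonneg mangoldt_nonneg) auto
    have "(\<Sum>d=1..Y. Lam d * norm (V (real N / real d))) = norm (complex_of_real (\<Sum>d=1..Y. Lam d * norm (V (real N / real d))))"
      unfolding norm_of_real using S by simp
    hence "(\<Sum>d=1..Y. Lam d * norm (V (real N / real d))) = norm (\<Sum>i\<in>I. a i * cutoff \<sigma> h (u i)) / D"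
      unfolding eq using D h by (simp add: norm_divide)
    ultimately have "(\<Sum>d=1..Y. Lam d * norm (V (real N / real d))) \<le> B / h"
      using D h by (auto intro!: frac_le order.trans[OF norm_ge_zero])
    thus "(\<Sum>d=1..Y. Lam d * norm (V (real N / real d))) \<le> (2 * h + 8) / h * real N powr \<sigma> * G * K * (ln (real N) + 4)"
      unfolding B_def by simp
  qed
qed

section \<open>Euler products\<close>

text \<open>What remains of the series after finitely many Euler factors are taken out. Keeping this
  remainder makes every finite identity exact and avoids infinite products.\<close>

definition sifted :: "nat set \<Rightarrow> nat set" where
  "sifted P = {n. n > 0 \<and> (\<forall>p\<in>P. \<not> p dvd n)}"

locale summable_multiplicative =
  fixes a :: "nat \<Rightarrow> complex"
  assumes a_1: "a (Suc 0) = 1"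
    and a_mult: "\<And>m n. m > 0 \<Longrightarrow> n > 0 \<Longrightarrow> coprime m n \<Longrightarrow> a (m * n) = a m * a n"
    and a_summable: "summable (\<lambda>n. norm (a n))"
begin

lemma a_summable_on: "a summable_on A"
  using norm_summable_imp_summable_on[OF a_summable] by (rule summable_on_subset_banach) auto

lemma norm_a_summable_on: "(\<lambda>n. norm (a n)) summable_on A"
proof -
  have "(\<lambda>n. norm (a n)) summable_on UNIV"
    using a_summable by (intro norm_summable_imp_summable_on) auto
  thus ?thesis by (rule summable_on_subset_banach) auto
qed

definition loc :: "nat \<Rightarrow> complex" where "loc p = (\<Sum>\<^sub>\<infinity>k. a (p ^ k))"

text \<open>Each integer without prime factors in P is uniquely q^k * m with m also prime to q;
  absolute summability permits summing over k and m separately.\<close>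

lemma sifted_insert:
  assumes q: "prime q" and P: "\<And>p. p \<in> P \<Longrightarrow> prime p" "q \<notin> P"
  shows "infsum a (sifted P) = loc q * infsum a (sifted (insert q P))"
proof -
  define g where "g = (\<lambda>(k, m). q ^ k * m)"
  have bij: "bij_betw g (UNIV \<times> sifted (insert q P)) (sifted P)"
    unfolding bij_betw_def
  proof
    show "inj_on g (UNIV \<times> sifted (insert q P))"
    proof (rule inj_onI, clarify)
      fix k m k' m'
      assume m: "m \<in> sifted (insert q P)" "m' \<in> sifted (insert q P)" and eq: "g (k, m) = g (k', m')"
      have "multiplicity q (q ^ k * m) = k" if "m \<in> sifted (insert q P)" for k m
        by (rule multiplicity_decomposeI[where x'=m]) (use that q in \<open>auto simp: sifted_def\<close>)
      from this[OF m(1), of k] this[OF m(2), of k'] eq have "k = k'" by (simp add: g_def)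
      with eq show "k = k' \<and> m = m'" using q by (auto simp: g_def prime_gt_0_nat)
    qed
    show "g ` (UNIV \<times> sifted (insert q P)) = sifted P"
    proof safe
      fix k m assume "m \<in> sifted (insert q P)"
      moreover have "\<not> p dvd q ^ k * m" if "p \<in> P" "\<not> p dvd m" for p
        using that P q primes_dvd_imp_eq[of p q] prime_dvd_power[of p q k] by (auto simp: prime_dvd_mult_iff)
      ultimately show "g (k, m) \<in> sifted P"
        using q by (auto simp: g_def sifted_def prime_gt_0_nat)
    next
      fix n assume n: "n \<in> sifted P"
      hence "n \<noteq> 0" by (auto simp: sifted_def)
      moreover have "\<not> is_unit q" using q by auto
      ultimately obtain m where m: "n = q ^ multiplicity q n * m" "\<not> q dvd m"
        by (rule multiplicity_decompose')
      have "m dvd n" by (subst m(1)) simp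
      hence "m \<in> sifted (insert q P)" using n m(2) by (auto simp: sifted_def intro: dvd_trans Nat.gr0I)
      thus "n \<in> g ` (UNIV \<times> sifted (insert q P))" 
        by (intro image_eqI[where x="(multiplicity q n, m)"]) (simp_all add: g_def flip: m(1))
    qed
  qed
  have "infsum a (sifted P) = infsum (\<lambda>x. a (g x)) (UNIV \<times> sifted (insert q P))"
    by (rule infsum_reindex_bij_betw[OF bij, symmetric])
  also have "\<dots> = (\<Sum>\<^sub>\<infinity>k. \<Sum>\<^sub>\<infinity>m\<in>sifted (insert q P). a (g (k, m)))"
  proof (rule infsum_Sigma_banach[symmetric])
    show "(\<lambda>x. a (g x)) summable_on (UNIV \<times> sifted (insert q P))"
      using summable_on_reindex_bij_betw[OF bij, of a] a_summable_on by blast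
  qed
  also have "\<dots> = (\<Sum>\<^sub>\<infinity>k. \<Sum>\<^sub>\<infinity>m\<in>sifted (insert q P). a (q ^ k) * a m)"
  proof (intro infsum_cong)
    fix k m assume m: "m \<in> sifted (insert q P)"
    have "coprime (q ^ k) m" using m q by (auto simp: sifted_def prime_imp_coprime)
    thus "a (g (k, m)) = a (q ^ k) * a m"
      unfolding g_def using a_mult[of "q ^ k" m] m q by (simp add: sifted_def prime_gt_0_nat)
  qed
  also have "\<dots> = (\<Sum>\<^sub>\<infinity>k. a (q ^ k) * infsum a (sifted (insert q P)))"
    by (intro infsum_cong infsum_cmult_right) (auto intro: a_summable_on)
  also have "\<dots> = loc q * infsum a (sifted (insert q P))"
  proof -
    have "inj (\<lambda>k. q ^ k)" using prime_gt_1_nat[OF q] by (auto simp: inj_def)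
    hence "(\<lambda>k. a (q ^ k)) summable_on UNIV"
      using summable_on_reindex[of "\<lambda>k. q ^ k" UNIV a] a_summable_on by (simp add: o_def)
    thus ?thesis unfolding loc_def by (intro infsum_cmult_left)
  qed
  finally show ?thesis .
qed

lemma euler_finite:
  assumes "finite P" "\<And>p. p \<in> P \<Longrightarrow> prime p"
  shows "infsum a {0<..} = (\<Prod>p\<in>P. loc p) * infsum a (sifted P)"
  using assms
proof (induction P rule: finite_induct)
  case empty
  have "sifted {} = {0<..}" by (auto simp: sifted_def)
  thus ?case by simp
next
  case (insert q P)
  thus ?case using sifted_insert[of q P] by (simp add: mult_ac)
qed

text \<open>The integer 1 survives every sieve, and all other survivors have a prime factor above y,
  so the distance to 1 is at most a tail of the absolutely convergent series.\<close>

lemma sifted_tendsto: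
  "(\<lambda>y. infsum a (sifted {p. prime p \<and> p \<le> y})) \<longlonglongrightarrow> 1"
proof -
  have fin: "(\<lambda>y. suminf (\<lambda>n. norm (a (n + Suc y)))) \<longlonglongrightarrow> 0"
    using suminf_exist_split2[OF a_summable] by (rule LIMSEQ_Suc)
  show ?thesis
  proof (rule LIM_zero_cancel, rule Lim_null_comparison[OF _ fin], intro always_eventually allI)
    fix y :: nat
    define P where "P = {p. prime p \<and> p \<le> y}"
    have eq: "sifted P = insert 1 (sifted P - {1})" by (auto simp: sifted_def P_def dest: prime_gt_1_nat)
    have "infsum a (sifted P) = 1 + infsum a (sifted P - {1})"
      by (subst eq, subst infsum_insert) (auto simp: a_1 intro: a_summable_on)
    hence "norm (infsum a (sifted P) - 1) = norm (infsum a (sifted P - {1}))" by simp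
    also have "\<dots> \<le> infsum (\<lambda>n. norm (a n)) (sifted P - {1})"
      by (intro norm_infsum_bound norm_a_summable_on)
    also have "\<dots> \<le> infsum (\<lambda>n. norm (a n)) {Suc y..}"
    proof (intro infsum_mono2 norm_a_summable_on)
      show "sifted P - {1} \<subseteq> {Suc y..}"
      proof
        fix n assume n: "n \<in> sifted P - {1}"
        hence "n \<noteq> 1" by auto
        then obtain p where p: "prime p" "p dvd n" using prime_factor_nat by blast
        have "p \<notin> P" using n p by (auto simp: sifted_def)
        hence "p > y" using p by (auto simp: P_def)
        moreover have "p \<le> n" using p n by (intro dvd_imp_le) (auto simp: sifted_def)
        ultimately show "n \<in> {Suc y..}" by simp
      qed
    qed auto
    also have "\<dots> = infsum (\<lambda>n. norm (a (n + Suc y))) UNIV"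
      by (rule infsum_reindex_bij_betw[symmetric, of "\<lambda>n. n + Suc y" UNIV "{Suc y..}" "\<lambda>n. norm (a n)"])
         (auto intro!: bij_betwI[where g="\<lambda>n. n - Suc y"])
    also have "\<dots> = suminf (\<lambda>n. norm (a (n + Suc y)))"
    proof (intro infsumI norm_summable_imp_has_sum summable_sums)
      show "summable (\<lambda>n. norm (a (n + Suc y)))" by (rule summable_ignore_initial_segment[OF a_summable])
      thus "summable (\<lambda>n. norm (norm (a (n + Suc y))))" by (simp del: add_Suc_right)
    qed
    finally show "norm (infsum a (sifted {p. prime p \<and> p \<le> y}) - 1) \<le> suminf (\<lambda>n. norm (a (n + Suc y)))"
      unfolding P_def .
  qed
qed

end

section \<open>The zeta function on the real axis\<close>

lemma summable_powr_neg: "\<sigma> > 1 \<Longrightarrow> summable (\<lambda>n. real n powr - \<sigma>)"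
  by (subst summable_real_powr_iff) auto

lemma powr_neg_bounds:
  assumes "\<sigma> > 1" "n \<ge> 1"
  shows "(\<sigma> - 1) * real (Suc n) powr - \<sigma> \<le> real n powr (1 - \<sigma>) - real (Suc n) powr (1 - \<sigma>)"
    "real n powr (1 - \<sigma>) - real (Suc n) powr (1 - \<sigma>) \<le> (\<sigma> - 1) * real n powr - \<sigma>"
proof -
  have "\<exists>z. real n < z \<and> z < real (Suc n) \<and>
     real (Suc n) powr (1 - \<sigma>) - real n powr (1 - \<sigma>) = (real (Suc n) - real n) * ((1 - \<sigma>) * z powr - \<sigma>)"
  proof (rule MVT2)
    fix x assume "real n \<le> x"
    thus "((\<lambda>x. x powr (1 - \<sigma>)) has_real_derivative (1 - \<sigma>) * x powr - \<sigma>) (at x)"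
      using assms by (auto intro!: derivative_eq_intros)
  qed auto
  then obtain z where z: "real n < z" "z < real (Suc n)" 
    "real n powr (1 - \<sigma>) - real (Suc n) powr (1 - \<sigma>) = (\<sigma> - 1) * z powr - \<sigma>"
    by (auto simp: algebra_simps)
  have "real (Suc n) powr - \<sigma> \<le> z powr - \<sigma>" "z powr - \<sigma> \<le> real n powr - \<sigma>"
    using z assms by (auto intro!: powr_mono2')
  thus "(\<sigma> - 1) * real (Suc n) powr - \<sigma> \<le> real n powr (1 - \<sigma>) - real (Suc n) powr (1 - \<sigma>)"
    "real n powr (1 - \<sigma>) - real (Suc n) powr (1 - \<sigma>) \<le> (\<sigma> - 1) * real n powr - \<sigma>"
    unfolding z(3) using assms by (auto intro!: mult_left_mono)
qed

text \<open>Telescoping n^(1-\<sigma>) by means of the mean value theorem replaces the integral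
  test. The sums may start at 0, where \<open>powr\<close> gives 0.\<close>

lemma zeta_bounds:
  assumes s: "\<sigma> > 1"
  shows "(\<Sum>n. real n powr - \<sigma>) \<le> 1 + 1 / (\<sigma> - 1)" "1 / (\<sigma> - 1) \<le> (\<Sum>n. real n powr - \<sigma>)"
proof -
  have lim: "(\<lambda>n. real n powr (1 - \<sigma>)) \<longlonglongrightarrow> 0"
    using s by (intro tendsto_neg_powr filterlim_real_sequentially) auto
  have "(\<lambda>n. real (Suc n) powr (1 - \<sigma>) - real (Suc (Suc n)) powr (1 - \<sigma>)) sums (real (Suc 0) powr (1 - \<sigma>) - 0)"
    by (rule telescope_sums') (use LIMSEQ_Suc[OF lim] in simp)
  hence tel: "(\<lambda>n. real (Suc n) powr (1 - \<sigma>) - real (Suc (Suc n)) powr (1 - \<sigma>)) sums 1" by simp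
  have sm: "summable (\<lambda>n. real n powr - \<sigma>)" using s by (rule summable_powr_neg)
  have sm1: "summable (\<lambda>n. real (Suc n) powr - \<sigma>)" using sm by (subst summable_Suc_iff)
  have sm2: "summable (\<lambda>n. real (Suc (Suc n)) powr - \<sigma>)"
    using sm1 by (subst (asm) summable_Suc_iff[symmetric])
  have e1: "(\<Sum>n. real n powr - \<sigma>) = (\<Sum>n. real (Suc n) powr - \<sigma>)"
    using suminf_split_head[OF sm] by simp
  have e2: "(\<Sum>n. real (Suc n) powr - \<sigma>) = 1 + (\<Sum>n. real (Suc (Suc n)) powr - \<sigma>)"
    using suminf_split_head[OF sm1] by simp
  define D where "D n = real (Suc n) powr (1 - \<sigma>) - real (Suc (Suc n)) powr (1 - \<sigma>)" for n
  have D: "suminf D = 1" "summable D"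
    using tel by (auto simp: D_def[abs_def] sums_iff)
  have "(\<sigma> - 1) * (\<Sum>n. real (Suc (Suc n)) powr - \<sigma>) = (\<Sum>n. (\<sigma> - 1) * real (Suc (Suc n)) powr - \<sigma>)"
    by (rule suminf_mult[OF sm2, symmetric])
  also have "\<dots> \<le> suminf D"
    unfolding D_def using powr_neg_bounds(1)[OF s] D(2)
    by (intro suminf_le summable_mult sm2) (auto simp: D_def[abs_def] simp del: of_nat_Suc)
  finally have "(\<sigma> - 1) * (\<Sum>n. real (Suc (Suc n)) powr - \<sigma>) \<le> 1" using D by simp
  thus "(\<Sum>n. real n powr - \<sigma>) \<le> 1 + 1 / (\<sigma> - 1)"
    unfolding e1 e2 using s by (simp add: pos_le_divide_eq mult.commute)
  have "suminf D \<le> (\<Sum>n. (\<sigma> - 1) * real (Suc n) powr - \<sigma>)"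
    unfolding D_def using powr_neg_bounds(2)[OF s] D(2)
    by (intro suminf_le summable_mult sm1) (auto simp: D_def[abs_def] simp del: of_nat_Suc)
  also have "\<dots> = (\<sigma> - 1) * (\<Sum>n. real (Suc n) powr - \<sigma>)"
    by (rule suminf_mult[OF sm1])
  finally have "1 \<le> (\<sigma> - 1) * (\<Sum>n. real (Suc n) powr - \<sigma>)" using D by simp
  thus "1 / (\<sigma> - 1) \<le> (\<Sum>n. real n powr - \<sigma>)"
    unfolding e1 using s by (simp add: pos_divide_le_eq mult.commute)
qed

lemma summable_multiplicative_powr:
  assumes "\<sigma> > 1"
  shows "summable_multiplicative (\<lambda>n. complex_of_real (real n powr - \<sigma>))"
  using assms by unfold_locales (auto simp: powr_mult summable_powr_neg)

lemma loc_powr: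
  assumes "\<sigma> > 1" "prime p"
  shows "summable_multiplicative.loc (\<lambda>n. complex_of_real (real n powr - \<sigma>)) p = 1 / (1 - of_real (real p powr -\<sigma>))"
proof -
  interpret summable_multiplicative "\<lambda>n. complex_of_real (real n powr - \<sigma>)"
    using assms by (intro summable_multiplicative_powr)
  define x where "x = real p powr -\<sigma>"
  have p: "real p > 1" using assms prime_gt_1_nat by auto
  have x: "0 < x" "x < 1" unfolding x_def using p assms by (auto intro: powr_less_one)
  have "real (p ^ k) powr - \<sigma> = x ^ k" for k
  proof -
    have "real (p ^ k) powr - \<sigma> = (real p powr real k) powr - \<sigma>" using p by (simp add: powr_realpow)
    also have "\<dots> = (real p powr - \<sigma>) powr real k" by (simp add: powr_powr mult.commute)
    also have "\<dots> = x ^ k" using x unfolding x_def by (intro powr_realpow)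
    finally show ?thesis .
  qed
  hence "loc p = (\<Sum>\<^sub>\<infinity>k. (complex_of_real x) ^ k)" unfolding loc_def by simp
  also have "\<dots> = 1 / (1 - of_real x)"
    using x by (intro infsumI norm_summable_imp_has_sum geometric_sums) (auto simp: norm_power summable_geometric)
  finally show ?thesis unfolding x_def .
qed

section \<open>The size of a single Euler factor\<close>

lemma local_factor_suminf:
  fixes c :: "nat \<Rightarrow> complex"
  assumes c0: "c 0 = 1" and c: "\<And>k. norm (c k) \<le> r ^ k" and r: "0 \<le> r" "r \<le> 1/2"
  shows "summable (\<lambda>k. norm (c k))" "norm (suminf c - (1 + c 1)) \<le> 2 * r^2"
proof -
  have geo: "summable (\<lambda>k. r ^ k)" using r by (intro summable_geometric) auto
  show sn: "summable (\<lambda>k. norm (c k))"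
    by (rule summable_comparison_test'[OF geo, of 0]) (use c in auto)
  hence sc: "summable c" by (rule summable_norm_cancel)
  have "suminf c = (\<Sum>k. c (k + 2)) + (\<Sum>k<2. c k)"
    by (rule suminf_split_initial_segment[OF sc])
  hence "suminf c - (1 + c 1) = (\<Sum>k. c (k + 2))" by (simp add: c0 numeral_2_eq_2)
  also have "norm \<dots> \<le> (\<Sum>k. r^2 * r ^ k)"
  proof (rule norm_suminf_le)
    show "norm (c (k + 2)) \<le> r^2 * r ^ k" for k using c[of "k+2"] by (simp add: power2_eq_square mult_ac)
  qed (intro summable_mult geo)
  also have "\<dots> = r^2 * (1 / (1 - r))" using r by (subst suminf_mult[OF geo]) (simp add: suminf_geometric)
  also have "\<dots> \<le> r^2 * 2" using r by (intro mult_left_mono) (auto simp: field_simps)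
  finally show "norm (suminf c - (1 + c 1)) \<le> 2 * r^2" by simp
qed

text \<open>With r = p^(-\<sigma>) this is the ratio of the Euler factors of f and zeta. The linear
  term gives exp (Re (c 1) + r^2 / 2), the tail 2 r^2 at most a factor exp (4 r^2), and 1 - r <= exp
  (-r); the total 9/2 is rounded up to 5.\<close>

lemma local_factor_upper:
  fixes c :: "nat \<Rightarrow> complex"
  assumes c0: "c 0 = 1" and c: "\<And>k. norm (c k) \<le> r ^ k" and r: "0 \<le> r" "r \<le> 1/2"
  shows "norm (suminf c) * (1 - r) \<le> exp (- (r - Re (c 1)) + 5 * r^2)"
proof -
  define z where "z = c 1"
  have z: "norm z \<le> r" using c[of 1] by (simp add: z_def)
  have Rez: "Re z \<ge> - 1/2" using abs_Re_le_cmod[of z] z r by linarith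
  have "norm (1 + z) \<le> exp (Re z + r^2/2)"
  proof (rule power2_le_imp_le)
    have "(norm (1 + z))^2 = 1 + 2 * Re z + (norm z)^2"
      unfolding cmod_power2 by (simp add: power2_eq_square algebra_simps)
    also have "\<dots> \<le> 1 + (2 * Re z + r^2)" using z by (simp add: power_mono)
    also have "\<dots> \<le> exp (2 * Re z + r^2)" by (rule exp_ge_add_one_self)
    also have "\<dots> = (exp (Re z + r^2/2))^2" by (simp add: power2_eq_square flip: exp_add)
    finally show "(norm (1 + z))^2 \<le> (exp (Re z + r^2/2))^2" .
  qed auto
  moreover have "2 * r^2 \<le> exp (Re z + r^2/2) * (4 * r^2)"
  proof -
    have "1 + (-1/2) \<le> exp (-1/2::real)" by (rule exp_ge_add_one_self)
    also have "\<dots> \<le> exp (Re z + r^2/2)" using Rez by (simp add: add_increasing2)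
    finally have "1/2 * (4 * r^2) \<le> exp (Re z + r^2/2) * (4 * r^2)" by (intro mult_right_mono) auto
    thus ?thesis by simp
  qed
  moreover have "norm (suminf c) \<le> norm (1 + z) + 2 * r^2"
    using local_factor_suminf(2)[OF assms] norm_triangle_sub[of "suminf c" "1 + z"] by (simp add: z_def)
  ultimately have "norm (suminf c) \<le> exp (Re z + r^2/2) * (1 + 4 * r^2)" by (simp add: algebra_simps)
  also have "\<dots> \<le> exp (Re z + r^2/2) * exp (4 * r^2)" by (intro mult_left_mono exp_ge_add_one_self) auto
  also have "\<dots> \<le> exp (Re z + 5 * r^2)" by (simp flip: exp_add)
  finally have "norm (suminf c) * (1 - r) \<le> exp (Re z + 5 * r^2) * exp (- r)"
    using r exp_ge_add_one_self[of "- r"] by (intro mult_mono) auto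
  thus ?thesis by (simp add: z_def algebra_simps flip: exp_add)
qed

text \<open>For r <= 1/3 the factor is 1 + w with |w| <= 5/9, so its logarithm is w + O(r^2). The
  errors are 2 from w against \<open>c 1\<close>, 25/4 from the logarithm and 2 from ln (1 - r);
  their sum 41/4 is rounded up to 11. The prime 2 is out of reach of this argument.\<close>

lemma local_factor_lower:
  fixes c :: "nat \<Rightarrow> complex"
  assumes c0: "c 0 = 1" and c: "\<And>k. norm (c k) \<le> r ^ k" and r: "0 \<le> r" "r \<le> 1/3"
  shows "norm (suminf c) * (1 - r) \<ge> exp (- (r - Re (c 1)) - 11 * r^2)"
proof -
  define w where "w = suminf c - 1"
  have d: "norm (w - c 1) \<le> 2 * r^2"
    using local_factor_suminf(2)[OF c0 c r(1)] r by (simp add: w_def diff_diff_eq)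
  have c1: "norm (c 1) \<le> r" using c[of 1] by simp
  have r2: "r^2 \<le> 1/3 * r" unfolding power2_eq_square using r by (intro mult_right_mono) auto
  have w1: "norm w \<le> r + 2 * r^2" using d c1 norm_triangle_sub[of w "c 1"] by simp
  have w2: "norm w \<le> 5/3 * r" using w1 r2 by linarith
  have w3: "norm w \<le> 5/9" using w2 r by linarith
  have Rew: "Re w \<ge> Re (c 1) - 2 * r^2" using abs_Re_le_cmod[of "w - c 1"] d by simp
  have nz: "1 + w \<noteq> 0"
  proof
    assume "1 + w = 0"
    hence "w = -1" by (simp add: add_eq_0_iff)
    thus False using w3 by simp
  qed
  have "\<bar>Re (Ln (1 + w) - w)\<bar> \<le> norm (Ln (1 + w) - w)" by (rule abs_Re_le_cmod)
  also have "\<dots> \<le> (norm w)^2 / (1 - norm w)" using w3 by (intro Ln_approx_linear) auto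
  also have "\<dots> \<le> (5/3 * r)^2 / (4/9)" using w2 w3 by (intro frac_le power_mono) auto
  also have "\<dots> \<le> 25/4 * r^2" by (simp add: power_mult_distrib power2_eq_square)
  finally have "\<bar>Re (Ln (1 + w) - w)\<bar> \<le> 25/4 * r^2" .
  hence L: "Re (Ln (1 + w)) \<ge> Re w - 25/4 * r^2" unfolding minus_complex.sel by linarith
  have "exp (Re (c 1) - 33/4 * r^2) \<le> exp (Re (Ln (1 + w)))" using L Rew by simp
  also have "\<dots> = norm (1 + w)" using nz by simp
  finally have 1: "exp (Re (c 1) - 33/4 * r^2) \<le> norm (suminf c)" by (simp add: w_def)
  have "- r - 2 * r^2 \<le> ln (1 - r)" using r by (intro ln_one_minus_pos_lower_bound) auto
  hence "exp (- r - 2 * r^2) \<le> 1 - r" using r by (subst (asm) ln_ge_iff) auto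
  hence "exp (Re (c 1) - 33/4 * r^2) * exp (- r - 2 * r^2) \<le> norm (suminf c) * (1 - r)"
    using 1 by (intro mult_mono) auto
  moreover have "exp (Re (c 1) - 33/4 * r^2) * exp (- r - 2 * r^2) = exp (- (r - Re (c 1)) - 41/4 * r^2)"
    by (simp flip: exp_add)
  moreover have "exp (- (r - Re (c 1)) - 11 * r^2) \<le> exp (- (r - Re (c 1)) - 41/4 * r^2)" by simp
  ultimately show ?thesis by linarith
qed

section \<open>Upper and lower bounds for the Dirichlet series to the right of 1\<close>

context bounded_multiplicative
begin

definition twist :: "real \<Rightarrow> nat \<Rightarrow> real" where
  "twist t p = Re (f p * cis (- (t * ln (real p))))"

lemma twist_le: "\<bar>twist t p\<bar> \<le> 1"
proof -
  have "\<bar>twist t p\<bar> \<le> norm (f p * cis (- (t * ln (real p))))" unfolding twist_def by (rule abs_Re_le_cmod)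
  also have "\<dots> \<le> 1" using norm_f_le[of p] by (simp add: norm_mult)
  finally show ?thesis .
qed

lemma Re_term: "Re (f p * dpow \<sigma> t p) = real p powr -\<sigma> * twist t p"
  by (simp add: twist_def dpow_def algebra_simps)

lemma norm_term_le: "norm (f n * dpow \<sigma> t n) \<le> real n powr -\<sigma>"
  using mult_right_mono[OF norm_f_le[of n], of "real n powr -\<sigma>"] by (simp add: norm_mult)

lemma summable_multiplicative_term:
  assumes "\<sigma> > 1"
  shows "summable_multiplicative (\<lambda>n. f n * dpow \<sigma> t n)"
proof
  show "summable (\<lambda>n. norm (f n * dpow \<sigma> t n))"
    by (rule summable_comparison_test'[OF summable_powr_neg[OF assms], of 0]) (use norm_term_le in auto)
qed (auto simp: f_mult dpow_mult)

definition F :: "real \<Rightarrow> real \<Rightarrow> complex" where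
  "F \<sigma> t = (\<Sum>\<^sub>\<infinity>n\<in>{0<..}. f n * dpow \<sigma> t n)"

lemma F_conv_suminf:
  assumes "\<sigma> > 1"
  shows "F \<sigma> t = (\<Sum>n. f n * dpow \<sigma> t n)"
proof -
  interpret summable_multiplicative "\<lambda>n. f n * dpow \<sigma> t n" by (rule summable_multiplicative_term[OF assms])
  have "F \<sigma> t = (\<Sum>\<^sub>\<infinity>n. f n * dpow \<sigma> t n)"
    unfolding F_def by (rule infsum_cong_neutral) (auto simp: dpow_def)
  also have "\<dots> = (\<Sum>n. f n * dpow \<sigma> t n)"
    using a_summable by (intro infsumI norm_summable_imp_has_sum summable_sums summable_norm_cancel[OF a_summable])
  finally show ?thesis .
qed

text \<open>The tails are dominated by those of zeta at \<sigma>, so one M0 serves all t at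
  once.\<close>

lemma partial_sum_le_F:
  assumes "\<sigma> > 1"
  obtains M0 where "\<And>M t. M \<ge> M0 \<Longrightarrow> norm (\<Sum>m=1..M. f m * dpow \<sigma> t m) \<le> norm (F \<sigma> t) + 1"
proof -
  have sm: "summable (\<lambda>n. real n powr -\<sigma>)" by (rule summable_powr_neg[OF assms])
  obtain M0 where M0: "\<And>M. M \<ge> M0 \<Longrightarrow> norm (\<Sum>n. real (n + M) powr -\<sigma>) < 1"
    using suminf_exist_split[OF zero_less_one sm] by auto
  show ?thesis
  proof (rule that)
    fix M t assume M: "M \<ge> M0"
    interpret summable_multiplicative "\<lambda>n. f n * dpow \<sigma> t n" by (rule summable_multiplicative_term[OF assms])
    have "F \<sigma> t = (\<Sum>n. f (n + Suc M) * dpow \<sigma> t (n + Suc M)) + (\<Sum>n<Suc M. f n * dpow \<sigma> t n)"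
      unfolding F_conv_suminf[OF assms]
      by (rule suminf_split_initial_segment[OF summable_norm_cancel[OF a_summable]])
    also have "(\<Sum>n<Suc M. f n * dpow \<sigma> t n) = (\<Sum>m=1..M. f m * dpow \<sigma> t m)"
      by (intro sum.mono_neutral_right) (auto simp: dpow_def)
    finally have "(\<Sum>m=1..M. f m * dpow \<sigma> t m) = F \<sigma> t - (\<Sum>n. f (n + Suc M) * dpow \<sigma> t (n + Suc M))"
      by (simp add: algebra_simps)
    hence "norm (\<Sum>m=1..M. f m * dpow \<sigma> t m) \<le> norm (F \<sigma> t) + norm (\<Sum>n. f (n + Suc M) * dpow \<sigma> t (n + Suc M))"
      by (simp only: norm_triangle_ineq4)
    also have "norm (\<Sum>n. f (n + Suc M) * dpow \<sigma> t (n + Suc M)) \<le> (\<Sum>n. real (n + Suc M) powr -\<sigma>)"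
      by (intro norm_suminf_le norm_term_le) (rule summable_ignore_initial_segment[OF sm])
    also have "\<dots> \<le> 1" using M0[of "Suc M"] M by (simp del: of_nat_add of_nat_Suc)
    finally show "norm (\<Sum>m=1..M. f m * dpow \<sigma> t m) \<le> norm (F \<sigma> t) + 1" by simp
  qed
qed

lemma loc_facts:
  fixes t :: real
  assumes \<sigma>: "\<sigma> > 1" and p: "prime p"
  defines "c \<equiv> \<lambda>k. f (p ^ k) * dpow \<sigma> t (p ^ k)" and "r \<equiv> real p powr -\<sigma>"
  shows "c 0 = 1" "norm (c k) \<le> r ^ k" "0 < r" "r \<le> 1 / real p" "Re (c 1) = r * twist t p"
    "summable_multiplicative.loc (\<lambda>n. f n * dpow \<sigma> t n) p = suminf c"
proof -
  interpret summable_multiplicative "\<lambda>n. f n * dpow \<sigma> t n" by (rule summable_multiplicative_term[OF \<sigma>])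
  have p2: "real p \<ge> 2" using prime_ge_2_nat[OF p] by simp
  show "c 0 = 1" by (simp add: c_def)
  show r: "0 < r" using p2 by (simp add: r_def)
  have "r \<le> real p powr - 1" unfolding r_def using p2 \<sigma> by (intro powr_mono) auto
  thus rp: "r \<le> 1 / real p" using p2 by (simp add: powr_minus field_simps)
  have rk: "real (p ^ k) powr - \<sigma> = r ^ k" for k
  proof -
    have "real (p ^ k) powr - \<sigma> = (real p powr real k) powr - \<sigma>" using p2 by (simp add: powr_realpow)
    also have "\<dots> = (real p powr - \<sigma>) powr real k" by (simp add: powr_powr mult.commute)
    also have "\<dots> = r ^ k" using r unfolding r_def by (intro powr_realpow)
    finally show ?thesis .
  qed
  show ck: "norm (c k) \<le> r ^ k" for k unfolding c_def rk[symmetric] by (rule norm_term_le)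
  show "Re (c 1) = r * twist t p" unfolding c_def r_def by (simp only: power_one_right Re_term)
  have "1 / real p \<le> 1/2" using p2 by (intro divide_left_mono) auto
  hence "r \<le> 1/2" using rp by linarith
  hence "summable (\<lambda>k. norm (c k))"
    using \<open>c 0 = 1\<close> ck r by (intro local_factor_suminf(1)[of c r]) auto
  hence "(c has_sum suminf c) UNIV"
    by (intro norm_summable_imp_has_sum summable_sums) (auto intro: summable_norm_cancel)
  hence "infsum c UNIV = suminf c" by (rule infsumI)
  thus "loc p = suminf c" by (simp only: loc_def c_def)
qed

text \<open>The sifted sum of zeta, a majorant of the sifted sum of the Dirichlet series of f at
  every t.\<close>

definition zsum :: "real \<Rightarrow> nat set \<Rightarrow> real" where
  "zsum \<sigma> P = infsum (\<lambda>n. real n powr - \<sigma>) (sifted P)"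

lemma powr_summable_on: "\<sigma> > 1 \<Longrightarrow> (\<lambda>n. real n powr - \<sigma>) summable_on A"
proof -
  assume s: "\<sigma> > 1"
  have "(\<lambda>n. real n powr - \<sigma>) summable_on UNIV"
    using summable_powr_neg[OF s] by (intro norm_summable_imp_summable_on) auto
  thus ?thesis by (rule summable_on_subset_banach) auto
qed

lemma infsum_complex_powr:
  assumes "\<sigma> > 1"
  shows "infsum (\<lambda>n. complex_of_real (real n powr - \<sigma>)) A = complex_of_real (infsum (\<lambda>n. real n powr - \<sigma>) A)"
  using powr_summable_on[OF assms] by (intro infsumI) (simp add: has_sum_of_real_iff has_sum_infsum)

lemma zeta_euler:
  assumes \<sigma>: "\<sigma> > 1" and P: "finite P" "\<And>p. p \<in> P \<Longrightarrow> prime p"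
  shows "(\<Sum>n. real n powr - \<sigma>) * (\<Prod>p\<in>P. 1 - real p powr -\<sigma>) = zsum \<sigma> P"
proof -
  interpret summable_multiplicative "\<lambda>n. complex_of_real (real n powr - \<sigma>)"
    by (rule summable_multiplicative_powr[OF \<sigma>])
  have r: "real p powr -\<sigma> < 1" if "p \<in> P" for p
    using P(2)[OF that] \<sigma> prime_gt_1_nat[of p] by (intro powr_less_one) auto
  have "(\<Sum>\<^sub>\<infinity>n\<in>{0<..}. complex_of_real (real n powr - \<sigma>)) = (\<Prod>p\<in>P. loc p) * infsum (\<lambda>n. complex_of_real (real n powr - \<sigma>)) (sifted P)"
    by (rule euler_finite[OF P])
  also have "(\<Prod>p\<in>P. loc p) = (\<Prod>p\<in>P. complex_of_real (1 / (1 - real p powr -\<sigma>)))"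
    using P(2) loc_powr[OF \<sigma>] by (intro prod.cong refl) auto
  also have "\<dots> = complex_of_real (\<Prod>p\<in>P. 1 / (1 - real p powr -\<sigma>))" by simp
  also have "infsum (\<lambda>n. complex_of_real (real n powr - \<sigma>)) (sifted P) = complex_of_real (zsum \<sigma> P)"
    unfolding zsum_def by (rule infsum_complex_powr[OF \<sigma>])
  also have "(\<Sum>\<^sub>\<infinity>n\<in>{0<..}. complex_of_real (real n powr - \<sigma>)) = complex_of_real (\<Sum>n. real n powr - \<sigma>)"
  proof -
    have "(\<Sum>\<^sub>\<infinity>n\<in>{0<..}. real n powr - \<sigma>) = (\<Sum>\<^sub>\<infinity>n. real n powr - \<sigma>)"
      by (rule infsum_cong_neutral) auto
    also have "\<dots> = (\<Sum>n. real n powr - \<sigma>)"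
      using summable_powr_neg[OF \<sigma>] by (intro infsumI norm_summable_imp_has_sum summable_sums) auto
    finally show ?thesis by (simp only: infsum_complex_powr[OF \<sigma>])
  qed
  finally have "(\<Sum>n. real n powr - \<sigma>) = (\<Prod>p\<in>P. 1 / (1 - real p powr -\<sigma>)) * zsum \<sigma> P"
    by (simp only: of_real_mult[symmetric] of_real_eq_iff)
  moreover have "(\<Prod>p\<in>P. 1 / (1 - real p powr -\<sigma>)) * (\<Prod>p\<in>P. 1 - real p powr -\<sigma>) = 1"
    unfolding prod.distrib[symmetric]
  proof (intro prod.neutral ballI)
    fix p assume "p \<in> P"
    from r[OF this] show "1 / (1 - real p powr - \<sigma>) * (1 - real p powr - \<sigma>) = 1" by simp
  qed
  moreover have "Z * B = Y" if "Z = A * Y" "A * B = 1" for A B Y Z :: real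
    using that by (metis mult.commute mult.left_commute mult.right_neutral)
  ultimately show ?thesis by blast
qed

lemma norm_F_le_zeta:
  assumes "\<sigma> > 1"
  shows "norm (F \<sigma> t) \<le> 1 + 1 / (\<sigma> - 1)"
proof -
  have "norm (F \<sigma> t) \<le> (\<Sum>n. real n powr - \<sigma>)"
    unfolding F_conv_suminf[OF assms] by (intro norm_suminf_le norm_term_le summable_powr_neg assms)
  thus ?thesis using zeta_bounds(1)[OF assms] by simp
qed

lemma sum_square_le:
  assumes \<sigma>: "\<sigma> > 1" and P: "finite P" "\<And>p. p \<in> P \<Longrightarrow> prime p"
  shows "(\<Sum>p\<in>P. (real p powr - \<sigma>)^2) \<le> (\<Sum>n. real n powr -2)"
proof -
  have "(\<Sum>p\<in>P. (real p powr - \<sigma>)^2) \<le> (\<Sum>p\<in>P. real p powr -2)"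
  proof (intro sum_mono)
    fix p assume p: "p \<in> P"
    have p1: "real p \<ge> 1" using P(2)[OF p] prime_ge_1_nat[of p] by simp
    have "(real p powr - \<sigma>)^2 = real p powr (- \<sigma> + - \<sigma>)" by (simp only: power2_eq_square powr_add)
    also have "\<dots> \<le> real p powr -2" using \<sigma> p1 by (intro powr_mono) auto
    finally show "(real p powr - \<sigma>)^2 \<le> real p powr -2" .
  qed
  also have "\<dots> \<le> (\<Sum>n. real n powr -2)"
    using P by (intro sum_le_suminf summable_powr_neg) auto
  finally show ?thesis .
qed

text \<open>Finitely many Euler factors are taken out of both series. What remains of the series for
  f is at most what remains of zeta, so |F| is at most zeta times a finite product of ratios of
  local factors.\<close>

lemma norm_F_upper:
  assumes \<sigma>: "\<sigma> > 1" and P: "finite P" "\<And>p. p \<in> P \<Longrightarrow> prime p"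
  shows "norm (F \<sigma> t) \<le> (1 + 1 / (\<sigma> - 1)) * exp (5 * (\<Sum>n. real n powr -2)) *
           exp (- (\<Sum>p\<in>P. (1 - twist t p) * real p powr -\<sigma>))"
proof -
  interpret summable_multiplicative "\<lambda>n. f n * dpow \<sigma> t n" by (rule summable_multiplicative_term[OF \<sigma>])
  have r: "real p powr -\<sigma> \<le> 1/2" if "p \<in> P" for p
  proof -
    have "real p powr -\<sigma> \<le> 1 / real p" using loc_facts(4)[OF \<sigma> P(2)[OF that]] .
    also have "\<dots> \<le> 1/2" using prime_ge_2_nat[OF P(2)[OF that]] by (intro divide_left_mono) auto
    finally show ?thesis .
  qed
  have "norm (F \<sigma> t) = (\<Prod>p\<in>P. norm (loc p)) * norm (\<Sum>\<^sub>\<infinity>n\<in>sifted P. f n * dpow \<sigma> t n)"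
    unfolding F_def by (subst euler_finite[OF P]) (simp_all add: norm_mult prod_norm)
  also have "norm (\<Sum>\<^sub>\<infinity>n\<in>sifted P. f n * dpow \<sigma> t n) \<le> zsum \<sigma> P"
    unfolding zsum_def
    by (intro norm_infsum_le[OF has_sum_infsum has_sum_infsum] a_summable_on powr_summable_on norm_term_le \<sigma>)
  also have "zsum \<sigma> P = (\<Sum>n. real n powr - \<sigma>) * (\<Prod>p\<in>P. 1 - real p powr -\<sigma>)"
    by (rule zeta_euler[OF \<sigma> P, symmetric])
  also have "(\<Prod>p\<in>P. norm (loc p)) * ((\<Sum>n. real n powr - \<sigma>) * (\<Prod>p\<in>P. 1 - real p powr -\<sigma>)) =
         (\<Sum>n. real n powr - \<sigma>) * (\<Prod>p\<in>P. norm (loc p) * (1 - real p powr -\<sigma>))"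
    by (simp add: prod.distrib mult_ac)
  also have "\<dots> \<le> (1 + 1 / (\<sigma> - 1)) * (\<Prod>p\<in>P. exp (- ((1 - twist t p) * real p powr -\<sigma>) + 5 * (real p powr -\<sigma>)^2))"
  proof (intro mult_mono zeta_bounds \<sigma> prod_mono conjI)
    fix p assume p: "p \<in> P"
    note lf = loc_facts(1,2)[OF \<sigma> P(2)[OF p], where t=t] loc_facts(3,4)[OF \<sigma> P(2)[OF p]] loc_facts(5,6)[OF \<sigma> P(2)[OF p], where t=t]
    show "0 \<le> norm (loc p) * (1 - real p powr -\<sigma>)" using r[OF p] by (intro mult_nonneg_nonneg) auto
    have "norm (loc p) * (1 - real p powr -\<sigma>) \<le> exp (- (real p powr -\<sigma> - real p powr -\<sigma> * twist t p) + 5 * (real p powr -\<sigma>)^2)"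
      unfolding lf(5)[symmetric] lf(6) using r[OF p] lf(3)
      by (intro local_factor_upper lf(1,2)) auto
    thus "norm (loc p) * (1 - real p powr -\<sigma>) \<le> exp (- ((1 - twist t p) * real p powr -\<sigma>) + 5 * (real p powr -\<sigma>)^2)"
      by (simp add: algebra_simps)
  next
    have "real p powr -\<sigma> \<le> 1" if "p \<in> P" for p using r[OF that] by linarith
    thus "0 \<le> (\<Prod>p\<in>P. norm (loc p) * (1 - real p powr -\<sigma>))"
      by (intro prod_nonneg mult_nonneg_nonneg ballI) auto
  qed (use \<sigma> in auto)
  also have "(\<Prod>p\<in>P. exp (- ((1 - twist t p) * real p powr -\<sigma>) + 5 * (real p powr -\<sigma>)^2)) =
          exp (5 * (\<Sum>p\<in>P. (real p powr -\<sigma>)^2)) * exp (- (\<Sum>p\<in>P. (1 - twist t p) * real p powr -\<sigma>))"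
    unfolding exp_sum[OF P(1), symmetric] exp_add[symmetric] sum_distrib_left
    by (simp add: sum.distrib sum_subtractf)
  also have "\<dots> \<le> exp (5 * (\<Sum>n. real n powr -2)) * exp (- (\<Sum>p\<in>P. (1 - twist t p) * real p powr -\<sigma>))"
    using sum_square_le[OF \<sigma> P] by (intro mult_right_mono) auto
  finally show ?thesis using \<sigma> by (simp add: mult_ac mult_left_mono mult_right_mono prod_nonneg)
qed

text \<open>The comparison with zeta now runs over all p <= y, followed by a limit in y. Since 1 -
  \<open>twist t p\<close> is nonnegative and p^(-\<sigma>) <= 1 / p, a bound B at \<sigma> = 1
  serves all \<sigma> > 1, and the constants stay uniform in \<sigma>.\<close>

lemma norm_F_lower:
  assumes \<sigma>: "\<sigma> > 1" and B: "\<And>y. (\<Sum>p | prime p \<and> p \<le> y. (1 - twist t p) / real p) \<le> B"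
  shows "norm (F \<sigma> t) \<ge> 1 / (\<sigma> - 1) * (norm (\<Sum>k. f (2 ^ k) * dpow \<sigma> t (2 ^ k)) / 2) *
           exp (- B - 11 * (\<Sum>n. real n powr -2))"
proof -
  interpret summable_multiplicative "\<lambda>n. f n * dpow \<sigma> t n" by (rule summable_multiplicative_term[OF \<sigma>])
  interpret z: summable_multiplicative "\<lambda>n. complex_of_real (real n powr - \<sigma>)"
    by (rule summable_multiplicative_powr[OF \<sigma>])
  define Z where "Z = (\<Sum>n. real n powr -2)"
  define P where "P y = {p. prime p \<and> p \<le> y}" for y :: nat
  have finP: "finite (P y)" for y unfolding P_def by (rule finite_subset[of _ "{..y}"]) auto
  define l2 where "l2 = norm (\<Sum>k. f (2 ^ k) * dpow \<sigma> t (2 ^ k))"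
  define C where "C = 1 / (\<sigma> - 1) * (l2 / 2) * exp (- B - 11 * Z)"
  define I where "I y = norm (infsum (\<lambda>n. f n * dpow \<sigma> t n) (sifted (P y)))" for y
  have C: "C * I y \<le> norm (F \<sigma> t) * zsum \<sigma> (P y)" if y: "y \<ge> 2" for y
  proof -
    define P' where "P' = P y - {2}"
    have P2: "P y = insert 2 P'" "2 \<notin> P'" using y by (auto simp: P_def P'_def)
    have P': "finite P'" "\<And>p. p \<in> P' \<Longrightarrow> prime p" using finP by (auto simp: P'_def P_def)
    have P'3: "p \<ge> 3" if "p \<in> P'" for p
      using that prime_ge_2_nat[OF P'(2)[OF that]] by (auto simp: P'_def)
    have bnd: "(\<Sum>p\<in>P'. (1 - twist t p) * real p powr -\<sigma>) \<le> B"
    proof -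
      have "(\<Sum>p\<in>P'. (1 - twist t p) * real p powr -\<sigma>) \<le> (\<Sum>p\<in>P'. (1 - twist t p) / real p)"
      proof (intro sum_mono)
        fix p assume "p \<in> P'"
        thus "(1 - twist t p) * real p powr -\<sigma> \<le> (1 - twist t p) / real p"
          using mult_left_mono[OF loc_facts(4)[OF \<sigma> P'(2)], of p "1 - twist t p"] twist_le[of t p] by simp
      qed
      also have "\<dots> \<le> (\<Sum>p\<in>P y. (1 - twist t p) / real p)"
        unfolding P2(1) using P' twist_le[of t 2] P2(2) by simp
      also have "\<dots> \<le> B" unfolding P_def by (rule B)
      finally show ?thesis .
    qed
    \<comment> \<open>At p = 2 only the zeta factor is estimated; the local factor of f may vanish
      and is kept in the bound.\<close>
    have two: "norm (loc 2) * (1 - real 2 powr -\<sigma>) \<ge> l2 * (1/2)"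
    proof -
      have "real 2 powr -\<sigma> \<le> 1 / real 2" by (rule loc_facts(4)[OF \<sigma>]) auto
      moreover have "norm (loc 2) = l2" unfolding l2_def using loc_facts(6)[OF \<sigma>, where p=2 and t=t] by simp
      ultimately have "norm (loc 2) = l2" "1/2 \<le> 1 - real 2 powr -\<sigma>" by auto
      thus ?thesis by (metis mult_left_mono norm_ge_zero)
    qed
    have "C = 1 / (\<sigma> - 1) * ((l2 * (1/2)) * exp (- B - 11 * Z))" by (simp add: C_def)
    also have "\<dots> \<le> (\<Sum>n. real n powr - \<sigma>) * ((norm (loc 2) * (1 - real 2 powr -\<sigma>)) * (\<Prod>p\<in>P'. norm (loc p) * (1 - real p powr -\<sigma>)))"
    proof (rule mult_mono[OF zeta_bounds(2)[OF \<sigma>] mult_mono[OF two]])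
      have "exp (- B - 11 * Z) \<le> exp (\<Sum>p\<in>P'. - ((1 - twist t p) * real p powr -\<sigma>) - 11 * (real p powr -\<sigma>)^2)"
        using bnd sum_square_le[OF \<sigma> P'] unfolding Z_def
        by (simp add: sum_subtractf sum_negf flip: sum_distrib_left)
      also have "\<dots> = (\<Prod>p\<in>P'. exp (- ((1 - twist t p) * real p powr -\<sigma>) - 11 * (real p powr -\<sigma>)^2))"
        by (rule exp_sum[OF P'(1)])
      also have "\<dots> \<le> (\<Prod>p\<in>P'. norm (loc p) * (1 - real p powr -\<sigma>))"
      proof (intro prod_mono conjI)
        fix p assume p: "p \<in> P'"
        note lf = loc_facts(1,2)[OF \<sigma> P'(2)[OF p], where t=t] loc_facts(3,4)[OF \<sigma> P'(2)[OF p]] loc_facts(5,6)[OF \<sigma> P'(2)[OF p], where t=t]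
        have "1 / real p \<le> 1/3" using P'3[OF p] by (intro divide_left_mono) auto
        hence r: "real p powr -\<sigma> \<le> 1/3" using lf(4) by linarith
        have "exp (- (real p powr -\<sigma> - real p powr -\<sigma> * twist t p) - 11 * (real p powr -\<sigma>)^2) \<le> norm (loc p) * (1 - real p powr -\<sigma>)"
          unfolding lf(5)[symmetric] lf(6) using r lf(3)
          by (intro local_factor_lower lf(1,2)) auto
        thus "exp (- ((1 - twist t p) * real p powr -\<sigma>) - 11 * (real p powr -\<sigma>)^2) \<le> norm (loc p) * (1 - real p powr -\<sigma>)"
          by (simp add: algebra_simps)
      qed auto
      finally show "exp (- B - 11 * Z) \<le> (\<Prod>p\<in>P'. norm (loc p) * (1 - real p powr -\<sigma>))" .
      show "0 \<le> norm (loc 2) * (1 - real 2 powr -\<sigma>)"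
        using order.trans[OF _ two] by (simp add: l2_def)
    qed (auto simp: l2_def intro!: suminf_nonneg summable_powr_neg \<sigma> mult_nonneg_nonneg)
    also have "\<dots> = (\<Prod>p\<in>P y. norm (loc p)) * zsum \<sigma> (P y)"
    proof -
      have "(\<Sum>n. real n powr - \<sigma>) * (\<Prod>p\<in>P y. 1 - real p powr -\<sigma>) = zsum \<sigma> (P y)"
        using finP[of y] by (intro zeta_euler \<sigma>) (auto simp: P_def)
      thus ?thesis unfolding P2(1) using P' P2(2) by (simp add: prod.distrib mult_ac)
    qed
    finally have "C * I y \<le> (\<Prod>p\<in>P y. norm (loc p)) * zsum \<sigma> (P y) * I y"
      by (intro mult_right_mono) (auto simp: I_def)
    also have "\<dots> = norm (F \<sigma> t) * zsum \<sigma> (P y)"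
    proof -
      have "norm (F \<sigma> t) = (\<Prod>p\<in>P y. norm (loc p)) * I y"
        unfolding F_def I_def using euler_finite[OF finP[of y]] by (simp add: P_def norm_mult prod_norm)
      thus ?thesis by (simp add: mult_ac)
    qed
    finally show ?thesis .
  qed
  have lim1: "(\<lambda>y. C * I y) \<longlonglongrightarrow> C * norm (1::complex)"
    unfolding I_def P_def by (intro tendsto_intros sifted_tendsto)
  have "(\<lambda>y. Re (complex_of_real (zsum \<sigma> (P y)))) \<longlonglongrightarrow> Re 1"
    using z.sifted_tendsto unfolding zsum_def P_def infsum_complex_powr[OF \<sigma>] by (rule tendsto_Re)
  hence lim2: "(\<lambda>y. norm (F \<sigma> t) * zsum \<sigma> (P y)) \<longlonglongrightarrow> norm (F \<sigma> t) * 1"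
    by (intro tendsto_mult tendsto_const) simp
  \<comment> \<open>Both sifted remainders tend to 1; the inequality was arranged crosswise so that
    neither of them is divided by.\<close>
  have "C * norm (1::complex) \<le> norm (F \<sigma> t) * 1"
    by (rule tendsto_le[OF sequentially_bot lim2 lim1 eventually_mono[OF eventually_ge_at_top[of 2] C]])
  thus ?thesis by (simp add: C_def l2_def Z_def)
qed

end

section \<open>Halasz's theorem\<close>

context bounded_multiplicative
begin

text \<open>The square of the distance from f to n^(i t), over primes up to an integer y: additive
  in the primes and continuous in t.\<close>

definition Dsum :: "real \<Rightarrow> nat \<Rightarrow> real" where
  "Dsum t y = (\<Sum>p | prime p \<and> p \<le> y. (1 - twist t p) / real p)"

lemma finite_primes_le: "finite {p. prime p \<and> p \<le> (y::nat)}"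
  by (rule finite_subset[of _ "{..y}"]) auto

lemma Dsum_mono: "y \<le> y' \<Longrightarrow> Dsum t y \<le> Dsum t y'"
  unfolding Dsum_def by (intro sum_mono2 finite_primes_le) (auto intro!: divide_nonneg_nonneg simp: abs_le_D1[OF twist_le])

lemma continuous_on_Dsum: "continuous_on A (\<lambda>t. Dsum t y)"
  unfolding Dsum_def twist_def
  by (intro continuous_intros) (auto dest: prime_gt_0_nat)

text \<open>Dini-type compactness: the sets of t with \<open>Dsum t y > B\<close> are open, increase
  with y and cover [-R,R].\<close>

lemma Dsum_uniform:
  assumes div: "\<And>t B. \<exists>y. Dsum t y > B"
  shows "\<exists>y. \<forall>t\<in>{-R..R}. Dsum t y > B"
proof -
  define U where "U y = {t. Dsum t y > B}" for y
  have "compact {-R..R}" by simp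
  moreover have "open (U y)" for y
    unfolding U_def by (intro open_Collect_less continuous_on_Dsum continuous_on_const)
  moreover have "{-R..R} \<subseteq> (\<Union>y\<in>UNIV. U y)" using div by (auto simp: U_def)
  ultimately obtain C where C: "finite C" "{-R..R} \<subseteq> (\<Union>y\<in>C. U y)"
    by (meson compactE_image)
  show ?thesis
  proof (intro exI ballI)
    fix t assume "t \<in> {-R..R}"
    then obtain y where y: "y \<in> C" "Dsum t y > B" using C by (auto simp: U_def)
    have "y \<le> Max (insert 0 C)" using y C by (intro Max_ge) auto
    from Dsum_mono[OF this, of t] y show "Dsum t (Max (insert 0 C)) > B" by linarith
  qed
qed

text \<open>A single y serves all |t| <= R, so only finitely many primes matter, and for \<sigma>
  near 1 their weights p^(-\<sigma>) are at least half of 1 / p.\<close>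

lemma F_small_uniform:
  assumes div: "\<And>t B. \<exists>y. Dsum t y > B" and e: "e > 0"
  obtains \<delta> where "\<delta> > 0" "\<And>\<sigma> t. 1 < \<sigma> \<Longrightarrow> \<sigma> < 1 + \<delta> \<Longrightarrow> \<bar>t\<bar> \<le> R \<Longrightarrow> norm (F \<sigma> t) \<le> e / (\<sigma> - 1)"
proof -
  define C where "C = 2 * exp (5 * (\<Sum>n. real n powr -2))"
  have C: "C > 0" by (simp add: C_def)
  \<comment> \<open>Doubled because half of \<open>Dsum\<close> is lost on passing from 1 / p to
    p^(-\<sigma>). The factor 2 in C covers 1 + 1 / (\<sigma> - 1) <= 2 / (\<sigma> - 1).\<close>
  define B where "B = 2 * ln (C / e)"
  obtain y where y: "\<And>t. t \<in> {-R..R} \<Longrightarrow> Dsum t y > B" using Dsum_uniform[OF div, of R B] by blast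
  define Y where "Y = real (y + 2)"
  have Y: "Y > 1" by (simp add: Y_def)
  \<comment> \<open>The quotient gives Y^(-(\<sigma>-1)) >= 1/2, the minimum keeps \<sigma> below 2;
    the shift by 2 in Y makes ln Y positive even for y = 0.\<close>
  define \<delta> where "\<delta> = min 1 (ln 2 / ln Y)"
  have \<delta>: "\<delta> > 0" using Y by (simp add: \<delta>_def)
  show ?thesis
  proof (rule that[OF \<delta>])
    fix \<sigma> t assume \<sigma>: "1 < \<sigma>" "\<sigma> < 1 + \<delta>" and t: "\<bar>t\<bar> \<le> R"
    define P where "P = {p. prime p \<and> p \<le> y}"
    have half: "Y powr - (\<sigma> - 1) \<ge> 1/2"
    proof -
      have "\<sigma> - 1 \<le> ln 2 / ln Y" using \<sigma> by (simp add: \<delta>_def)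
      hence "(\<sigma> - 1) * ln Y \<le> ln 2" using Y by (simp add: pos_le_divide_eq)
      hence "exp (- ln 2) \<le> exp (- ((\<sigma> - 1) * ln Y))" by simp
      moreover have "exp (- ln 2) = (1/2 :: real)" by (simp add: exp_minus)
      moreover have "exp (- ((\<sigma> - 1) * ln Y)) = Y powr - (\<sigma> - 1)" using Y by (simp add: powr_def algebra_simps)
      ultimately show ?thesis by (simp only:)
    qed
    have "(\<Sum>p\<in>P. (1 - twist t p) * real p powr -\<sigma>) \<ge> (\<Sum>p\<in>P. (1 - twist t p) / real p * (1/2))"
    proof (intro sum_mono)
      fix p assume p: "p \<in> P"
      have p1: "real p \<ge> 1" "real p \<le> Y" using p prime_ge_1_nat by (auto simp: P_def Y_def)
      have "1/2 \<le> real p powr - (\<sigma> - 1)"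
        using half p1 \<sigma> powr_mono2'[of "- (\<sigma> - 1)" "real p" Y] by simp
      hence "1 / real p * (1/2) \<le> 1 / real p * real p powr - (\<sigma> - 1)" by (intro mult_left_mono) auto
      also have "\<dots> = real p powr - \<sigma>" using p1 by (simp add: powr_diff powr_minus field_simps)
      finally have "(1 - twist t p) * (1 / real p * (1/2)) \<le> (1 - twist t p) * real p powr - \<sigma>"
        using abs_le_D1[OF twist_le[of t p]] by (intro mult_left_mono) auto
      thus "(1 - twist t p) / real p * (1/2) \<le> (1 - twist t p) * real p powr - \<sigma>" by simp
    qed
    also have "(\<Sum>p\<in>P. (1 - twist t p) / real p * (1/2)) = Dsum t y / 2"
      unfolding Dsum_def P_def by (simp add: sum_divide_distrib)
    finally have "ln (C / e) \<le> (\<Sum>p\<in>P. (1 - twist t p) * real p powr -\<sigma>)"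
      using y[of t] t by (simp add: B_def abs_le_iff)
    hence "exp (- (\<Sum>p\<in>P. (1 - twist t p) * real p powr -\<sigma>)) \<le> exp (- ln (C / e))" by simp
    also have "\<dots> = e / C" using e C by (simp add: exp_minus)
    finally have small: "exp (- (\<Sum>p\<in>P. (1 - twist t p) * real p powr -\<sigma>)) \<le> e / C" .
    have "norm (F \<sigma> t) \<le> (1 + 1 / (\<sigma> - 1)) * exp (5 * (\<Sum>n. real n powr -2)) *
           exp (- (\<Sum>p\<in>P. (1 - twist t p) * real p powr -\<sigma>))"
      using \<sigma> by (intro norm_F_upper) (auto simp: P_def finite_primes_le)
    also have "\<dots> \<le> (2 / (\<sigma> - 1)) * exp (5 * (\<Sum>n. real n powr -2)) * (e / C)"
    proof (intro mult_mono small order.refl)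
      have "\<sigma> - 1 \<le> 1" using \<sigma> by (simp add: \<delta>_def)
      hence "\<sigma> / (\<sigma> - 1) \<le> 2 / (\<sigma> - 1)" using \<sigma> by (intro divide_right_mono) auto
      moreover have "1 + 1 / (\<sigma> - 1) = \<sigma> / (\<sigma> - 1)" using \<sigma> by (simp add: field_simps)
      ultimately show "1 + 1 / (\<sigma> - 1) \<le> 2 / (\<sigma> - 1)" by simp
    qed (use \<sigma> in auto)
    also have "\<dots> = e / (\<sigma> - 1)" by (simp add: C_def)
    finally show "norm (F \<sigma> t) \<le> e / (\<sigma> - 1)" .
  qed
qed

text \<open>The normalised weight is 1 up to N exp (-h), so at most N (1 - exp (-h)) + 1 terms are
  affected, each by at most 1.\<close>

lemma smoothing_error:
  assumes \<sigma>: "\<sigma> \<ge> 1" and h: "h > 0" and N: "N \<ge> 1"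
  shows "norm ((\<Sum>n=1..N. f n) - smoothed_sum.T f (\<lambda>u. cutoff \<sigma> h u / (exp (\<sigma> * h) - 1)) N (real N)) \<le> h * real N + 1"
proof -
  define D where "D = exp (\<sigma> * h) - 1"
  have D: "D > 0" unfolding D_def using \<sigma> h by simp
  interpret smoothed_sum f "\<lambda>u. cutoff \<sigma> h u / (exp (\<sigma> * h) - 1)" N
    using cutoff_bounds[of \<sigma> h] \<sigma> h N D
    by unfold_locales (auto simp: D_def)
  define x where "x = real N * exp (- h)"
  have x0: "x \<ge> 0" "x \<le> real N" using h by (auto simp: x_def mult_left_le)
  have "(\<Sum>n=1..N. f n) - T (real N) = (\<Sum>n=1..N. f n * of_real (1 - cutoff \<sigma> h (ln (real N / real n)) / D))"
    unfolding T_def D_def by (simp add: algebra_simps sum_subtractf)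
  also have "norm \<dots> \<le> (\<Sum>n=1..N. if real n > x then 1 else 0)"
  proof (intro sum_norm_le)
    fix n assume n: "n \<in> {1..N}"
    define k where "k = cutoff \<sigma> h (ln (real N / real n)) / D"
    show "norm (f n * of_real (1 - k)) \<le> (if real n > x then 1 else 0)"
    proof (cases "real n > x")
      case True
      have "0 \<le> k" "k \<le> 1" using cutoff_bounds[of \<sigma> h "ln (real N / real n)"] \<sigma> h D by (auto simp: k_def D_def)
      hence "norm (f n) * \<bar>1 - k\<bar> \<le> 1 * 1" by (intro mult_mono norm_f_le) auto
      thus ?thesis using True by (simp add: norm_mult del: of_real_diff)
    next
      case False
      hence "exp h \<le> real N / real n" using n by (simp add: x_def exp_minus field_simps)
      hence "h \<le> ln (real N / real n)" using n N by (subst ln_ge_iff) auto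
      hence "k = 1" using cutoff_bounds(4)[of \<sigma> h "ln (real N / real n)"] \<sigma> h D by (simp add: k_def D_def)
      thus ?thesis using False by simp
    qed
  qed
  also have "\<dots> = real (card {n\<in>{1..N}. real n > x})"
    by (subst sum.inter_filter [symmetric]) auto
  also have "{n\<in>{1..N}. real n > x} \<subseteq> {nat \<lfloor>x\<rfloor><..N}" using x0 by (auto; linarith)
  hence "card {n\<in>{1..N}. real n > x} \<le> card {nat \<lfloor>x\<rfloor><..N}" by (intro card_mono) auto
  hence "real (card {n\<in>{1..N}. real n > x}) \<le> real (N - nat \<lfloor>x\<rfloor>)" by simp
  also have "\<dots> \<le> real N - x + 1" using x0 by linarith
  also have "\<dots> \<le> h * real N + 1"
    using mult_left_mono[OF exp_ge_add_one_self[of "- h"], of "real N"] by (simp add: x_def algebra_simps)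
  finally show ?thesis .
qed

text \<open>The quarter (1 + t^2)^(-1/4) set aside from the kernel is at most 1, and at most 1 /
  sqrt R beyond R, where only the poor bound A' is at hand.\<close>

lemma weight_bound:
  assumes R: "R > 0" and A: "\<And>t. \<bar>t\<bar> \<le> R \<Longrightarrow> X t \<le> A" and A': "\<And>t. X t \<le> A'" and pos: "A \<ge> 0" "A' \<ge> 0"
  shows "X t / (1 + t^2) \<le> (A + A' / sqrt R) * decay_weight t"
proof -
  have q: "1 + t^2 > 0" by (simp add: add_pos_nonneg)
  have eq: "1 / (1 + t^2) = decay_weight t * (1 + t^2) powr (-1/4)"
    using q by (simp add: decay_weight_def powr_minus field_simps flip: powr_add)
  have le1: "(1 + t^2) powr (-1/4) \<le> 1"
    using powr_mono2'[of "-1/4" 1 "1 + t^2"] by simp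
  have "X t * (1 + t^2) powr (-1/4) \<le> A + A' / sqrt R"
  proof (cases "\<bar>t\<bar> \<le> R")
    case True
    have "X t * (1 + t^2) powr (-1/4) \<le> A * (1 + t^2) powr (-1/4)" using A[OF True] by (intro mult_right_mono) auto
    also have "\<dots> \<le> A" using le1 pos by (simp add: mult_left_le)
    also have "\<dots> \<le> A + A' / sqrt R" using pos R by simp
    finally show ?thesis .
  next
    case False
    have "R^2 \<le> 1 + t^2" using False R power_mono[of R "\<bar>t\<bar>" 2] by simp
    hence "(1 + t^2) powr (-1/4) \<le> (R^2) powr (-1/4)" using R by (intro powr_mono2') auto
    also have "\<dots> = R powr (-1/2)" using R by (simp add: powr_powr flip: powr_numeral)
    also have "\<dots> = 1 / sqrt R" using R by (simp add: powr_minus powr_half_sqrt field_simps)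
    finally have s: "(1 + t^2) powr (-1/4) \<le> 1 / sqrt R" .
    have "X t * (1 + t^2) powr (-1/4) \<le> A' * (1 + t^2) powr (-1/4)" using A'[of t] by (intro mult_right_mono) auto
    also have "\<dots> \<le> A' * (1 / sqrt R)" using s pos by (intro mult_left_mono) auto
    also have "\<dots> \<le> A + A' / sqrt R" using pos by simp
    finally show ?thesis .
  qed
  hence "decay_weight t * (X t * (1 + t^2) powr (-1/4)) \<le> decay_weight t * (A + A' / sqrt R)"
    using decay_weight_pos[of t] by (intro mult_left_mono) auto
  moreover have "X t / (1 + t^2) = decay_weight t * (X t * (1 + t^2) powr (-1/4))"
  proof -
    have "X t / (1 + t^2) = X t * (1 / (1 + t^2))" by simp
    also have "\<dots> = X t * (decay_weight t * (1 + t^2) powr (-1/4))" by (simp only: eq)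
    also have "\<dots> = decay_weight t * (X t * (1 + t^2) powr (-1/4))" by (rule mult.left_commute)
    finally show ?thesis .
  qed
  ultimately show ?thesis by (simp only: mult.commute)
qed

text \<open>Y is N^(1-\<eta>) rounded up, which at most doubles it. The resulting loss of ln 2 is at
  most half of \<eta> ln N by hypothesis.\<close>

lemma split_point:
  assumes \<eta>: "0 < \<eta>" "\<eta> \<le> 1/2" and N: "\<eta> * ln (real N) \<ge> 2 * ln 2" "N \<ge> 2"
  obtains Y where "1 \<le> Y" "Y < N" "\<eta> * ln (real N) / 2 \<le> ln (real N / real Y)" "ln (real N / real Y) \<le> \<eta> * ln (real N)"
proof -
  define z where "z = real N powr (1 - \<eta>)"
  define Y where "Y = nat \<lceil>z\<rceil>"
  have z1: "z \<ge> 1" unfolding z_def using N \<eta> by (intro ge_one_powr_ge_zero) auto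
  have Y: "z \<le> real Y" "real Y \<le> 2 * z" "Y \<ge> 1" using z1 unfolding Y_def by linarith+
  have lnz: "ln z = ln (real N) - \<eta> * ln (real N)" using N by (simp add: z_def ln_powr algebra_simps)
  have eq: "ln (real N / real Y) = ln (real N) - ln (real Y)" using N Y by (simp add: ln_div)
  have "ln z \<le> ln (real Y)" using z1 Y by simp
  hence 1: "ln (real N / real Y) \<le> \<eta> * ln (real N)" using lnz eq by simp
  have "ln (real Y) \<le> ln (2 * z)" using z1 Y by (intro ln_mono) auto
  also have "\<dots> = ln 2 + ln z" using z1 by (simp add: ln_mult)
  finally have 2: "\<eta> * ln (real N) / 2 \<le> ln (real N / real Y)" using lnz eq N by simp
  have "ln (2::real) > 0" by simp
  hence "ln (real N / real Y) > 0" using 2 N by linarith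
  hence "real N > real Y" using N Y by (simp add: ln_div)
  thus ?thesis using that[of Y] 1 2 Y by simp
qed

text \<open>Of the 5 \<eta>, one each comes from the integral, from the range d > Y and from the
  lower order terms; the other two come from undoing the smoothing.\<close>

lemma halasz_bound:
  assumes div: "\<And>t B. \<exists>y. Dsum t y > B" and \<eta>: "0 < \<eta>" "\<eta> \<le> 1/2"
  shows "eventually (\<lambda>N. norm (\<Sum>n=1..N. f n) \<le> 5 * \<eta> * real N) sequentially"
proof -
  obtain K where K: "K > 0" and
    VK: "\<And>\<sigma> h N M Y G. 1 \<le> \<sigma> \<Longrightarrow> \<sigma> \<le> 2 \<Longrightarrow> h > 0 \<Longrightarrow> N \<ge> 1 \<Longrightarrow> N \<le> M \<Longrightarrow> Y \<le> N \<Longrightarrow>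
       (\<And>t. norm (\<Sum>m=1..M. f m * dpow \<sigma> t m) / (1 + t^2) \<le> G * decay_weight t) \<Longrightarrow>
       (\<Sum>d=1..Y. Lam d * norm (smoothed_sum.V f (\<lambda>u. cutoff \<sigma> h u / (exp (\<sigma> * h) - 1)) N (real N / real d)))
         \<le> (2 * h + 8) / h * real N powr \<sigma> * G * K * (ln (real N) + 4)"
    by (rule V_sum_bound) blast
  obtain K1 where K1: "K1 \<ge> 0" "\<And>N. (\<Sum>d=1..N. Lam d / (real d * real (aprimedivisor d))) \<le> K1"
    using sum_mangoldt_over_apd_bounded by blast
  define h where "h = \<eta>"
  have h: "h > 0" using \<eta> by (simp add: h_def)
  define Ch where "Ch = (2 * h + 8) / h * exp 1 * K"
  have Ch: "Ch > 0" using h K by (simp add: Ch_def)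
  define C0 where "C0 = 2 * K1 + 1"
  have C0: "C0 > 0" using K1 by (simp add: C0_def)
  \<comment> \<open>The saving required of sup |F|: with it the integral term 4 Ch \<kappa> / \<eta>
    * L is exactly \<eta> L.\<close>
  define \<kappa> where "\<kappa> = \<eta>^2 / (4 * Ch)"
  have \<kappa>: "\<kappa> > 0" using \<eta> Ch by (simp add: \<kappa>_def)
  \<comment> \<open>Beyond R the kernel gains 1 / sqrt R = \<kappa> / 4, so that the trivial bound
    for F is good enough there.\<close>
  define R where "R = (4 / \<kappa>)^2"
  have R: "R > 0" "1 / sqrt R = \<kappa> / 4" using \<kappa> by (auto simp: R_def real_sqrt_power)
  obtain \<delta> where \<delta>: "\<delta> > 0" "\<And>\<sigma> t. 1 < \<sigma> \<Longrightarrow> \<sigma> < 1 + \<delta> \<Longrightarrow> \<bar>t\<bar> \<le> R \<Longrightarrow> norm (F \<sigma> t) \<le> (\<kappa>/4) / (\<sigma> - 1)"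
    using F_small_uniform[OF div, of "\<kappa>/4" R] \<kappa> by auto
  \<comment> \<open>In turn: \<sigma> <= 2 and L + 4 <= 2 L; \<sigma> < 1 + \<delta>; existence of
    the split point; absorption of the additive constants in the bounds for F into \<kappa> L;
    absorption of the lower order terms into \<eta> L.\<close>
  define L0 where "L0 = Max {4, 2 / \<delta>, 2 * ln 2 / \<eta>, (2 + \<kappa>) / (\<kappa> / 2), (4 * C0 / \<eta> + 5 + C0) / \<eta>}"
  have lnlim: "filterlim (\<lambda>N. ln (real N)) at_top sequentially"
    by (rule filterlim_compose[OF ln_at_top filterlim_real_sequentially])
  have ev: "eventually (\<lambda>N. ln (real N) \<ge> L0) sequentially"
    using lnlim by (auto simp: filterlim_at_top)
  have ev2: "eventually (\<lambda>N. real N \<ge> 1 / \<eta>) sequentially"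
    using filterlim_real_sequentially by (auto simp: filterlim_at_top)
  show ?thesis using ev ev2 eventually_ge_at_top[of 2]
  proof eventually_elim
    case (elim N)
    define L where "L = ln (real N)"
    have L: "L \<ge> 4" "L \<ge> 2 / \<delta>" "L \<ge> 2 * ln 2 / \<eta>" "L \<ge> (2 + \<kappa>) / (\<kappa> / 2)" "L \<ge> (4 * C0 / \<eta> + 5 + C0) / \<eta>"
      using elim(1) unfolding L0_def L_def by simp_all
    have N: "N \<ge> 1" "N \<ge> 2" "real N > 0" using elim by auto
    \<comment> \<open>On this line N^\<sigma> is e N, and the trivial bound for F is L + 1.\<close>
    define \<sigma> where "\<sigma> = 1 + 1 / L"
    have \<sigma>: "1 < \<sigma>" "\<sigma> \<le> 2" using L by (auto simp: \<sigma>_def)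
    have "1 / L < \<delta>"
    proof -
      have "2 \<le> \<delta> * L" using L(2) \<delta>(1) by (simp add: field_simps)
      hence "1 < \<delta> * L" by linarith
      thus ?thesis using L(1) by (simp add: field_simps)
    qed
    hence \<sigma>\<delta>: "\<sigma> < 1 + \<delta>" by (simp add: \<sigma>_def)
    have inv: "1 / (\<sigma> - 1) = L" "\<sigma> - 1 = 1 / L" by (simp_all add: \<sigma>_def)
    obtain M0 where M0: "\<And>M t. M \<ge> M0 \<Longrightarrow> norm (\<Sum>m=1..M. f m * dpow \<sigma> t m) \<le> norm (F \<sigma> t) + 1"
      using partial_sum_le_F[OF \<sigma>(1)] by blast
    \<comment> \<open>M >= M0 makes the partial sum a substitute for F up to 1, and M >= N retains
      all terms of the smoothed sum.\<close>
    define M where "M = max M0 N"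
    define X where "X t = norm (\<Sum>m=1..M. f m * dpow \<sigma> t m)" for t
    have X1: "X t \<le> \<kappa>/4 * L + 1" if "\<bar>t\<bar> \<le> R" for t
      using M0[of M t] \<delta>(2)[OF \<sigma>(1) \<sigma>\<delta> that] inv by (simp add: X_def M_def)
    have X2: "X t \<le> L + 2" for t
      using M0[of M t] norm_F_le_zeta[OF \<sigma>(1), of t] inv by (simp add: X_def M_def)
    have G: "X t / (1 + t^2) \<le> \<kappa> * L * decay_weight t" for t
    proof -
      have "X t / (1 + t^2) \<le> ((\<kappa>/4 * L + 1) + (L + 2) / sqrt R) * decay_weight t"
        using L \<kappa> by (intro weight_bound[OF R(1) X1 X2]) auto
      moreover have "(\<kappa>/4 * L + 1) + (L + 2) / sqrt R \<le> \<kappa> * L"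
      proof -
        have "(L + 2) / sqrt R = (L + 2) * (1 / sqrt R)" by simp
        also have "\<dots> = (L + 2) * (\<kappa> / 4)" unfolding R(2) ..
        finally have "(L + 2) / sqrt R = (L + 2) * (\<kappa> / 4)" .
        moreover have "2 + \<kappa> \<le> L * (\<kappa> / 2)" using L(4) \<kappa> by (simp add: pos_divide_le_eq)
        hence "\<kappa>/4 * L + 1 + (L + 2) * (\<kappa> / 4) \<le> \<kappa> * L" using \<kappa> by (simp add: field_simps)
        ultimately show ?thesis by (simp only:)
      qed
      ultimately show ?thesis using decay_weight_pos[of t] mult_right_mono[of "(\<kappa>/4 * L + 1) + (L + 2) / sqrt R" "\<kappa> * L" "decay_weight t"]
        by linarith
    qed
    have "2 * ln 2 \<le> \<eta> * ln (real N)"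
      using L(3) \<eta> by (simp add: pos_divide_le_eq mult.commute L_def)
    then obtain Y where Y: "1 \<le> Y" "Y < N" "\<eta> * L / 2 \<le> ln (real N / real Y)" "ln (real N / real Y) \<le> \<eta> * L"
      using split_point[OF \<eta> _ N(2)] unfolding L_def by blast
    interpret smoothed_sum f "\<lambda>u. cutoff \<sigma> h u / (exp (\<sigma> * h) - 1)" N
    proof
      have "exp (\<sigma> * h) - 1 > 0" using \<sigma> h by simp
      thus "0 \<le> cutoff \<sigma> h u / (exp (\<sigma> * h) - 1)" "cutoff \<sigma> h u / (exp (\<sigma> * h) - 1) \<le> 1"
        "u \<le> 0 \<Longrightarrow> cutoff \<sigma> h u / (exp (\<sigma> * h) - 1) = 0" for u
        using cutoff_bounds[of \<sigma> h u] \<sigma> h by auto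
    qed (use N in auto)
    define lm where "lm = ln (real N / real Y)"
    have lm: "lm > 0" "lm \<ge> \<eta> * L / 2" "lm \<le> \<eta> * L"
    proof -
      show "lm \<ge> \<eta> * L / 2" "lm \<le> \<eta> * L" using Y by (auto simp: lm_def)
      moreover have "\<eta> * L / 2 > 0" using \<eta> L by simp
      ultimately show "lm > 0" by linarith
    qed
    define W where "W = (\<Sum>d=1..Y. Lam d * norm (V (real N / real d)))"
    have "W \<le> (2 * h + 8) / h * real N powr \<sigma> * (\<kappa> * L) * K * (ln (real N) + 4)"
      unfolding W_def using \<sigma> h N Y G by (intro VK[where M=M]) (auto simp: M_def X_def)
    also have "real N powr \<sigma> = real N * exp 1"
      using N L by (simp add: \<sigma>_def powr_add) (simp add: powr_def L_def)
    finally have W: "W \<le> real N * (Ch * \<kappa> * L * (L + 4))"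
      by (simp add: Ch_def L_def mult_ac)
    have "norm (T (real N)) * L \<le> (W + C0 * real N * (L + 4)) / lm + real N * (lm + 5) + C0 * real N"
      unfolding C0_def L_def lm_def W_def using Y by (intro T_bound K1) auto
    also have "\<dots> \<le> (real N * (Ch * \<kappa> * L * (L + 4)) + C0 * real N * (L + 4)) / lm + real N * (\<eta> * L + 5) + C0 * real N"
      using W lm N C0 by (intro add_mono divide_right_mono mult_left_mono) auto
    also have "\<dots> = real N * ((Ch * \<kappa> * L + C0) * (L + 4) / lm + (\<eta> * L + 5 + C0))"
      by (simp add: algebra_simps add_divide_distrib)
    also have "(Ch * \<kappa> * L + C0) * (L + 4) / lm \<le> (Ch * \<kappa> * L + C0) * (2 * L) / (\<eta> * L / 2)"
    proof (intro frac_le mult_left_mono)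
      show "\<eta> * L / 2 > 0" using \<eta> L by simp
    qed (use L lm Ch \<kappa> C0 in auto)
    also have "\<dots> = 4 * Ch * \<kappa> / \<eta> * L + 4 * C0 / \<eta>"
      using L \<eta> by (simp add: field_simps)
    also have "4 * Ch * \<kappa> / \<eta> = \<eta>" using \<eta> Ch by (simp add: \<kappa>_def power2_eq_square)
    also have "real N * (\<eta> * L + 4 * C0 / \<eta> + (\<eta> * L + 5 + C0)) \<le> real N * (3 * \<eta> * L)"
    proof (intro mult_left_mono)
      have "4 * C0 / \<eta> + 5 + C0 \<le> L * \<eta>" using L(5) \<eta> by (simp add: pos_divide_le_eq)
      thus "\<eta> * L + 4 * C0 / \<eta> + (\<eta> * L + 5 + C0) \<le> 3 * \<eta> * L" by (simp add: algebra_simps)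
    qed auto
    finally have "norm (T (real N)) * L \<le> (3 * \<eta> * real N) * L" 
      using N by (simp add: mult_ac mult_left_mono)
    hence TN: "norm (T (real N)) \<le> 3 * \<eta> * real N" using L by simp
    have "norm ((\<Sum>n=1..N. f n) - T (real N)) \<le> h * real N + 1"
      using smoothing_error[of \<sigma> h N] \<sigma> h N by simp
    moreover have "1 \<le> \<eta> * real N" using elim(2) \<eta> by (simp add: field_simps)
    ultimately have "norm ((\<Sum>n=1..N. f n) - T (real N)) \<le> 2 * \<eta> * real N" by (simp add: h_def)
    hence "norm (\<Sum>n=1..N. f n) \<le> 3 * \<eta> * real N + 2 * \<eta> * real N"
      using TN norm_triangle_sub[of "\<Sum>n=1..N. f n" "T (real N)"] by linarith
    thus ?case by simp
  qed
qed

theorem halasz: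
  assumes div: "\<And>t B. \<exists>y. Dsum t y > B"
  shows "(\<lambda>N. (\<Sum>n=1..N. f n) / of_nat N) \<longlonglongrightarrow> 0"
proof (rule tendstoI)
  fix e :: real assume e: "e > 0"
  define \<eta> where "\<eta> = min (1/2) (e / 10)"
  have \<eta>: "0 < \<eta>" "\<eta> \<le> 1/2" "5 * \<eta> < e" using e by (auto simp: \<eta>_def)
  from halasz_bound[OF div \<eta>(1,2)] eventually_gt_at_top[of 0]
  show "eventually (\<lambda>N. dist ((\<Sum>n=1..N. f n) / of_nat N) 0 < e) sequentially"
  proof eventually_elim
    case (elim N)
    have "norm ((\<Sum>n=1..N. f n) / of_nat N) \<le> 5 * \<eta>"
      using elim by (simp add: norm_divide divide_le_eq)
    thus ?case using \<eta> by simp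
  qed
qed

end

section \<open>Mean values of pretentious functions\<close>

lemma norm_cis_diff_le: "norm (cis x - cis y) \<le> \<bar>x - y\<bar>"
proof -
  have "cis x - cis y = cis y * (cis (x - y) - 1)" by (simp add: algebra_simps cis_mult)
  hence "norm (cis x - cis y) = norm (iexp (x - y) - 1)" by (simp add: norm_mult cis_conv_exp)
  thus ?thesis using norm_iexp_diff_le(1)[of "x - y"] by simp
qed

text \<open>The derivative of x^(-s) has modulus |s| x^(-\<sigma>-1); varying modulus and phase
  separately gives \<sigma> + |t| in place of |s|.\<close>

lemma norm_dpow_diff_le:
  assumes \<sigma>: "\<sigma> > 1" and n: "n \<ge> 1"
  shows "norm (dpow \<sigma> t n - dpow \<sigma> t (Suc n)) \<le> (\<sigma> + \<bar>t\<bar>) * (real n powr -\<sigma> / real n)"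
proof -
  define a where "a = real n powr -\<sigma>"
  define b where "b = real (Suc n) powr -\<sigma>"
  define x where "x = - (t * ln (real n))"
  define y where "y = - (t * ln (real (Suc n)))"
  have ab: "0 \<le> b" "b \<le> a" "a - b \<le> \<sigma> * (a / real n)"
  proof -
    show "0 \<le> b" by (simp add: b_def)
    show "b \<le> a" unfolding a_def b_def using \<sigma> n by (intro powr_mono2') auto
    have "- \<sigma> - 1 = - (\<sigma> + 1)" by simp
    hence "a - b \<le> \<sigma> * real n powr (- \<sigma> - 1)"
      using powr_neg_bounds(2)[of "\<sigma> + 1" n] \<sigma> n by (simp add: a_def b_def)
    also have "real n powr (- \<sigma> - 1) = a / real n" using n by (simp add: a_def powr_diff)
    finally show "a - b \<le> \<sigma> * (a / real n)" .
  qed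
  have xy: "\<bar>x - y\<bar> \<le> \<bar>t\<bar> / real n"
  proof -
    have "x - y = t * ln (1 + 1 / real n)"
    proof -
      have "1 + 1 / real n = real (Suc n) / real n" using n by (simp add: field_simps)
      thus ?thesis using n by (simp add: x_def y_def ln_div algebra_simps del: of_nat_Suc)
    qed
    moreover have "\<bar>ln (1 + 1 / real n)\<bar> \<le> 1 / real n"
      using ln_add_one_self_le_self[of "1 / real n"] by simp
    ultimately show ?thesis using mult_left_mono[of "\<bar>ln (1 + 1 / real n)\<bar>" "1 / real n" "\<bar>t\<bar>"] by (simp add: abs_mult)
  qed
  have "dpow \<sigma> t n - dpow \<sigma> t (Suc n) = of_real a * (cis x - cis y) + of_real (a - b) * cis y"
    by (simp add: dpow_def a_def b_def x_def y_def algebra_simps)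
  also have "norm \<dots> \<le> norm (of_real a * (cis x - cis y)) + norm (of_real (a - b) * cis y)"
    by (rule norm_triangle_ineq)
  also have "\<dots> = a * norm (cis x - cis y) + (a - b)"
    using ab by (simp add: norm_mult a_def del: of_real_diff)
  also have "\<dots> \<le> a * (\<bar>t\<bar> / real n) + \<sigma> * (a / real n)"
    using ab by (intro add_mono mult_left_mono order.trans[OF norm_cis_diff_le xy]) auto
  finally show ?thesis by (simp add: a_def algebra_simps add_divide_distrib)
qed

context bounded_multiplicative
begin

definition S :: "nat \<Rightarrow> complex" where "S N = (\<Sum>n=1..N. f n)"

lemma norm_S_le: "norm (S N) \<le> real N"
proof -
  have "norm (S N) \<le> (\<Sum>n=1..N. 1)" unfolding S_def by (intro sum_norm_le norm_f_le)
  thus ?thesis by simp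
qed

lemma abel_summation:
  "(\<Sum>n=1..M. f n * b n) = S M * b (Suc M) + (\<Sum>n=1..M. S n * (b n - b (Suc n)))"
  by (induction M) (auto simp: S_def algebra_simps)

text \<open>Partial summation against differences of size n^(-\<sigma>-1): each n >= n0 contributes
  e n^(-\<sigma>), which zeta sums, and each smaller n at most 1, all up to the factor \<sigma> +
  |t|.\<close>

lemma norm_F_le_of_mean:
  assumes \<sigma>: "\<sigma> > 1" and e: "e \<ge> 0" and n0: "\<And>n. n \<ge> n0 \<Longrightarrow> norm (S n) \<le> e * real n"
  shows "norm (F \<sigma> t) \<le> (\<sigma> + \<bar>t\<bar>) * (real n0 + e * (1 + 1 / (\<sigma> - 1)))"
proof (rule LIMSEQ_le_const2)
  interpret summable_multiplicative "\<lambda>n. f n * dpow \<sigma> t n" by (rule summable_multiplicative_term[OF \<sigma>])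
  define X where "X = (\<sigma> + \<bar>t\<bar>) * (real n0 + e * (1 + 1 / (\<sigma> - 1)))"
  have "(\<lambda>n. f n * dpow \<sigma> t n) sums F \<sigma> t"
    unfolding F_conv_suminf[OF \<sigma>] by (intro summable_sums summable_norm_cancel[OF a_summable])
  hence lim: "(\<lambda>M. \<Sum>n<Suc M. f n * dpow \<sigma> t n) \<longlonglongrightarrow> F \<sigma> t"
    unfolding sums_def by (rule LIMSEQ_Suc)
  have eq: "(\<Sum>n<Suc M. f n * dpow \<sigma> t n) = (\<Sum>n=1..M. f n * dpow \<sigma> t n)" for M
    by (intro sum.mono_neutral_right) (auto simp: dpow_def)
  have lim0: "(\<lambda>M. real M powr (1 - \<sigma>)) \<longlonglongrightarrow> 0"
    using \<sigma> by (intro tendsto_neg_powr filterlim_real_sequentially) auto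
  \<comment> \<open>The boundary term of the summation by parts is at most M^(1-\<sigma>);
    subtracting this null sequence beforehand leaves the limit unchanged.\<close>
  show "(\<lambda>M. norm (\<Sum>n=1..M. f n * dpow \<sigma> t n) - real M powr (1 - \<sigma>)) \<longlonglongrightarrow> norm (F \<sigma> t)"
    using tendsto_diff[OF tendsto_norm[OF lim] lim0] unfolding eq by simp
  show "\<exists>N. \<forall>M\<ge>N. norm (\<Sum>n=1..M. f n * dpow \<sigma> t n) - real M powr (1 - \<sigma>) \<le> (\<sigma> + \<bar>t\<bar>) * (real n0 + e * (1 + 1 / (\<sigma> - 1)))"
  proof (intro exI allI impI)
    fix M :: nat assume M: "M \<ge> 1"
    have "norm (\<Sum>n=1..M. S n * (dpow \<sigma> t n - dpow \<sigma> t (Suc n))) \<le>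
          (\<Sum>n=1..M. (\<sigma> + \<bar>t\<bar>) * ((if n < n0 then 1 else 0) + e * real n powr -\<sigma>))"
    proof (intro sum_norm_le)
      fix n assume n: "n \<in> {1..M}"
      have "norm (S n * (dpow \<sigma> t n - dpow \<sigma> t (Suc n))) \<le> norm (S n) * ((\<sigma> + \<bar>t\<bar>) * (real n powr -\<sigma> / real n))"
        unfolding norm_mult using n by (intro mult_left_mono norm_dpow_diff_le \<sigma>) auto
      also have "\<dots> = (\<sigma> + \<bar>t\<bar>) * ((norm (S n) / real n) * real n powr -\<sigma>)" by simp
      also have "\<dots> \<le> (\<sigma> + \<bar>t\<bar>) * ((if n < n0 then 1 else 0) + e * real n powr -\<sigma>)"
      proof (intro mult_left_mono)
        show "(norm (S n) / real n) * real n powr -\<sigma> \<le> (if n < n0 then 1 else 0) + e * real n powr -\<sigma>"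
        proof (cases "n < n0")
          case True
          have "real n powr -\<sigma> \<le> 1" using powr_mono2'[of "-\<sigma>" 1 "real n"] n \<sigma> by simp
          hence "(norm (S n) / real n) * real n powr -\<sigma> \<le> 1 * 1"
            using norm_S_le[of n] n by (intro mult_mono) (auto simp: divide_le_eq)
          also have "\<dots> \<le> (if n < n0 then 1 else 0) + e * real n powr -\<sigma>" using True e by simp
          finally show ?thesis .
        next
          case False
          hence "norm (S n) / real n \<le> e" using n0[of n] n by (simp add: divide_le_eq)
          hence "(norm (S n) / real n) * real n powr -\<sigma> \<le> e * real n powr -\<sigma>" by (intro mult_right_mono) auto
          thus ?thesis using False by simp
        qed
      qed (use \<sigma> in auto)
      finally show "norm (S n * (dpow \<sigma> t n - dpow \<sigma> t (Suc n))) \<le> (\<sigma> + \<bar>t\<bar>) * ((if n < n0 then 1 else 0) + e * real n powr -\<sigma>)" .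
    qed
    also have "\<dots> = (\<sigma> + \<bar>t\<bar>) * (real (card {n\<in>{1..M}. n < n0}) + e * (\<Sum>n=1..M. real n powr -\<sigma>))"
    proof -
      have "(\<Sum>n=1..M. if n < n0 then 1 else 0::real) = real (card {n\<in>{1..M}. n < n0})"
        by (subst sum.inter_filter[symmetric]) auto
      thus ?thesis unfolding sum_distrib_left[symmetric] sum.distrib by simp
    qed
    also have "\<dots> \<le> (\<sigma> + \<bar>t\<bar>) * (real n0 + e * (1 + 1 / (\<sigma> - 1)))"
    proof (intro mult_left_mono add_mono e)
      have "card {n\<in>{1..M}. n < n0} \<le> card {..<n0}" by (intro card_mono) auto
      thus "real (card {n\<in>{1..M}. n < n0}) \<le> real n0" by simp
      have "(\<Sum>n=1..M. real n powr -\<sigma>) \<le> (\<Sum>n. real n powr -\<sigma>)"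
        by (intro sum_le_suminf summable_powr_neg \<sigma>) auto
      thus "(\<Sum>n=1..M. real n powr -\<sigma>) \<le> 1 + 1 / (\<sigma> - 1)" using zeta_bounds(1)[OF \<sigma>] by linarith
    qed (use \<sigma> in auto)
    finally have 1: "norm (\<Sum>n=1..M. S n * (dpow \<sigma> t n - dpow \<sigma> t (Suc n))) \<le> X" unfolding X_def .
    have "norm (S M * dpow \<sigma> t (Suc M)) \<le> real M * real M powr -\<sigma>"
      unfolding norm_mult norm_dpow using M \<sigma> by (intro mult_mono norm_S_le powr_mono2') auto
    also have "\<dots> = real M powr (1 - \<sigma>)" using M by (simp add: powr_diff powr_minus field_simps)
    finally have 2: "norm (S M * dpow \<sigma> t (Suc M)) \<le> real M powr (1 - \<sigma>)" .
    have "norm (\<Sum>n=1..M. f n * dpow \<sigma> t n) \<le> norm (S M * dpow \<sigma> t (Suc M)) + norm (\<Sum>n=1..M. S n * (dpow \<sigma> t n - dpow \<sigma> t (Suc n)))"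
      unfolding abel_summation by (rule norm_triangle_ineq)
    thus "norm (\<Sum>n=1..M. f n * dpow \<sigma> t n) - real M powr (1 - \<sigma>) \<le> (\<sigma> + \<bar>t\<bar>) * (real n0 + e * (1 + 1 / (\<sigma> - 1)))"
      using 1 2 unfolding X_def by linarith
  qed
qed

text \<open>The Euler factor of f at the prime 2, taken at 1 + i t.\<close>

definition loc2 :: "real \<Rightarrow> complex" where
  "loc2 t = (\<Sum>k. f (2 ^ k) * cis (- (t * ln (real (2 ^ k)))) * (1/2) ^ k)"

text \<open>As \<sigma> decreases to 1, (\<sigma> - 1) |F| stays above a fixed multiple of the local
  factor at 2 by the Euler product, whereas mean value 0 sends it to 0 by partial summation.\<close>

theorem mean_not_zero:
  assumes B: "\<And>y. Dsum t y \<le> B" and nz: "loc2 t \<noteq> 0"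
  shows "\<not> (\<lambda>N. (\<Sum>n=1..N. f n) / of_nat N) \<longlonglongrightarrow> 0"
proof
  assume lim: "(\<lambda>N. (\<Sum>n=1..N. f n) / of_nat N) \<longlonglongrightarrow> 0"
  define c where "c k = f (2 ^ k) * cis (- (t * ln (real (2 ^ k))))" for k
  have nc: "norm (c k) \<le> 1" for k using norm_f_le[of "2^k"] by (simp add: c_def norm_mult)
  define Q where "Q x = (\<Sum>k. c k * x ^ k)" for x :: complex
  \<comment> \<open>The local factor at 2 is a power series in 2^(-\<sigma>) with bounded
    coefficients; it converges at 3/4, beyond the point 1/2 that belongs to \<sigma> = 1.\<close>
  have contQ: "isCont Q (1/2)"
    unfolding Q_def
  proof (rule isCont_powser)
    show "summable (\<lambda>k. c k * (3/4) ^ k)"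
      by (rule summable_comparison_test'[OF summable_geometric[of "3/4::real"], of 0])
         (use nc in \<open>auto simp: norm_mult norm_power mult_left_le_one_le\<close>)
  qed (auto simp: norm_divide)
  have Qloc: "Q (of_real (2 powr -\<sigma>)) = (\<Sum>k. f (2 ^ k) * dpow \<sigma> t (2 ^ k))" for \<sigma>
  proof -
    have "real (2 ^ k) powr - \<sigma> = (2 powr - \<sigma>) ^ k" for k
    proof -
      have "real (2 ^ k) powr - \<sigma> = (2 powr real k) powr - \<sigma>" by (simp add: powr_realpow)
      also have "\<dots> = (2 powr - \<sigma>) powr real k" by (simp add: powr_powr mult.commute)
      also have "\<dots> = (2 powr - \<sigma>) ^ k" by (intro powr_realpow) auto
      finally show ?thesis .
    qed
    thus ?thesis unfolding Q_def c_def dpow_def by (simp only: of_real_power mult_ac)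
  qed
  define E where "E = exp (- B - 11 * (\<Sum>n. real n powr -2)) / 2"
  have Epos: "E > 0" by (simp add: E_def)
  define x where "x j = 1 + 1 / real (Suc j)" for j
  have x1: "x j > 1" for j by (simp add: x_def)
  have xlim: "x \<longlonglongrightarrow> 1"
    unfolding x_def using tendsto_add[OF tendsto_const[of 1] LIMSEQ_inverse_real_of_nat] by (simp add: inverse_eq_divide)
  have "norm (loc2 t) * E \<le> (1 + \<bar>t\<bar>) * e" if e: "e > 0" for e
  proof -
    have "eventually (\<lambda>N. norm ((\<Sum>n=1..N. f n) / of_nat N) < e) sequentially"
      using tendstoD[OF lim e] by simp
    then obtain n0 where n0: "\<And>N. N \<ge> n0 \<Longrightarrow> norm ((\<Sum>n=1..N. f n) / of_nat N) < e"
      by (auto simp: eventually_sequentially)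
    have S_le: "norm (S n) \<le> e * real n" if "n \<ge> n0" for n
    proof (cases "n = 0")
      case False
      thus ?thesis using n0[OF that] by (simp add: S_def norm_divide divide_less_eq)
    qed (auto simp: S_def)
    have le: "norm (Q (of_real (2 powr - x j))) * E \<le> (x j + \<bar>t\<bar>) * (real n0 * (x j - 1) + e * (x j - 1 + 1))" for j
    proof -
      have d: "x j - 1 > 0" using x1[of j] by simp
      have "1 / (x j - 1) * (norm (Q (of_real (2 powr - x j))) / 2) * (2 * E) \<le> norm (F (x j) t)"
        unfolding Qloc E_def using norm_F_lower[OF x1 B[unfolded Dsum_def]] by simp
      also have "\<dots> \<le> (x j + \<bar>t\<bar>) * (real n0 + e * (1 + 1 / (x j - 1)))"
        using e by (intro norm_F_le_of_mean x1 S_le) auto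
      finally have "1 / (x j - 1) * (norm (Q (of_real (2 powr - x j))) / 2) * (2 * E) \<le> (x j + \<bar>t\<bar>) * (real n0 + e * (1 + 1 / (x j - 1)))" .
      moreover have "1 / d * (q / 2) * (2 * E) = q * E / d" for d q by simp
      ultimately have "norm (Q (of_real (2 powr - x j))) * E / (x j - 1) \<le> (x j + \<bar>t\<bar>) * (real n0 + e * (1 + 1 / (x j - 1)))"
        by metis
      hence "norm (Q (of_real (2 powr - x j))) * E \<le> (x j + \<bar>t\<bar>) * (real n0 + e * (1 + 1 / (x j - 1))) * (x j - 1)"
        using d by (simp add: pos_divide_le_eq)
      also have "\<dots> = (x j + \<bar>t\<bar>) * (real n0 * (x j - 1) + e * ((1 + 1 / (x j - 1)) * (x j - 1)))"
        by (simp only: mult.assoc distrib_right)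
      also have "(1 + 1 / (x j - 1)) * (x j - 1) = x j - 1 + 1"
        using d by (simp add: distrib_right)
      finally show ?thesis .
    qed
    have "(\<lambda>j. norm (Q (of_real (2 powr - x j))) * E) \<longlonglongrightarrow> norm (Q (1/2)) * E"
    proof (intro tendsto_intros isCont_tendsto_compose[OF contQ])
      have "(\<lambda>j. complex_of_real (2 powr - x j)) \<longlonglongrightarrow> complex_of_real (2 powr - 1)"
        by (intro tendsto_intros xlim) auto
      thus "(\<lambda>j. complex_of_real (2 powr - x j)) \<longlonglongrightarrow> 1/2" by (simp add: powr_minus)
    qed
    moreover have "(\<lambda>j. (x j + \<bar>t\<bar>) * (real n0 * (x j - 1) + e * (x j - 1 + 1))) \<longlonglongrightarrow> (1 + \<bar>t\<bar>) * (real n0 * (1 - 1) + e * (1 - 1 + 1))"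
      by (intro tendsto_intros xlim)
    ultimately have "norm (Q (1/2)) * E \<le> (1 + \<bar>t\<bar>) * (real n0 * (1 - 1) + e * (1 - 1 + 1))"
      using le by (intro LIMSEQ_le) auto
    moreover have "Q (1/2) = loc2 t" unfolding Q_def c_def loc2_def by simp
    ultimately show ?thesis by simp
  qed
  hence le: "norm (loc2 t) * E \<le> (1 + \<bar>t\<bar>) * e" if "e > 0" for e using that by blast
  define v where "v = norm (loc2 t) * E"
  have v: "v > 0" using nz Epos by (simp add: v_def)
  \<comment> \<open>The bound holds for every e > 0; this choice turns the right-hand side into v /
    2.\<close>
  have "v \<le> (1 + \<bar>t\<bar>) * (v / (2 * (1 + \<bar>t\<bar>)))"
    unfolding v_def using v by (intro le) (auto simp: v_def zero_less_mult_iff)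
  also have "\<dots> = v / 2" by (simp add: field_simps)
  finally show False using v by simp
qed

text \<open>The equation writes -1 as an average of the normalised values with weights 2^(-k), k >=
  1, of total mass exactly 1. As -1 is an extreme point of the unit disc, every value equals
  -1.\<close>

lemma loc2_eq_0D:
  assumes "loc2 t = 0" "k > 0"
  shows "f (2 ^ k) * cis (- (t * ln (real (2 ^ k)))) = -1"
proof -
  define c where "c k = f (2 ^ k) * cis (- (t * ln (real (2 ^ k))))" for k
  have nc: "norm (c k) \<le> 1" for k using norm_f_le[of "2^k"] by (simp add: c_def norm_mult)
  have c0: "c 0 = 1" by (simp add: c_def)
  have sm: "summable (\<lambda>k. c k * (1/2) ^ k)"
    by (rule summable_comparison_test'[OF summable_geometric[of "1/2::real"], of 0])
       (use nc in \<open>auto simp: norm_mult norm_power norm_divide mult_left_le_one_le\<close>)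
  have "(\<lambda>k. c k * (1/2) ^ k) sums 0"
    using summable_sums[OF sm] assms(1) unfolding loc2_def c_def by simp
  moreover have "Re (c k * (1/2) ^ k) = Re (c k) * (1/2) ^ k" for k
  proof -
    have "(1/2 :: complex) ^ k = complex_of_real ((1/2) ^ k)" by simp
    thus ?thesis by (simp only: times_complex.sel Re_complex_of_real Im_complex_of_real mult_zero_right diff_zero)
  qed
  ultimately have s1: "(\<lambda>k. Re (c k) * (1/2) ^ k) sums 0"
    using sums_Re[of "\<lambda>k. c k * (1/2) ^ k" 0] by simp
  have "(\<lambda>k. (1/2::real) ^ k) sums 2" using geometric_sums[of "1/2::real"] by simp
  \<comment> \<open>Adding the geometric series makes all terms nonnegative, and the term k = 0
    alone already equals the total 2.\<close>
  from sums_add[OF s1 this] have s2: "(\<lambda>k. (1 + Re (c k)) * (1/2) ^ k) sums 2" by (simp add: algebra_simps)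
  hence s3: "(\<lambda>k. (1 + Re (c (Suc k))) * (1/2) ^ Suc k) sums 0"
    using sums_Suc_iff[of "\<lambda>k. (1 + Re (c k)) * (1/2) ^ k" 0] c0 by simp
  have nn: "0 \<le> (1 + Re (c (Suc k))) * (1/2) ^ Suc k" for k
    using abs_Re_le_cmod[of "c (Suc k)"] nc[of "Suc k"] by (intro mult_nonneg_nonneg) auto
  have "(1 + Re (c (Suc j))) * (1/2) ^ Suc j = 0" for j
    using suminf_eq_zero_iff[OF sums_summable[OF s3] nn] sums_unique[OF s3] by simp
  hence Re: "Re (c (Suc j)) = -1" for j by simp (metis add_eq_0_iff)
  obtain j where k: "k = Suc j" using assms(2) by (cases k) auto
  have "Im (c k) = 0"
  proof -
    have "(Re (c k))^2 + (Im (c k))^2 \<le> 1" using nc[of k] by (simp add: cmod_def)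
    thus ?thesis using Re[of j] by (simp add: k)
  qed
  hence "c k = -1" using Re[of j] by (simp add: complex_eq_iff k)
  thus ?thesis by (simp add: c_def)
qed

end

section \<open>Weyl's criterion\<close>

definition weyl :: "(nat \<Rightarrow> real) \<Rightarrow> bool" where
  "weyl x \<longleftrightarrow> (\<forall>l::int. l \<noteq> 0 \<longrightarrow> (\<lambda>N. (\<Sum>k=1..N. cis (2 * pi * (of_int l * x k))) / of_nat N) \<longlonglongrightarrow> 0)"

text \<open>Real trigonometric polynomials on the unit circle: multiplication by z^n clears negative
  exponents, so ordinary polynomials suffice. Being real-valued, they form an algebra for the real
  Stone-Weierstrass theorem.\<close>

definition laurent :: "(complex \<Rightarrow> real) \<Rightarrow> bool" where
  "laurent g \<longleftrightarrow> (\<exists>n p. \<forall>z. norm z = 1 \<longrightarrow> of_real (g z) * z ^ n = poly p z)"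

lemma laurent_const: "laurent (\<lambda>_. c)"
  unfolding laurent_def by (rule exI[of _ 0], rule exI[of _ "[:of_real c:]"]) simp

lemma laurent_add: assumes "laurent f" "laurent g" shows "laurent (\<lambda>z. f z + g z)"
proof -
  from assms obtain n p m q where p: "\<And>z. norm z = 1 \<Longrightarrow> of_real (f z) * z ^ n = poly p z"
    and q: "\<And>z. norm z = 1 \<Longrightarrow> of_real (g z) * z ^ m = poly q z" unfolding laurent_def by blast
  show ?thesis unfolding laurent_def
  proof (intro exI allI impI)
    fix z :: complex assume z: "norm z = 1"
    have "of_real (f z + g z) * z ^ (n + m) = (of_real (f z) * z ^ n) * z ^ m + (of_real (g z) * z ^ m) * z ^ n"
      by (simp add: algebra_simps power_add)
    thus "of_real (f z + g z) * z ^ (n + m) = poly (p * monom 1 m + q * monom 1 n) z"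
      unfolding p[OF z] q[OF z] by (simp add: poly_monom)
  qed
qed

lemma laurent_mult: assumes "laurent f" "laurent g" shows "laurent (\<lambda>z. f z * g z)"
proof -
  from assms obtain n p m q where p: "\<And>z. norm z = 1 \<Longrightarrow> of_real (f z) * z ^ n = poly p z"
    and q: "\<And>z. norm z = 1 \<Longrightarrow> of_real (g z) * z ^ m = poly q z" unfolding laurent_def by blast
  show ?thesis unfolding laurent_def
  proof (intro exI allI impI)
    fix z :: complex assume z: "norm z = 1"
    have "of_real (f z * g z) * z ^ (n + m) = (of_real (f z) * z ^ n) * (of_real (g z) * z ^ m)"
      by (simp add: algebra_simps power_add)
    thus "of_real (f z * g z) * z ^ (n + m) = poly (p * q) z"
      unfolding p[OF z] q[OF z] by simp
  qed
qed

lemma laurent_Re: "laurent Re"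
  unfolding laurent_def
proof (intro exI allI impI)
  fix z :: complex assume z: "norm z = 1"
  have "1 = z * cnj z" using complex_norm_square[of z] z by simp
  moreover have "of_real (Re z) = (z + cnj z) / 2" by (simp add: complex_eq_iff)
  ultimately have "of_real (Re z) * z ^ 1 = (1 + z ^ 2) / 2" by (simp add: algebra_simps power2_eq_square)
  thus "of_real (Re z) * z ^ 1 = poly [:1/2, 0, 1/2:] z" by (simp add: power2_eq_square add_divide_distrib)
qed

lemma laurent_Im: "laurent Im"
  unfolding laurent_def
proof (intro exI allI impI)
  fix z :: complex assume z: "norm z = 1"
  have "of_real (Im z) = \<i>/2 * (cnj z - z)" by (simp add: complex_eq_iff)
  moreover have "c * (w - z) * z ^ 1 = c * (z * w - z ^ 2)" for c w
    by (simp add: algebra_simps power2_eq_square)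
  ultimately have "of_real (Im z) * z ^ 1 = \<i>/2 * (z * cnj z - z ^ 2)" by (simp only:)
  also have "z * cnj z = 1" using complex_norm_square[of z] z by simp
  finally have "of_real (Im z) * z ^ 1 = \<i>/2 * (1 - z ^ 2)" .
  thus "of_real (Im z) * z ^ 1 = poly [:\<i>/2, 0, -\<i>/2:] z" by (simp add: power2_eq_square algebra_simps)
qed

lemma integral_cis:
  assumes "l \<noteq> (0::int)"
  shows "((\<lambda>t. cis (2 * pi * (of_int l * t))) has_integral 0) {0..1}"
proof -
  define a where "a = 2 * pi * of_int l"
  have a: "a \<noteq> 0" using assms by (simp add: a_def)
  have "((\<lambda>t. cis (a * t)) has_integral (cis (a * 1) / (\<i> * a) - cis (a * 0) / (\<i> * a))) {0..1}"
  proof (rule fundamental_theorem_of_calculus)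
    fix t :: real
    have "((\<lambda>t. exp (\<i> * of_real a * of_real t) / (\<i> * a)) has_vector_derivative exp (\<i> * of_real a * of_real t)) (at t within {0..1})"
      using a by (auto intro!: derivative_eq_intros has_vector_derivative_real_field)
    thus "((\<lambda>t. cis (a * t) / (\<i> * a)) has_vector_derivative cis (a * t)) (at t within {0..1})"
      by (simp add: cis_conv_exp mult_ac)
  qed auto
  moreover have "cis a = 1" unfolding a_def using cis_multiple_2pi[of "of_int l"] by simp
  ultimately show ?thesis by (simp add: a_def mult_ac)
qed

lemma weyl_laurent:
  assumes W: "weyl x" and g: "laurent g"
  shows "(\<lambda>N. (\<Sum>k=1..N. g (cis (2 * pi * x k))) / real N) \<longlonglongrightarrow> integral {0..1} (\<lambda>t. g (cis (2 * pi * t)))"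
    (is "?A \<longlonglongrightarrow> ?I")
proof -
  from g obtain n p where p: "\<And>z. norm z = 1 \<Longrightarrow> of_real (g z) * z ^ n = poly p z" unfolding laurent_def by blast
  have expand: "of_real (g (cis (2 * pi * t))) = (\<Sum>i\<le>degree p. coeff p i * cis (2 * pi * (of_int (int i - int n) * t)))" for t
  proof -
    define z where "z = cis (2 * pi * t)"
    have z: "norm z = 1" "z \<noteq> 0" by (auto simp: z_def)
    have zi: "z ^ i / z ^ n = cis (2 * pi * (of_int (int i - int n) * t))" for i
      unfolding z_def Complex.DeMoivre cis_divide by (rule arg_cong[where f=cis]) (simp add: algebra_simps)
    have "of_real (g z) = (of_real (g z) * z ^ n) / z ^ n" using z by simp
    also have "\<dots> = (\<Sum>i\<le>degree p. coeff p i * (z ^ i / z ^ n))"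
      unfolding p[OF z(1)] poly_altdef by (simp add: sum_divide_distrib)
    finally show ?thesis unfolding zi unfolding z_def .
  qed
  define c where "c = coeff p n"
  \<comment> \<open>Only exponent 0, that is i = n, survives averaging and integration. If n exceeds
    the degree, no index qualifies and the coefficient is 0 as well.\<close>
  define m where "m i = (if i = n then coeff p i else 0)" for i
  have csum: "(\<Sum>i\<le>degree p. m i) = c"
    by (cases "n \<le> degree p") (auto simp: m_def c_def sum.delta coeff_eq_0)
  have "((\<lambda>t. \<Sum>i\<le>degree p. coeff p i * cis (2 * pi * (of_int (int i - int n) * t))) has_integral (\<Sum>i\<le>degree p. m i)) {0..1}"
  proof (intro has_integral_sum finite_atMost)
    fix i
    show "((\<lambda>t. coeff p i * cis (2 * pi * (of_int (int i - int n) * t))) has_integral m i) {0..1}"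
    proof (cases "i = n")
      case True
      thus ?thesis using has_integral_const_real[of "coeff p i" 0 1] by (simp add: m_def)
    next
      case False
      hence "int i - int n \<noteq> 0" by simp
      from has_integral_mult_right[OF integral_cis[OF this], of "coeff p i"] False show ?thesis by (simp add: m_def)
    qed
  qed
  hence "((\<lambda>t. complex_of_real (g (cis (2 * pi * t)))) has_integral c) {0..1}" unfolding expand csum .
  from has_integral_linear[OF this bounded_linear_Re] have I: "?I = Re c"
    by (auto simp: o_def intro: integral_unique)
  have "(\<lambda>N. \<Sum>i\<le>degree p. coeff p i * ((\<Sum>k=1..N. cis (2 * pi * (of_int (int i - int n) * x k))) / of_nat N)) \<longlonglongrightarrow> (\<Sum>i\<le>degree p. m i)"
  proof (intro tendsto_sum)
    fix i
    show "(\<lambda>N. coeff p i * ((\<Sum>k=1..N. cis (2 * pi * (of_int (int i - int n) * x k))) / of_nat N)) \<longlonglongrightarrow> m i"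
    proof (cases "i = n")
      case True
      have "eventually (\<lambda>N. coeff p i * ((\<Sum>k=1..N. cis (2 * pi * (of_int (int i - int n) * x k))) / of_nat N) = m i) sequentially"
        using eventually_gt_at_top[of 0] by eventually_elim (use True in \<open>simp add: m_def\<close>)
      thus ?thesis by (rule tendsto_eventually)
    next
      case False
      hence "int i - int n \<noteq> 0" by simp
      hence "(\<lambda>N. (\<Sum>k=1..N. cis (2 * pi * (of_int (int i - int n) * x k))) / of_nat N) \<longlonglongrightarrow> 0"
        using W unfolding weyl_def by blast
      from tendsto_mult_left[OF this, of "coeff p i"] False show ?thesis by (simp add: m_def)
    qed
  qed
  hence lim: "(\<lambda>N. \<Sum>i\<le>degree p. coeff p i * ((\<Sum>k=1..N. cis (2 * pi * (of_int (int i - int n) * x k))) / of_nat N)) \<longlonglongrightarrow> c"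
    unfolding csum .
  have eqA: "(\<Sum>i\<le>degree p. coeff p i * ((\<Sum>k=1..N. cis (2 * pi * (of_int (int i - int n) * x k))) / of_nat N)) = of_real (?A N)" for N
  proof -
    have "complex_of_real (?A N) = (\<Sum>k=1..N. complex_of_real (g (cis (2 * pi * x k)))) / of_nat N" by simp
    also have "\<dots> = (\<Sum>k=1..N. \<Sum>i\<le>degree p. coeff p i * cis (2 * pi * (of_int (int i - int n) * x k))) / of_nat N"
      unfolding expand ..
    also have "(\<Sum>k=1..N. \<Sum>i\<le>degree p. coeff p i * cis (2 * pi * (of_int (int i - int n) * x k))) =
               (\<Sum>i\<le>degree p. \<Sum>k=1..N. coeff p i * cis (2 * pi * (of_int (int i - int n) * x k)))"
      by (rule sum.swap)
    finally show ?thesis by (simp only: sum_distrib_left sum_divide_distrib times_divide_eq_right)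
  qed
  show ?thesis using tendsto_Re[OF lim] unfolding eqA I by simp
qed

text \<open>Trigonometric polynomials are dense because \<open>Re\<close> and \<open>Im\<close>
  separate points; averages and integrals each move by at most e/4 under the approximation.\<close>

lemma weyl_continuous:
  assumes W: "weyl x" and g: "continuous_on (sphere 0 1) (g :: complex \<Rightarrow> real)"
  shows "(\<lambda>N. (\<Sum>k=1..N. g (cis (2 * pi * x k))) / real N) \<longlonglongrightarrow> integral {0..1} (\<lambda>t. g (cis (2 * pi * t)))"
    (is "?A g \<longlonglongrightarrow> ?I g")
proof (rule tendstoI)
  fix e :: real assume e: "e > 0"
  define P where "P = (\<lambda>g :: complex \<Rightarrow> real. continuous_on (sphere 0 1) g \<and> laurent g)"
  have "\<exists>q. P q \<and> (\<forall>z\<in>sphere 0 1. \<bar>g z - q z\<bar> < e / 4)"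
  proof (rule Stone_Weierstrass_HOL[of "sphere 0 1" P])
    show "P (\<lambda>x. c)" for c by (auto simp: P_def laurent_const)
    show "P f \<and> P g \<Longrightarrow> P (\<lambda>x. f x + g x)" for f g by (auto simp: P_def laurent_add intro: continuous_on_add)
    show "P f \<and> P g \<Longrightarrow> P (\<lambda>x. f x * g x)" for f g by (auto simp: P_def laurent_mult intro: continuous_on_mult)
    have "P Re" "P Im" by (auto simp: P_def laurent_Re laurent_Im intro!: continuous_intros)
    thus "\<exists>f. P f \<and> f z \<noteq> f w" if "z \<in> sphere 0 1 \<and> w \<in> sphere 0 1 \<and> z \<noteq> w" for z w
      using that by (metis complex_eq_iff)
  qed (use g e in \<open>auto simp: P_def\<close>)
  then obtain q where q: "continuous_on (sphere 0 1) q" "laurent q" "\<And>z. norm z = 1 \<Longrightarrow> \<bar>g z - q z\<bar> < e / 4"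
    unfolding P_def by auto
  have int: "(\<lambda>t. f (cis (2 * pi * t))) integrable_on {0..1}" if "continuous_on (sphere 0 1) (f :: complex \<Rightarrow> real)" for f
    by (intro integrable_continuous_real continuous_on_compose2[OF that] continuous_intros) auto
  have "\<bar>?I g - ?I q\<bar> \<le> e / 4"
  proof -
    have "?I g - ?I q = integral {0..1} (\<lambda>t. g (cis (2 * pi * t)) - q (cis (2 * pi * t)))"
      by (rule Henstock_Kurzweil_Integration.integral_diff[OF int[OF g] int[OF q(1)], symmetric])
    also have "norm \<dots> \<le> integral {0..1} (\<lambda>t::real. e / 4)"
      using q(3) by (intro integral_norm_bound_integral integrable_diff int g q) (auto simp: less_imp_le)
    finally show ?thesis by simp
  qed
  moreover have "\<bar>?A g N - ?A q N\<bar> \<le> e / 4" for N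
  proof -
    have "\<bar>\<Sum>k=1..N. g (cis (2 * pi * x k)) - q (cis (2 * pi * x k))\<bar> \<le> (\<Sum>k=1..N. e / 4)"
      using q(3) by (intro order.trans[OF sum_abs] sum_mono) (auto simp: less_imp_le)
    hence "\<bar>(\<Sum>k=1..N. g (cis (2 * pi * x k)) - q (cis (2 * pi * x k))) / real N\<bar> \<le> e / 4"
      using e by (cases "N = 0") (auto simp: abs_divide divide_le_eq mult_ac)
    thus ?thesis by (simp add: sum_subtractf diff_divide_distrib)
  qed
  moreover have "eventually (\<lambda>N. \<bar>?A q N - ?I q\<bar> < e / 4) sequentially"
    using tendstoD[OF weyl_laurent[OF W q(2)], of "e / 4"] e by (simp add: dist_real_def)
  ultimately show "eventually (\<lambda>N. dist (?A g N) (?I g) < e) sequentially"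
  proof (elim eventually_mono)
    fix N assume 1: "\<bar>?I g - ?I q\<bar> \<le> e / 4" and 2: "\<And>N. \<bar>?A g N - ?A q N\<bar> \<le> e / 4" and 3: "\<bar>?A q N - ?I q\<bar> < e / 4"
    show "dist (?A g N) (?I g) < e"
      unfolding dist_real_def using 1 2[of N] 3 e unfolding abs_less_iff abs_le_iff by linarith
  qed
qed

section \<open>From continuous test functions to counting in intervals and back\<close>

lemma cis_2pi_eq_iff:
  assumes "cis (2 * pi * s) = cis (2 * pi * t)"
  shows "s - t \<in> \<int>"
proof -
  have "cis (2 * pi * (s - t)) = 1"
    using assms by (simp add: right_diff_distrib flip: cis_divide)
  hence "cos (2 * pi * (s - t)) = 1" by (simp add: complex_eq_iff)
  then obtain n :: int where "2 * pi * (s - t) = of_int n * 2 * pi" using cos_one_2pi_int by auto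
  hence "s - t = of_int n" by simp
  thus ?thesis by simp
qed

text \<open>The functions \<open>G n\<close> decrease to the indicator of the image A of J on the
  circle, so by dominated convergence one of them is a continuous majorant with integral below I +
  e/2.\<close>

lemma weyl_upper:
  assumes W: "weyl x" and J: "closed J" "J \<subseteq> {0..1}" "J \<noteq> {}" and I: "(indicat_real J has_integral I) {0..1}" and e: "e > 0"
  shows "eventually (\<lambda>N. real (card {k\<in>{1..N}. frac (x k) \<in> J}) \<le> (I + e) * real N) sequentially"
proof -
  define A where "A = (\<lambda>t. cis (2 * pi * t)) ` J"
  have "compact J" using J by (meson bounded_closed_interval bounded_subset compact_eq_bounded_closed)
  hence "compact A" unfolding A_def by (intro compact_continuous_image continuous_intros)
  hence A: "closed A" "A \<noteq> {}" using J by (auto simp: compact_imp_closed A_def)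
  define G where "G n z = max 0 (1 - real n * infdist z A)" for n z
  have contG: "continuous_on S (G n)" for S n
    unfolding G_def by (intro continuous_intros)
  have G01: "0 \<le> G n z" "G n z \<le> 1" for n z by (auto simp: G_def infdist_nonneg)
  have GA: "G n z = 1" if "z \<in> A" for n z using that by (simp add: G_def)
  have "(\<lambda>n. integral {0..1} (\<lambda>t. G n (cis (2 * pi * t)))) \<longlonglongrightarrow> integral {0..1} (\<lambda>t. indicat_real A (cis (2 * pi * t)))"
  proof (rule dominated_convergence(2)[where h="\<lambda>_. 1"])
    fix n show "(\<lambda>t. G n (cis (2 * pi * t))) integrable_on {0..1}"
      by (intro integrable_continuous_real continuous_on_compose2[OF contG[of UNIV]] continuous_intros) auto
    fix t :: real show "norm (G n (cis (2 * pi * t))) \<le> 1" using G01[of n] by simp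
  next
    fix t :: real
    define z where "z = cis (2 * pi * t)"
    show "(\<lambda>n. G n (cis (2 * pi * t))) \<longlonglongrightarrow> indicat_real A (cis (2 * pi * t))"
    proof (cases "z \<in> A")
      case True thus ?thesis by (simp add: GA z_def)
    next
      case False
      have d: "infdist z A > 0" using A False by (metis in_closed_iff_infdist_zero infdist_nonneg less_eq_real_def)
      have "filterlim (\<lambda>n. real n * infdist z A) at_top sequentially"
        using d by (intro filterlim_at_top_mult_tendsto_pos[OF tendsto_const] filterlim_real_sequentially)
      hence "eventually (\<lambda>n. real n * infdist z A \<ge> 1) sequentially" by (auto simp: filterlim_at_top)
      hence "eventually (\<lambda>n. G n z = 0) sequentially" by eventually_elim (auto simp: G_def)
      thus ?thesis using False unfolding z_def by (simp add: tendsto_eventually)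
    qed
  qed auto
  moreover have "((\<lambda>t. indicat_real A (cis (2 * pi * t))) has_integral I) {0..1}"
  \<comment> \<open>The points 0 and 1 have the same image on the circle, so membership in A and in
    J may disagree there, but nowhere else in [0,1].\<close>
  proof (rule has_integral_spike_finite[OF _ _ I, of "{0,1}"])
    fix t :: real assume t: "t \<in> {0..1} - {0,1}"
    have "cis (2 * pi * t) \<in> A \<longleftrightarrow> t \<in> J"
    proof
      assume "cis (2 * pi * t) \<in> A"
      then obtain s where s: "s \<in> J" "cis (2 * pi * t) = cis (2 * pi * s)" by (auto simp: A_def)
      from cis_2pi_eq_iff[OF this(2)] obtain n :: int where n: "t - s = of_int n" by (auto elim: Ints_cases)
      have "s \<in> {0..1}" using s J by blast
      hence "\<bar>t - s\<bar> < 1" using t by (auto simp: abs_if)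
      hence "n = 0" unfolding n by linarith
      thus "t \<in> J" using n s by simp
    qed (auto simp: A_def)
    thus "indicat_real A (cis (2 * pi * t)) = indicat_real J t" by (simp add: indicator_def)
  qed auto
  ultimately have "(\<lambda>n. integral {0..1} (\<lambda>t. G n (cis (2 * pi * t)))) \<longlonglongrightarrow> I" by (simp add: integral_unique)
  hence "eventually (\<lambda>n. integral {0..1} (\<lambda>t. G n (cis (2 * pi * t))) < I + e / 2) sequentially"
    using e by (intro order_tendstoD) auto
  then obtain n where n: "integral {0..1} (\<lambda>t. G n (cis (2 * pi * t))) < I + e / 2" by (auto simp: eventually_sequentially)
  have "eventually (\<lambda>N. (\<Sum>k=1..N. G n (cis (2 * pi * x k))) / real N < integral {0..1} (\<lambda>t. G n (cis (2 * pi * t))) + e / 2) sequentially"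
    using e by (intro order_tendstoD[OF weyl_continuous[OF W contG]]) auto
  thus ?thesis using eventually_gt_at_top[of 0]
  proof eventually_elim
    case (elim N)
    have "real (card {k\<in>{1..N}. frac (x k) \<in> J}) = (\<Sum>k=1..N. if frac (x k) \<in> J then 1 else 0)"
      by (subst sum.inter_filter[symmetric]) auto
    also have "\<dots> \<le> (\<Sum>k=1..N. G n (cis (2 * pi * x k)))"
    proof (intro sum_mono)
      fix k
      have "cis (2 * pi * frac (x k)) = cis (2 * pi * x k)"
      proof -
        have "cis (2 * pi * frac (x k)) = cis (2 * pi * x k) / cis (2 * pi * of_int \<lfloor>x k\<rfloor>)"
          by (simp add: frac_def right_diff_distrib flip: cis_divide)
        thus ?thesis using cis_multiple_2pi[of "of_int \<lfloor>x k\<rfloor>"] by simp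
      qed
      hence "frac (x k) \<in> J \<Longrightarrow> cis (2 * pi * x k) \<in> A" by (metis A_def imageI)
      thus "(if frac (x k) \<in> J then 1 else 0) \<le> G n (cis (2 * pi * x k))" using GA G01 by auto
    qed
    also have "\<dots> \<le> (I + e) * real N"
    proof -
      have "(\<Sum>k=1..N. G n (cis (2 * pi * x k))) / real N < I + e" using elim(1) n by linarith
      thus ?thesis using elim(2) by (simp add: pos_divide_less_eq less_imp_le)
    qed
    finally show ?case .
  qed
qed

definition equidist :: "(nat \<Rightarrow> real) \<Rightarrow> real \<Rightarrow> real \<Rightarrow> bool" where
  "equidist x u v \<longleftrightarrow> (\<lambda>N. real (card {k\<in>{1..N}. frac (x k) \<in> {u..<v}}) / real N) \<longlonglongrightarrow> v - u"

text \<open>The lower bound is the upper bound for the closed complement {0..u} \<union> {v..1}; the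
  overlap at u and v has measure 0.\<close>

lemma weyl_imp_equidist:
  assumes W: "weyl x" and uv: "0 \<le> u" "u < v" "v \<le> 1"
  shows "equidist x u v"
  unfolding equidist_def
proof (rule tendstoI)
  fix e :: real assume e: "e > 0"
  define c where "c N = real (card {k\<in>{1..N}. frac (x k) \<in> {u..<v}})" for N
  have i1: "(indicat_real {u..v} has_integral (v - u)) {0..1}"
  proof -
    have "((\<lambda>_. 1::real) has_integral (v - u)) {u..v}"
      using has_integral_const_real[of "1::real" u v] uv by simp
    hence "((\<lambda>x. if x \<in> {u..v} then 1 else 0::real) has_integral (v - u)) {0..1}"
      using uv by (subst has_integral_restrict) auto
    moreover have "indicat_real {u..v} = (\<lambda>x. if x \<in> {u..v} then 1 else 0)" by (rule ext) simp
    ultimately show ?thesis by (simp only:)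
  qed
  have "((\<lambda>t. 1 - indicat_real {u..v} t) has_integral ((1 - 0) *\<^sub>R 1 - (v - u))) {0..1}"
    using has_integral_const_real[of "1::real" 0 1] by (intro has_integral_diff i1) simp
  hence "((\<lambda>t. 1 - indicat_real {u..v} t) has_integral (1 - (v - u))) {0..1}" by simp
  hence i2: "(indicat_real ({0..u} \<union> {v..1}) has_integral (1 - (v - u))) {0..1}"
    by (rule has_integral_spike_finite[of "{u,v}", rotated 2]) (auto simp: indicator_def)
  have "eventually (\<lambda>N. real (card {k\<in>{1..N}. frac (x k) \<in> {u..v}}) \<le> ((v - u) + e/2) * real N) sequentially"
    using uv e by (intro weyl_upper[OF W] i1) auto
  moreover have "eventually (\<lambda>N. real (card {k\<in>{1..N}. frac (x k) \<in> {0..u} \<union> {v..1}}) \<le> ((1 - (v - u)) + e/2) * real N) sequentially"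
    using uv e by (intro weyl_upper[OF W] i2) (auto intro: closed_Un)
  ultimately show "eventually (\<lambda>N. dist (real (card {k\<in>{1..N}. frac (x k) \<in> {u..<v}}) / real N) (v - u) < e) sequentially"
    using eventually_gt_at_top[of 0]
  proof eventually_elim
    case (elim N)
    have "c N \<le> real (card {k\<in>{1..N}. frac (x k) \<in> {u..v}})"
      unfolding c_def by (intro of_nat_mono card_mono) auto
    hence 1: "c N / real N \<le> (v - u) + e/2" using elim by (simp add: divide_le_eq)
    have "real N = real (card {1..N})" by simp
    also have "{1..N} = {k\<in>{1..N}. frac (x k) \<in> {u..<v}} \<union> {k\<in>{1..N}. frac (x k) \<notin> {u..<v}}" by auto
    also have "real (card \<dots>) \<le> c N + real (card {k\<in>{1..N}. frac (x k) \<notin> {u..<v}})"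
      unfolding c_def using card_Un_le[of "{k\<in>{1..N}. frac (x k) \<in> {u..<v}}" "{k\<in>{1..N}. frac (x k) \<notin> {u..<v}}"]
      by (simp only: of_nat_add[symmetric] of_nat_le_iff)
    also have "real (card {k\<in>{1..N}. frac (x k) \<notin> {u..<v}}) \<le> real (card {k\<in>{1..N}. frac (x k) \<in> {0..u} \<union> {v..1}})"
      by (intro of_nat_mono card_mono) (auto simp: frac_lt_1 less_imp_le)
    finally have "real N \<le> c N + ((1 - (v - u)) + e/2) * real N" using elim by linarith
    hence "(v - u - e/2) * real N \<le> c N" by (simp add: algebra_simps)
    hence 2: "v - u - e/2 \<le> c N / real N" using elim by (simp add: le_divide_eq)
    show ?case unfolding dist_real_def c_def[symmetric] abs_less_iff using 1 2 e by linarith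
  qed
qed

text \<open>With a = 2 pi l, moving each fractional part to the left end of its piece costs |a| e,
  the limiting Riemann sum is at most |a| e, and convergence takes another e. The indices m to n are
  meant for the integers with a given number of digits.\<close>

lemma equidist_partition_bound:
  fixes p :: "nat \<Rightarrow> real"
  assumes mn: "m \<le> n" and p0: "p m = 0" and pn: "p n = 1" and mono: "\<And>i. m \<le> i \<Longrightarrow> i < n \<Longrightarrow> p i \<le> p (Suc i)"
    and mesh: "\<And>i. m \<le> i \<Longrightarrow> i < n \<Longrightarrow> p (Suc i) - p i \<le> e" and e: "e > 0"
    and eq: "\<And>i. m \<le> i \<Longrightarrow> i < n \<Longrightarrow> equidist x (p i) (p (Suc i))" and l: "l \<noteq> (0::int)"
  shows "eventually (\<lambda>N. norm ((\<Sum>k=1..N. cis (2 * pi * (of_int l * x k))) / of_nat N) \<le> (4 * pi * \<bar>of_int l\<bar> + 1) * e) sequentially"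
proof -
  define a where "a = 2 * pi * of_int l"
  have a0: "a \<noteq> 0" using l by (simp add: a_def)
  define E where "E t = cis (a * t)" for t
  have E1: "E 1 = 1" unfolding E_def a_def using cis_multiple_2pi[of "of_int l"] by simp
  define I where "I i = {p i..<p (Suc i)}" for i
  define c where "c i N = real (card {k\<in>{1..N}. frac (x k) \<in> I i})" for i N
  have Efrac: "E (frac t) = E t" for t
  proof -
    have "E (frac t) = E t / cis (2 * pi * (of_int l * of_int \<lfloor>t\<rfloor>))"
      by (simp add: E_def a_def frac_def cis_divide algebra_simps)
    thus ?thesis using cis_multiple_2pi[of "of_int l * of_int \<lfloor>t\<rfloor>"] by simp
  qed
  have union: "(\<Union>i\<in>{m..<j}. I i) = {p m..<p j}" if "m \<le> j" "j \<le> n" for j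
    using that
  proof (induction j rule: dec_induct)
    case (step j)
    have "{m..<Suc j} = insert j {m..<j}" using step by auto
    hence "(\<Union>i\<in>{m..<Suc j}. I i) = {p m..<p j} \<union> I j" using step by auto
    moreover have "p m \<le> p j" using step(1) step.prems
    proof (induction j rule: dec_induct)
      case (step i) thus ?case using mono[of i] by force
    qed auto
    ultimately show ?case using mono[of j] step by (auto simp: I_def)
  qed auto
  have disj: "I i \<inter> I j = {}" if "i \<in> {m..<n}" "j \<in> {m..<n}" "i \<noteq> j" for i j
  proof -
    have mono': "p i \<le> p j" if "m \<le> i" "i \<le> j" "j \<le> n" for i j
      using that(2,1,3)
    proof (induction j rule: dec_induct)
      case (step j) thus ?case using mono[of j] by force
    qed auto
    show ?thesis using that mono'[of "Suc i" j] mono'[of "Suc j" i] by (cases "i < j") (auto simp: I_def)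
  qed
  have main: "norm ((\<Sum>k=1..N. E (x k)) - (\<Sum>i=m..<n. of_real (c i N) * E (p i))) \<le> \<bar>a\<bar> * e * real N" for N
  proof -
    have ex1: "(\<Sum>i=m..<n. if frac t \<in> I i then g i else 0) = g j" if "j \<in> {m..<n}" "frac t \<in> I j" for t j and g :: "nat \<Rightarrow> complex"
    proof -
      have "(\<Sum>i=m..<n. if frac t \<in> I i then g i else 0) = (\<Sum>i=m..<n. if i = j then g i else 0)"
        using that disj by (intro sum.cong refl) (auto; fastforce)
      thus ?thesis using that by simp
    qed
    have "(\<Sum>i=m..<n. of_real (c i N) * E (p i)) = (\<Sum>i=m..<n. \<Sum>k=1..N. if frac (x k) \<in> I i then E (p i) else 0)"
    proof (intro sum.cong refl)
      fix i
      have "(\<Sum>k=1..N. if frac (x k) \<in> I i then E (p i) else 0) = of_nat (card {k\<in>{1..N}. frac (x k) \<in> I i}) * E (p i)"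
        by (subst sum.inter_filter[symmetric]) auto
      thus "of_real (c i N) * E (p i) = (\<Sum>k=1..N. if frac (x k) \<in> I i then E (p i) else 0)" by (simp add: c_def)
    qed
    also have "\<dots> = (\<Sum>k=1..N. \<Sum>i=m..<n. if frac (x k) \<in> I i then E (p i) else 0)" by (rule sum.swap)
    finally have "(\<Sum>k=1..N. E (x k)) - (\<Sum>i=m..<n. of_real (c i N) * E (p i)) = 
        (\<Sum>k=1..N. E (x k) - (\<Sum>i=m..<n. if frac (x k) \<in> I i then E (p i) else 0))" by (simp add: sum_subtractf)
    also have "norm \<dots> \<le> (\<Sum>k=1..N. \<bar>a\<bar> * e)"
    proof (intro sum_norm_le)
      fix k
      have "frac (x k) \<in> (\<Union>i\<in>{m..<n}. I i)" unfolding union[OF mn order.refl] p0 pn by (simp add: frac_lt_1)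
      then obtain j where j: "j \<in> {m..<n}" "frac (x k) \<in> I j" by blast
      have "norm (E (frac (x k)) - E (p j)) \<le> \<bar>a * frac (x k) - a * p j\<bar>" unfolding E_def by (rule norm_cis_diff_le)
      also have "\<dots> = \<bar>a\<bar> * \<bar>frac (x k) - p j\<bar>" by (simp add: abs_mult flip: right_diff_distrib)
      also have "\<dots> \<le> \<bar>a\<bar> * e" using j mesh[of j] by (intro mult_left_mono) (auto simp: I_def)
      finally show "norm (E (x k) - (\<Sum>i=m..<n. if frac (x k) \<in> I i then E (p i) else 0)) \<le> \<bar>a\<bar> * e"
        unfolding Efrac ex1[OF j] .
    qed
    finally show ?thesis by (simp add: mult_ac)
  qed
  \<comment> \<open>A Riemann sum for the vanishing integral of E. Multiplied by i a, it is compared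
    with the telescoping sum of the increments of E, which is 0 because E 1 = E 0; each piece
    contributes a second-order Taylor error.\<close>
  define R where "R = (\<Sum>i=m..<n. of_real (p (Suc i) - p i) * E (p i))"
  have R: "norm R \<le> \<bar>a\<bar> * e"
  proof -
    define D where "D i = p (Suc i) - p i" for i
    have "(\<Sum>i=m..<n. E (p (Suc i)) - E (p i)) = E (p n) - E (p m)" by (rule sum_Suc_diff'[OF mn])
    also have "\<dots> = 0" using E1 by (simp add: p0 pn E_def)
    finally have "\<i> * of_real a * R = (\<Sum>i=m..<n. \<i> * of_real a * (of_real (D i) * E (p i)) - (E (p (Suc i)) - E (p i)))"
      by (simp add: R_def D_def sum_subtractf sum_distrib_left)
    also have "norm \<dots> \<le> (\<Sum>i=m..<n. \<bar>a\<bar>^2 * e * D i)"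
    proof (intro sum_norm_le)
      fix i assume i: "i \<in> {m..<n}"
      have D: "0 \<le> D i" "D i \<le> e" using mono[of i] mesh[of i] i by (auto simp: D_def)
      have "E (p (Suc i)) = E (p i) * iexp (a * D i)"
        unfolding E_def D_def cis_conv_exp[symmetric] cis_mult
        by (rule arg_cong[where f=cis]) (simp add: algebra_simps)
      hence "\<i> * of_real a * (of_real (D i) * E (p i)) - (E (p (Suc i)) - E (p i)) = - E (p i) * (iexp (a * D i) - (1 + \<i> * (a * D i)))"
        by (simp add: algebra_simps)
      also have "norm \<dots> = norm (iexp (a * D i) - (1 + \<i> * (a * D i)))" by (simp add: norm_mult E_def)
      also have "\<dots> \<le> \<bar>a * D i\<bar>^2 / 2" using iexp_approx1[of "a * D i" 1] by (simp add: fact_numeral numeral_2_eq_2)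
      also have "\<dots> \<le> \<bar>a * D i\<bar>^2" using zero_le_power2[of "a * D i"] by simp
      also have "\<dots> = \<bar>a\<bar>^2 * (D i * D i)" by (simp add: power_mult_distrib power2_eq_square)
      also have "\<dots> \<le> \<bar>a\<bar>^2 * (e * D i)" using D by (intro mult_left_mono mult_right_mono) auto
      finally show "norm (\<i> * of_real a * (of_real (D i) * E (p i)) - (E (p (Suc i)) - E (p i))) \<le> \<bar>a\<bar>^2 * e * D i" by (simp add: mult_ac)
    qed
    also have "\<dots> = \<bar>a\<bar>^2 * e * (\<Sum>i=m..<n. D i)" by (simp add: sum_distrib_left)
    also have "(\<Sum>i=m..<n. D i) = 1" unfolding D_def using sum_Suc_diff'[OF mn, of p] by (simp add: p0 pn)
    finally have "\<bar>a\<bar> * norm R \<le> \<bar>a\<bar> * (\<bar>a\<bar> * e)" by (simp add: norm_mult power2_eq_square)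
    thus ?thesis using a0 by simp
  qed
  have "(\<lambda>N. \<Sum>i=m..<n. of_real (c i N / real N) * E (p i)) \<longlonglongrightarrow> R"
    unfolding R_def c_def I_def
    by (intro tendsto_intros) (use eq in \<open>auto simp: equidist_def\<close>)
  hence "eventually (\<lambda>N. norm ((\<Sum>i=m..<n. of_real (c i N / real N) * E (p i)) - R) < e) sequentially"
    using e by (auto dest!: tendstoD simp: dist_norm)
  thus ?thesis using eventually_gt_at_top[of 0]
  proof eventually_elim
    case (elim N)
    define X where "X = (\<Sum>k=1..N. E (x k)) / of_nat N"
    define Y where "Y = (\<Sum>i=m..<n. of_real (c i N / real N) * E (p i))"
    have "Y = (\<Sum>i=m..<n. of_real (c i N) * E (p i)) / of_nat N" unfolding Y_def by (simp add: sum_divide_distrib)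
    hence "X - Y = ((\<Sum>k=1..N. E (x k)) - (\<Sum>i=m..<n. of_real (c i N) * E (p i))) / of_nat N"
      by (simp add: X_def diff_divide_distrib)
    hence "norm (X - Y) \<le> \<bar>a\<bar> * e" using main[of N] elim by (simp add: norm_divide divide_le_eq)
    hence "norm X \<le> \<bar>a\<bar> * e + e + \<bar>a\<bar> * e"
      using elim(1) R norm_triangle_sub[of X Y] norm_triangle_sub[of Y R] unfolding Y_def[symmetric] by linarith
    also have "\<dots> = (4 * pi * \<bar>of_int l\<bar> + 1) * e" by (simp add: a_def abs_mult algebra_simps)
    finally show ?case by (simp add: X_def E_def a_def mult_ac)
  qed
qed

section \<open>Decimal digits\<close>

definition digit_sum :: "(nat \<Rightarrow> nat) \<Rightarrow> nat \<Rightarrow> real" where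
  "digit_sum s n = (\<Sum>j<n. real (s j) / 10 ^ j)"

lemma digit_sum_Suc: "digit_sum s (Suc n) = digit_sum s n + real (s n) / 10 ^ n"
  by (simp add: digit_sum_def)

lemma digit_sum_mono: "m \<le> n \<Longrightarrow> digit_sum s m \<le> digit_sum s n"
  unfolding digit_sum_def by (intro sum_mono2) auto

text \<open>Nines throughout would give equality; retaining the exact term 10 / 10^n is what lets
  the induction close.\<close>

lemma digit_sum_le:
  assumes "\<And>j. s j \<le> 9" "m \<le> n"
  shows "digit_sum s n \<le> digit_sum s m + 10 / 10 ^ m - 10 / 10 ^ n"
  using assms(2)
proof (induction n rule: dec_induct)
  case (step n)
  have "real (s n) / 10 ^ n \<le> 9 / 10 ^ n" using assms(1)[of n] by (intro divide_right_mono) auto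
  hence "digit_sum s (Suc n) \<le> digit_sum s m + 10 / 10 ^ m - 10 / 10 ^ n + 9 / 10 ^ n"
    using step.IH by (simp add: digit_sum_Suc)
  also have "\<dots> = digit_sum s m + 10 / 10 ^ m - 10 / 10 ^ Suc n" by (simp add: field_simps)
  finally show ?case .
qed simp

lemma digits_summable:
  assumes "\<And>j. d j \<le> (9::nat)"
  shows "summable (\<lambda>j. real (d j) / 10 ^ j)"
proof (rule summable_comparison_test'[where N=0])
  show "summable (\<lambda>j. 9 * (1/10::real) ^ j)" by (intro summable_mult summable_geometric) auto
  show "norm (real (d j) / 10 ^ j) \<le> 9 * (1/10) ^ j" for j
    using assms[of j] by (simp add: power_divide divide_right_mono)
qed

lemma digit_sum_tendsto:
  assumes "\<And>j. d j \<le> (9::nat)"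
  shows "digit_sum d \<longlonglongrightarrow> (\<Sum>j. real (d j) / 10 ^ j)"
  using summable_sums[OF digits_summable[OF assms]] unfolding sums_def digit_sum_def[abs_def] .

lemma digit_sum_integral:
  assumes "\<And>j. s j \<le> 9"
  shows "\<exists>v::nat. real v = 10 ^ j * digit_sum s (Suc j) \<and> v mod 10 = s j"
proof (induction j)
  case 0
  show ?case using assms[of 0] by (intro exI[of _ "s 0"]) (auto simp: digit_sum_def)
next
  case (Suc j)
  then obtain v where v: "real v = 10 ^ j * digit_sum s (Suc j)" by auto
  have "real (10 * v + s (Suc j)) = 10 ^ Suc j * digit_sum s (Suc (Suc j))"
    by (subst digit_sum_Suc) (simp add: v distrib_left)
  moreover have "(10 * v + s (Suc j)) mod 10 = s (Suc j)" using assms[of "Suc j"] by simp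
  ultimately show ?case by blast
qed

text \<open>Greedy digits: every truncation is an exact floor, which yields both convergence to y
  and the exclusion of trailing nines.\<close>

lemma floor_digit_expansion:
  assumes y: "1 \<le> y" "y < 10"
  defines "d \<equiv> \<lambda>j. nat (\<lfloor>10 ^ j * y\<rfloor> mod 10)"
  shows "d j \<le> 9" "d 0 \<ge> 1" "digit_sum d (Suc n) = of_int \<lfloor>10 ^ n * y\<rfloor> / 10 ^ n"
    "(\<Sum>j. real (d j) / 10 ^ j) = y" "\<not> (\<exists>J. \<forall>j\<ge>J. d j = 9)"
proof -
  show d9: "d j \<le> 9" for j
  proof -
    have "\<lfloor>10 ^ j * y\<rfloor> mod 10 < 10" by simp
    thus ?thesis unfolding d_def by linarith
  qed
  have "\<lfloor>y\<rfloor> \<ge> 1" "\<lfloor>y\<rfloor> < 10" using y by linarith+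
  moreover have "d 0 = nat (\<lfloor>y\<rfloor> mod 10)" by (simp add: d_def)
  ultimately have "d 0 = nat \<lfloor>y\<rfloor>" by (simp only: mod_pos_pos_trivial)
  hence d0: "real (d 0) = of_int \<lfloor>y\<rfloor>" and "d 0 \<ge> 1" using \<open>\<lfloor>y\<rfloor> \<ge> 1\<close> by linarith+
  thus "d 0 \<ge> 1" by simp
  show part: "digit_sum d (Suc n) = of_int \<lfloor>10 ^ n * y\<rfloor> / 10 ^ n" for n
  proof (induction n)
    case 0
    thus ?case using d0 by (simp add: digit_sum_def)
  next
    case (Suc n)
    have "\<lfloor>(10 ^ Suc n * y) / of_int 10\<rfloor> = \<lfloor>10 ^ Suc n * y\<rfloor> div 10"
      by (rule floor_divide_real_eq_div) simp
    hence "\<lfloor>10 ^ Suc n * y\<rfloor> div 10 = \<lfloor>10 ^ n * y\<rfloor>" by simp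
    moreover have "\<lfloor>10 ^ Suc n * y\<rfloor> = 10 * (\<lfloor>10 ^ Suc n * y\<rfloor> div 10) + \<lfloor>10 ^ Suc n * y\<rfloor> mod 10" by simp
    ultimately have "\<lfloor>10 ^ Suc n * y\<rfloor> = 10 * \<lfloor>10 ^ n * y\<rfloor> + int (d (Suc n))"
      unfolding d_def by simp
    hence "real_of_int \<lfloor>10 ^ Suc n * y\<rfloor> = 10 * of_int \<lfloor>10 ^ n * y\<rfloor> + real (d (Suc n))" by simp
    thus ?case by (subst digit_sum_Suc, subst Suc.IH) (simp add: field_simps)
  qed
  have lim: "(\<lambda>n. digit_sum d (Suc n)) \<longlonglongrightarrow> y"
  proof (rule LIM_zero_cancel, rule Lim_null_comparison)
    show "(\<lambda>n. (1/10::real) ^ n) \<longlonglongrightarrow> 0" by (rule LIMSEQ_realpow_zero) auto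
    show "eventually (\<lambda>n. norm (digit_sum d (Suc n) - y) \<le> (1/10) ^ n) sequentially"
    proof (intro always_eventually allI)
      fix n
      have "digit_sum d (Suc n) - y = (of_int \<lfloor>10 ^ n * y\<rfloor> - 10 ^ n * y) / 10 ^ n"
        unfolding part by (simp add: diff_divide_distrib)
      moreover have "\<bar>of_int \<lfloor>10 ^ n * y\<rfloor> - 10 ^ n * y\<bar> \<le> 1" by linarith
      ultimately show "norm (digit_sum d (Suc n) - y) \<le> (1/10) ^ n"
        by (simp add: abs_divide power_divide divide_right_mono)
    qed
  qed
  show "(\<Sum>j. real (d j) / 10 ^ j) = y"
    using LIMSEQ_unique[OF LIMSEQ_Suc[OF digit_sum_tendsto[OF d9]] lim] .
  show "\<not> (\<exists>J. \<forall>j\<ge>J. d j = 9)"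
  proof
    assume "\<exists>J. \<forall>j\<ge>J. d j = 9"
    then obtain J where J: "\<And>j. j \<ge> J \<Longrightarrow> d j = 9" by blast
    define x where "x = 10 ^ J * y"
    \<comment> \<open>With nines from J on the tail telescopes, so the series sums to (floor (10^J
      y) + 1) / 10^J. As it also sums to y, the number 10^J y would exceed its own floor by
      1.\<close>
    have "digit_sum d n = digit_sum d (Suc J) + 10 / 10 ^ Suc J - 10 / 10 ^ n" if "n \<ge> Suc J" for n
      using that
    proof (induction n rule: dec_induct)
      case (step n)
      have "digit_sum d (Suc n) = digit_sum d n + 9 / 10 ^ n" using J[of n] step by (simp add: digit_sum_Suc[of d n])
      moreover have "9 / 10 ^ n = 10 / 10 ^ n - 10 / (10 ^ Suc n :: real)" by simp
      ultimately show ?case using step.IH by linarith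
    qed simp
    note closed = this
    have "digit_sum d (Suc n) = digit_sum d (Suc J) + 10 / 10 ^ Suc J - (1/10) ^ n" if "n \<ge> J" for n
    proof -
      have "10 / 10 ^ Suc n = (1/10 :: real) ^ n" by (simp add: power_divide)
      thus ?thesis using closed[of "Suc n"] that by simp
    qed
    hence "eventually (\<lambda>n. digit_sum d (Suc n) = digit_sum d (Suc J) + 10 / 10 ^ Suc J - (1/10) ^ n) sequentially"
      by (rule eventually_mono[OF eventually_ge_at_top[of J]])
    moreover have "(\<lambda>n. digit_sum d (Suc J) + 10 / 10 ^ Suc J - (1/10) ^ n) \<longlonglongrightarrow> digit_sum d (Suc J) + 10 / 10 ^ Suc J - 0"
      by (intro tendsto_intros LIMSEQ_realpow_zero) auto
    ultimately have "(\<lambda>n. digit_sum d (Suc n)) \<longlonglongrightarrow> digit_sum d (Suc J) + 10 / 10 ^ Suc J"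
      by (simp add: tendsto_cong)
    from LIMSEQ_unique[OF lim this] have "y = (of_int \<lfloor>x\<rfloor> + 1) / 10 ^ J"
      unfolding part x_def by (simp add: add_divide_distrib)
    moreover have "10 ^ J * y = A" if "y = A / 10 ^ J" for A using that by simp
    ultimately have "x = of_int \<lfloor>x\<rfloor> + 1" unfolding x_def by blast
    thus False using real_of_int_floor_add_one_gt[of x] by (metis less_irrefl)
  qed
qed

lemma digit_string_bounds:
  assumes S: "S \<noteq> []" "set S \<subseteq> {0..9}" "hd S \<noteq> 0"
  defines "s \<equiv> \<lambda>j. if j < length S then S ! j else 0"
  shows "\<And>j. s j \<le> 9" "digit_string_value S = digit_sum s (length S)" "1 \<le> digit_string_value S"
    "digit_string_value S + 10 / 10 ^ length S \<le> 10"
proof -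
  show s9: "s j \<le> 9" for j
  proof (cases "j < length S")
    case True
    hence "S ! j \<in> {0..9}" using S(2) nth_mem by blast
    thus ?thesis using True by (simp add: s_def)
  qed (simp add: s_def)
  show eq: "digit_string_value S = digit_sum s (length S)"
    unfolding digit_string_value_def digit_sum_def by (intro sum.cong) (auto simp: s_def)
  have "s 0 \<ge> 1" using S by (cases S) (auto simp: s_def)
  moreover have "digit_sum s 1 \<le> digit_sum s (length S)" using S(1) by (intro digit_sum_mono) (cases S, auto)
  ultimately show "1 \<le> digit_string_value S" unfolding eq by (simp add: digit_sum_def)
  show "digit_string_value S + 10 / 10 ^ length S \<le> 10"
    unfolding eq using digit_sum_le[of s 0 "length S", OF s9] by (simp add: digit_sum_def)
qed

lemma powi_length: "(10::real) powi (1 - int K) = 10 / 10 ^ K"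
proof -
  have "(10::real) powi (1 - int K) = 10 powi 1 / 10 powi int K" by (rule power_int_diff) simp
  thus ?thesis by simp
qed

lemma first_digits_iff:
  assumes S: "S \<noteq> []" "set S \<subseteq> {0..9}" "hd S \<noteq> 0" and a: "a > 0"
  defines "r \<equiv> digit_string_value S" and "w \<equiv> digit_string_value S + 10 powi (1 - int (length S))"
  shows "first_digits a S \<longleftrightarrow> (\<exists>M::int. 10 powi M * r \<le> a \<and> a < 10 powi M * w)"
proof
  define K where "K = length S"
  define s where "s j = (if j < length S then S ! j else 0)" for j
  note sb = digit_string_bounds[OF S, folded s_def]
  have w: "w = r + 10 / 10 ^ K" unfolding w_def r_def powi_length K_def ..
  assume "first_digits a S"
  then obtain M d where a': "a = 10 powi M * (\<Sum>j. real (d j) / 10 ^ j)" and d: "\<And>j. d j \<le> 9" "\<not> (\<exists>J. \<forall>j\<ge>J. d j = 9)"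
    and dS: "\<And>j. j < K \<Longrightarrow> d j = S ! j" unfolding first_digits_def decimal_expansion_def K_def by blast
  have r: "r = digit_sum d K" unfolding r_def digit_string_value_def digit_sum_def K_def by (intro sum.cong) (auto simp: dS K_def)
  define y where "y = (\<Sum>j. real (d j) / 10 ^ j)"
  have lim: "digit_sum d \<longlonglongrightarrow> y" unfolding y_def by (rule digit_sum_tendsto[OF d(1)])
  have 1: "r \<le> y" unfolding r by (rule LIMSEQ_le_const[OF lim]) (auto intro: digit_sum_mono)
  \<comment> \<open>A digit other than 9 at a position J >= K keeps y at least 10^(-J) below w. Here
    the convention on trailing nines yields the strict inequality.\<close>
  from d(2) obtain J where J: "J \<ge> K" "d J \<noteq> 9" by blast
  hence dJ: "d J \<le> 8" using d(1)[of J] by simp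
  have "y \<le> r + 10 / 10 ^ K - 1 / 10 ^ J"
  proof (rule LIMSEQ_le_const2[OF lim], intro exI allI impI)
    fix n assume n: "n \<ge> Suc J"
    have "digit_sum d n \<le> digit_sum d (Suc J) + 10 / 10 ^ Suc J" using digit_sum_le[of d, OF d(1) n] by (rule order.trans) simp
    also have "\<dots> \<le> digit_sum d J + 8 / 10 ^ J + 1 / 10 ^ J"
      using dJ divide_right_mono[of "real (d J)" 8 "10 ^ J"] by (simp add: digit_sum_Suc)
    also have "digit_sum d J \<le> r + 10 / 10 ^ K - 10 / 10 ^ J" unfolding r by (rule digit_sum_le[of d, OF d(1) J(1)])
    finally show "digit_sum d n \<le> r + 10 / 10 ^ K - 1 / 10 ^ J" by (simp add: field_simps)
  qed
  moreover have "1 / 10 ^ J > (0::real)" by simp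
  ultimately have 2: "y < w" unfolding w by linarith
  have "10 powi M > (0::real)" by simp
  thus "\<exists>M::int. 10 powi M * r \<le> a \<and> a < 10 powi M * w"
    using 1 2 unfolding a' y_def[symmetric] by (intro exI[of _ M]) (auto intro: mult_left_mono)
next
  define K where "K = length S"
  have K: "K \<ge> 1" using S(1) by (cases S) (auto simp: K_def)
  define s where "s j = (if j < length S then S ! j else 0)" for j
  note sb = digit_string_bounds[OF S, folded s_def]
  have w: "w = r + 10 / 10 ^ K" unfolding w_def r_def powi_length K_def ..
  assume "\<exists>M::int. 10 powi M * r \<le> a \<and> a < 10 powi M * w"
  then obtain M :: int where M: "10 powi M * r \<le> a" "a < 10 powi M * w" by blast
  define y where "y = a / 10 powi M"
  have pM: "10 powi M > (0::real)" by simp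
  have y: "r \<le> y" "y < w" "a = 10 powi M * y"
    using M pM by (auto simp: y_def field_simps)
  have r: "r = digit_sum s K" unfolding r_def K_def by (rule sb(2))
  have y10: "1 \<le> y" "y < 10" using y sb(3,4) w unfolding r_def K_def by linarith+
  define d where "d j = nat (\<lfloor>10 ^ j * y\<rfloor> mod 10)" for j
  note fe = floor_digit_expansion[OF y10, folded d_def]
  have "decimal_expansion a M d"
    unfolding decimal_expansion_def fe(4) using fe(1,2,5) y(3) by blast
  moreover have "d j = S ! j" if j: "j < length S" for j
  proof -
    \<comment> \<open>The first j + 1 digits of S form the integer v with last digit
      \<open>s j\<close>, and 10^j y lies in [v, v + 1).\<close>
    obtain v where v: "real v = 10 ^ j * digit_sum s (Suc j)" "v mod 10 = s j" using digit_sum_integral[of s j] sb(1) by blast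
    have jK: "Suc j \<le> K" using j by (simp add: K_def)
    have "digit_sum s (Suc j) \<le> y" using digit_sum_mono[OF jK, of s] y(1) r by linarith
    hence "10 ^ j * digit_sum s (Suc j) \<le> 10 ^ j * y" by (intro mult_left_mono) auto
    hence 1: "real v \<le> 10 ^ j * y" using v(1) by simp
    have "y < digit_sum s (Suc j) + 10 / 10 ^ Suc j"
      using digit_sum_le[of s, OF sb(1) jK] y(2) unfolding w r by linarith
    hence "10 ^ j * y < 10 ^ j * (digit_sum s (Suc j) + 10 / 10 ^ Suc j)" by (intro mult_strict_left_mono) auto
    also have "\<dots> = real v + 1" by (simp add: v(1) distrib_left)
    finally have "\<lfloor>10 ^ j * y\<rfloor> = int v" using 1 by (intro floor_unique) auto
    hence "d j = nat (int v mod 10)" by (simp only: d_def)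
    moreover have "int v mod 10 = int (v mod 10)" by (simp only: zmod_int of_nat_numeral)
    ultimately have "d j = v mod 10" by (simp only: nat_int)
    thus ?thesis using v(2) j by (simp add: s_def)
  qed
  ultimately show "first_digits a S" unfolding first_digits_def by blast
qed

text \<open>Induction by splitting off the last decimal digit of m; the lower bound on m keeps the
  leading digit nonzero.\<close>

lemma exists_digit_string:
  assumes "10 ^ n \<le> m" "m < 10 ^ Suc n"
  shows "\<exists>S. S \<noteq> [] \<and> set S \<subseteq> {0..9} \<and> hd S \<noteq> (0::nat) \<and> length S = Suc n \<and> digit_string_value S = real m / 10 ^ n"
  using assms
proof (induction n arbitrary: m)
  case 0
  thus ?case by (intro exI[of _ "[m]"]) (auto simp: digit_string_value_def)
next
  case (Suc n)
  have "10 ^ n \<le> m div 10" "m div 10 < 10 ^ Suc n" using Suc.prems by auto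
  from Suc.IH[OF this] obtain S where S: "S \<noteq> []" "set S \<subseteq> {0..9}" "hd S \<noteq> (0::nat)" "length S = Suc n"
    "digit_string_value S = real (m div 10) / 10 ^ n" by blast
  define T where "T = S @ [m mod 10]"
  have "digit_string_value T = digit_string_value S + real (m mod 10) / 10 ^ Suc n"
  proof -
    have "(\<Sum>j<Suc n. real (T ! j) / 10 ^ j) = (\<Sum>j<Suc n. real (S ! j) / 10 ^ j)"
      by (intro sum.cong) (auto simp: T_def nth_append S(4))
    thus ?thesis by (simp add: digit_string_value_def T_def S(4) nth_append)
  qed
  also have "\<dots> = (10 * real (m div 10) + real (m mod 10)) / 10 ^ Suc n"
    unfolding S(5) by (simp add: add_divide_distrib)
  also have "10 * real (m div 10) + real (m mod 10) = real m"
    by (metis mult_div_mod_eq of_nat_add of_nat_mult of_nat_numeral)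
  finally have "digit_string_value T = real m / 10 ^ Suc n" .
  moreover have "m mod 10 \<le> 9" using mod_less_divisor[of 10 m] by linarith
  ultimately show ?case using S by (intro exI[of _ T]) (auto simp: T_def)
qed

text \<open>Since log r >= 0 and log w <= 1, the exponent M can only be the floor of log a, so the
  conditions at all scales merge into one on the fractional part.\<close>

lemma frac_log_iff:
  assumes a: "a > 0" and rw: "1 \<le> r" "r < w" "w \<le> 10"
  shows "(\<exists>M::int. 10 powi M * r \<le> a \<and> a < 10 powi M * w) \<longleftrightarrow> frac (log 10 a) \<in> {log 10 r..<log 10 w}"
proof -
  define x where "x = log 10 a"
  have lw: "log 10 w \<le> 1" using rw log_le_cancel_iff[of 10 w 10] by simp
  have lr: "0 \<le> log 10 r" using rw by simp
  have lm: "log 10 (10 powi M * c) = of_int M + log 10 c" if "c > 0" for M :: int and c :: real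
  proof -
    have "10 powi M = (10::real) powr of_int M" by (simp add: powr_real_of_int')
    thus ?thesis using that by (simp add: log_mult)
  qed
  have 1: "10 powi M * r \<le> a \<longleftrightarrow> of_int M + log 10 r \<le> x" for M :: int
    using lm[of r M] rw a unfolding x_def by (subst log_le_cancel_iff[of 10, symmetric]) auto
  have 2: "a < 10 powi M * w \<longleftrightarrow> x < of_int M + log 10 w" for M :: int
    using lm[of w M] rw a unfolding x_def by (subst log_less_cancel_iff[of 10, symmetric]) auto
  show ?thesis unfolding 1 2 x_def[symmetric]
  proof
    assume "\<exists>M. of_int M + log 10 r \<le> x \<and> x < of_int M + log 10 w"
    then obtain M :: int where M: "of_int M + log 10 r \<le> x" "x < of_int M + log 10 w" by blast
    hence "\<lfloor>x\<rfloor> = M" using lw lr by (intro floor_unique) auto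
    thus "frac x \<in> {log 10 r..<log 10 w}" using M by (auto simp: frac_def)
  next
    assume "frac x \<in> {log 10 r..<log 10 w}"
    thus "\<exists>M. of_int M + log 10 r \<le> x \<and> x < of_int M + log 10 w"
      by (intro exI[of _ "\<lfloor>x\<rfloor>"]) (auto simp: frac_def)
  qed
qed

section \<open>The Benford property as equidistribution of logarithms modulo 1\<close>

lemma strong_benford_pos_iff_equidist:
  assumes b: "\<And>k. b k > 0"
  shows "strong_benford_pos b \<longleftrightarrow> (\<forall>S. S \<noteq> [] \<and> set S \<subseteq> {0..9} \<and> hd S \<noteq> 0 \<longrightarrow>
     equidist (\<lambda>k. log 10 (b k)) (log 10 (digit_string_value S))
       (log 10 (digit_string_value S + 10 powi (1 - int (length S)))))"
proof -
  have eq: "{k \<in> {1..N}. first_digits (b k) S} = {k\<in>{1..N}. frac (log 10 (b k)) \<in> {log 10 (digit_string_value S)..<log 10 (digit_string_value S + 10 powi (1 - int (length S)))}}"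
    if S: "S \<noteq> []" "set S \<subseteq> {0..9}" "hd S \<noteq> 0" for S N
  proof -
    have "first_digits (b k) S \<longleftrightarrow> frac (log 10 (b k)) \<in> {log 10 (digit_string_value S)..<log 10 (digit_string_value S + 10 powi (1 - int (length S)))}" for k
      unfolding first_digits_iff[OF S b]
      using digit_string_bounds(3,4)[OF S] by (intro frac_log_iff b) (auto simp: powi_length)
    thus ?thesis by auto
  qed
  show ?thesis
    unfolding strong_benford_pos_def equidist_def using eq by (intro iff_allI imp_cong refl) auto
qed

text \<open>The Benford property speaks only about intervals attached to digit strings. Those of one
  length tile [0,1), with mesh tending to 0 as the length grows, so they already control the
  exponential sums.\<close>

theorem strong_benford_pos_iff_weyl:
  assumes b: "\<And>k. b k > 0"
  shows "strong_benford_pos b \<longleftrightarrow> weyl (\<lambda>k. log 10 (b k))"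
proof
  assume W: "weyl (\<lambda>k. log 10 (b k))"
  show "strong_benford_pos b"
    unfolding strong_benford_pos_iff_equidist[OF b]
  proof (intro allI impI)
    fix S :: "nat list" assume "S \<noteq> [] \<and> set S \<subseteq> {0..9} \<and> hd S \<noteq> 0"
    hence S: "S \<noteq> []" "set S \<subseteq> {0..9}" "hd S \<noteq> 0" by auto
    define r where "r = digit_string_value S"
    define w where "w = r + 10 powi (1 - int (length S))"
    have rw: "1 \<le> r" "r < w" "w \<le> 10" using digit_string_bounds(3,4)[OF S] by (auto simp: r_def w_def powi_length)
    have "log 10 w \<le> log 10 10" using rw by (subst log_le_cancel_iff) auto
    thus "equidist (\<lambda>k. log 10 (b k)) (log 10 (digit_string_value S)) (log 10 (digit_string_value S + 10 powi (1 - int (length S))))"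
      unfolding r_def[symmetric] w_def[symmetric] using rw by (intro weyl_imp_equidist[OF W]) auto
  qed
next
  assume B: "strong_benford_pos b"
  show "weyl (\<lambda>k. log 10 (b k))" unfolding weyl_def
  proof (intro allI impI tendstoI)
    fix l :: int and e :: real assume l: "l \<noteq> 0" and e: "e > 0"
    define C where "C = 4 * pi * \<bar>real_of_int l\<bar> + 1"
    have C: "C > 0" by (simp add: C_def add_nonneg_pos)
    obtain K where K: "(1/10::real) ^ K < e / C" using real_arch_pow_inv[of "e / C" "1/10"] e C by auto
    \<comment> \<open>Strings of length K + 1 correspond to the integers i with 10^K <= i < 10^(K+1)
      via r = i / 10^K; the interval of such a string is [p i, p (i + 1)).\<close>
    define p where "p i = log 10 (real i) - real K" for i :: nat
    have "eventually (\<lambda>N. norm ((\<Sum>k=1..N. cis (2 * pi * (of_int l * log 10 (b k)))) / of_nat N) \<le> (4 * pi * \<bar>of_int l\<bar> + 1) * (1/10) ^ K) sequentially"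
    proof (rule equidist_partition_bound[where m="10 ^ K" and n="10 ^ Suc K" and p=p])
      show "p (10 ^ K) = 0" "p (10 ^ Suc K) = 1" by (auto simp: p_def log_nat_power log_mult)
      fix i :: nat assume i: "10 ^ K \<le> i" "i < 10 ^ Suc K"
      have i0: "i > 0" using i(1) by (metis gr0I le_zero_eq power_not_zero zero_neq_numeral)
      show "p i \<le> p (Suc i)" using i0 by (simp add: p_def)
      have "p (Suc i) - p i = ln (1 + 1 / real i) / ln 10"
      proof -
        have "1 + 1 / real i = real (Suc i) / real i" using i0 by (simp add: field_simps)
        thus ?thesis using i0 by (simp add: p_def log_def ln_div diff_divide_distrib)
      qed
      also have "\<dots> \<le> ln (1 + 1 / real i) / 1"
      proof (intro divide_left_mono)
        have "exp 1 \<le> (10::real)" using exp_le by simp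
        thus "1 \<le> ln (10::real)" by (subst ln_ge_iff) auto
      qed auto
      also have "\<dots> \<le> 1 / real i" using ln_add_one_self_le_self[of "1 / real i"] by simp
      also have "\<dots> \<le> 1 / 10 ^ K"
      proof -
        have "real (10 ^ K) \<le> real i" using i(1) by (rule of_nat_mono)
        hence "10 ^ K \<le> real i" by simp
        thus ?thesis by (intro frac_le) auto
      qed
      finally show "p (Suc i) - p i \<le> (1/10) ^ K" by (simp add: power_divide)
      obtain S where S: "S \<noteq> []" "set S \<subseteq> {0..9}" "hd S \<noteq> (0::nat)" "length S = Suc K" "digit_string_value S = real i / 10 ^ K"
        using exists_digit_string[OF i] by blast
      have "10 powi (1 - int (length S)) = (1::real) / 10 ^ K" unfolding powi_length S(4) by simp
      hence "digit_string_value S + 10 powi (1 - int (length S)) = real (Suc i) / 10 ^ K"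
        unfolding S(5) by (simp add: add_divide_distrib)
      moreover have "log 10 (real j / 10 ^ K) = p j" if "j > 0" for j
        using that by (simp add: p_def log_divide log_nat_power)
      ultimately show "equidist (\<lambda>k. log 10 (b k)) (p i) (p (Suc i))"
        using B[unfolded strong_benford_pos_iff_equidist[OF b]] S i0 by (metis zero_less_Suc)
    qed (use l in auto)
    thus "eventually (\<lambda>N. dist ((\<Sum>k=1..N. cis (2 * pi * (of_int l * log 10 (b k)))) / of_nat N) 0 < e) sequentially"
    proof eventually_elim
      case (elim N)
      also have "(4 * pi * \<bar>of_int l\<bar> + 1) * (1/10) ^ K < e" using K C by (simp add: C_def field_simps)
      finally show ?case by simp
    qed
  qed
qed

section \<open>The equivalence\<close>

text \<open>The distance is monotone, so its limit exists as the supremum over integer cutoffs, and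
  it is infinite exactly if the squared distances \<open>Dsum\<close> are unbounded.\<close>

lemma pretentious_dist_inf_eq_infinity_iff:
  assumes f: "bounded_multiplicative f"
  shows "pretentious_dist_inf f (\<lambda>n. of_nat n powr (\<i> * complex_of_real \<alpha>)) = \<infinity> \<longleftrightarrow>
           (\<forall>B. \<exists>y. bounded_multiplicative.Dsum f \<alpha> y > B)"
proof -
  interpret bounded_multiplicative f by (rule f)
  define G where "G y = ereal (sqrt (Dsum \<alpha> y))" for y
  have dist: "ereal (pretentious_dist f (\<lambda>n. of_nat n powr (\<i> * complex_of_real \<alpha>)) x) = G (nat \<lfloor>x\<rfloor>)" for x
  proof -
    have "real p \<le> x \<longleftrightarrow> p \<le> nat \<lfloor>x\<rfloor>" if "prime p" for p
      using prime_gt_0_nat[OF that] by linarith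
    hence primes: "{p. prime p \<and> real p \<le> x} = {p. prime p \<and> p \<le> nat \<lfloor>x\<rfloor>}" by blast
    have vals: "f p * cnj (of_nat p powr (\<i> * complex_of_real \<alpha>)) = f p * cis (- (\<alpha> * ln (real p)))" if "prime p" for p
    proof -
      have "of_nat p powr (\<i> * complex_of_real \<alpha>) = cis (\<alpha> * ln (real p))"
        using prime_gt_0_nat[OF that] by (simp add: powr_def cis_conv_exp Ln_of_nat mult_ac)
      thus ?thesis by (simp add: cis_cnj)
    qed
    show ?thesis
      unfolding pretentious_dist_def G_def Dsum_def twist_def primes
      by (intro arg_cong[where f=ereal] arg_cong[where f=sqrt] sum.cong refl) (simp only: mem_Collect_eq vals)
  qed
  have inc: "incseq G" unfolding G_def by (intro monoI) (simp add: Dsum_mono)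
  have "filterlim (\<lambda>x::real. nat \<lfloor>x\<rfloor>) sequentially at_top"
    by (rule filterlim_compose[OF filterlim_nat_sequentially filterlim_floor_sequentially])
  hence "((\<lambda>x::real. G (nat \<lfloor>x\<rfloor>)) \<longlongrightarrow> (SUP y. G y)) at_top"
    by (rule filterlim_compose[OF LIMSEQ_SUP[OF inc]])
  hence "pretentious_dist_inf f (\<lambda>n. of_nat n powr (\<i> * complex_of_real \<alpha>)) = (SUP y. G y)"
    unfolding pretentious_dist_inf_def dist by (intro tendsto_Lim) auto
  also have "(SUP y. G y) = \<infinity> \<longleftrightarrow> (\<forall>B. \<exists>y. Dsum \<alpha> y > B)"
  proof
    assume *: "(SUP y. G y) = \<infinity>"
    show "\<forall>B. \<exists>y. Dsum \<alpha> y > B"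
    proof
      fix B
      have "ereal (sqrt \<bar>B\<bar>) < (SUP y. G y)" unfolding * by simp
      then obtain y where "ereal (sqrt \<bar>B\<bar>) < G y" by (auto simp: less_SUP_iff)
      hence "\<bar>B\<bar> < Dsum \<alpha> y" by (simp add: G_def)
      thus "\<exists>y. Dsum \<alpha> y > B" by (intro exI[of _ y]) linarith
    qed
  next
    assume *: "\<forall>B. \<exists>y. Dsum \<alpha> y > B"
    show "(SUP y. G y) = \<infinity>"
    proof (rule ereal_top)
      fix B
      obtain y where "Dsum \<alpha> y > B^2" using * by blast
      hence "sqrt (B^2) \<le> sqrt (Dsum \<alpha> y)" by (intro real_sqrt_le_mono) simp
      hence "ereal B \<le> G y" by (simp add: G_def)
      also have "\<dots> \<le> (SUP y. G y)" by (intro SUP_upper) auto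
      finally show "ereal B \<le> (SUP y. G y)" .
    qed
  qed
  finally show ?thesis .
qed

section \<open>Mean values of the twists against their distances\<close>

lemma benford_twist_eq:
  "benford_twist h l n = (if h n = 0 then 0 else cis (2 * pi * (of_int l * log 10 \<bar>h n\<bar>)))"
  by (simp add: benford_twist_def cis_conv_exp mult_ac)

lemma bounded_multiplicative_benford_twist:
  assumes h: "multiplicative h" and h1: "h 1 = 1"
  shows "bounded_multiplicative (benford_twist h l)"
proof
  show "benford_twist h l (Suc 0) = 1" using h1 by (simp add: benford_twist_eq)
  show "norm (benford_twist h l n) \<le> 1" for n by (simp add: benford_twist_eq)
  fix m n :: nat assume mn: "m > 0" "n > 0" "coprime m n"
  hence "h (m * n) = h m * h n" using h by (simp add: multiplicative_def)
  thus "benford_twist h l (m * n) = benford_twist h l m * benford_twist h l n"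
    by (auto simp: benford_twist_eq abs_mult log_mult cis_mult algebra_simps)
qed

text \<open>Prime by prime, the squared triangle inequality behind D(f^2, g^2) <= 2 D(f, g); it
  carries a finite distance from l and \<alpha> to 2 l and 2 \<alpha>.\<close>

lemma one_minus_cos_double_le: "1 - cos (2 * \<theta>) \<le> 4 * (1 - cos (\<theta>::real))"
proof -
  have "4 * (1 - cos \<theta>) - (1 - cos (2 * \<theta>)) = 2 * (1 - cos \<theta>)^2"
    unfolding cos_double_cos by (simp add: power2_eq_square algebra_simps)
  moreover have "2 * (1 - cos \<theta>)^2 \<ge> 0" by simp
  ultimately show ?thesis by linarith
qed

lemma mean_zero_iff_divergent:
  assumes h: "multiplicative h" and h1: "h 1 = 1"
  shows "(\<forall>l::int. l \<noteq> 0 \<longrightarrow> (\<lambda>N. (\<Sum>n=1..N. benford_twist h l n) / of_nat N) \<longlonglongrightarrow> 0) \<longleftrightarrow>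
         (\<forall>(\<alpha>::real) (l::int). l \<noteq> 0 \<longrightarrow>
           pretentious_dist_inf (benford_twist h l) (\<lambda>n. of_nat n powr (\<i> * complex_of_real \<alpha>)) = \<infinity>)"
proof (intro iffI allI impI)
  fix l :: int assume l: "l \<noteq> 0"
  assume *: "\<forall>(\<alpha>::real) (l::int). l \<noteq> 0 \<longrightarrow>
           pretentious_dist_inf (benford_twist h l) (\<lambda>n. of_nat n powr (\<i> * complex_of_real \<alpha>)) = \<infinity>"
  interpret bounded_multiplicative "benford_twist h l" by (rule bounded_multiplicative_benford_twist[OF h h1])
  show "(\<lambda>N. (\<Sum>n=1..N. benford_twist h l n) / of_nat N) \<longlonglongrightarrow> 0"
    using * l pretentious_dist_inf_eq_infinity_iff[OF bounded_multiplicative_axioms] by (intro halasz) blast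
next
  fix \<alpha> :: real and l :: int assume l: "l \<noteq> 0"
  assume mean: "\<forall>l::int. l \<noteq> 0 \<longrightarrow> (\<lambda>N. (\<Sum>n=1..N. benford_twist h l n) / of_nat N) \<longlonglongrightarrow> 0"
  interpret A: bounded_multiplicative "benford_twist h l" by (rule bounded_multiplicative_benford_twist[OF h h1])
  interpret B: bounded_multiplicative "benford_twist h (2 * l)" by (rule bounded_multiplicative_benford_twist[OF h h1])
  show "pretentious_dist_inf (benford_twist h l) (\<lambda>n. of_nat n powr (\<i> * complex_of_real \<alpha>)) = \<infinity>"
  proof (rule ccontr)
    assume "pretentious_dist_inf (benford_twist h l) (\<lambda>n. of_nat n powr (\<i> * complex_of_real \<alpha>)) \<noteq> \<infinity>"
    then obtain B where B: "\<And>y. A.Dsum \<alpha> y \<le> B"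
      unfolding pretentious_dist_inf_eq_infinity_iff[OF A.bounded_multiplicative_axioms] by (auto simp: not_less)
    have zero: "A.loc2 \<alpha> = 0" using A.mean_not_zero[OF B] mean l by blast
    define \<theta> where "\<theta> n = 2 * pi * (of_int l * log 10 \<bar>h n\<bar>) - \<alpha> * ln (real n)" for n
    have ta: "benford_twist h l n * cis (- (\<alpha> * ln (real n))) = (if h n = 0 then 0 else cis (\<theta> n))" for n
      by (simp add: benford_twist_eq cis_mult \<theta>_def)
    have tb: "benford_twist h (2 * l) n * cis (- (2 * \<alpha> * ln (real n))) = (if h n = 0 then 0 else cis (2 * \<theta> n))" for n
      by (simp add: benford_twist_eq cis_mult \<theta>_def algebra_simps)
    have "B.Dsum (2 * \<alpha>) y \<le> 4 * B" for y
    proof -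
      have "B.Dsum (2 * \<alpha>) y \<le> 4 * A.Dsum \<alpha> y"
        unfolding A.Dsum_def B.Dsum_def A.twist_def B.twist_def ta tb sum_distrib_left
      proof (intro sum_mono)
        fix p :: nat
        \<comment> \<open>Where h p = 0 both twists vanish and the inequality reads 1 <= 4.\<close>
        have "1 - Re (if h p = 0 then 0 else cis (2 * \<theta> p)) \<le> 4 * (1 - Re (if h p = 0 then 0 else cis (\<theta> p)))"
          using one_minus_cos_double_le[of "\<theta> p"] by simp
        from divide_right_mono[OF this, of "real p"]
        show "(1 - Re (if h p = 0 then 0 else cis (2 * \<theta> p))) / real p \<le> 4 * ((1 - Re (if h p = 0 then 0 else cis (\<theta> p))) / real p)"
          by simp
      qed
      thus ?thesis using B[of y] by linarith
    qed
    moreover have "B.loc2 (2 * \<alpha>) \<noteq> 0"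
    proof -
      have "benford_twist h (2 * l) (2 ^ k) * cis (- (2 * \<alpha> * ln (real (2 ^ k)))) = 1" for k
      proof (cases "k = 0")
        case False
        hence "benford_twist h l (2 ^ k) * cis (- (\<alpha> * ln (real (2 ^ k)))) = -1"
          by (intro A.loc2_eq_0D[OF zero]) auto
        hence 1: "h (2 ^ k) \<noteq> 0" "cis (\<theta> (2 ^ k)) = -1" unfolding ta by (auto split: if_splits)
        have "cis (2 * \<theta> (2 ^ k)) = cis (\<theta> (2 ^ k)) * cis (\<theta> (2 ^ k))" by (simp add: cis_mult)
        thus ?thesis unfolding tb using 1 by simp
      qed (simp add: h1[simplified] benford_twist_eq)
      \<comment> \<open>Squaring -1 makes every normalised value at a power of 2 equal to 1, so the
        local factor is 2.\<close>
      hence "B.loc2 (2 * \<alpha>) = (\<Sum>k. (1/2) ^ k)" unfolding B.loc2_def by (simp only: mult_1_left)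
      also have "\<dots> = 1 / (1 - 1/2)" by (rule suminf_geometric) (simp add: norm_divide)
      finally show ?thesis by simp
    qed
    ultimately show False using B.mean_not_zero[of "2 * \<alpha>" "4 * B"] mean l by auto
  qed
qed

text \<open>By monotonicity the indices j with \<open>enumerate A j\<close> at most N are closed
  downwards, and such a set of c indices is {..<c}.\<close>

lemma enumerate_initial_segment:
  fixes A :: "nat set"
  assumes A: "infinite A"
  shows "{n\<in>A. n \<le> N} = enumerate A ` {..<card {n\<in>A. n \<le> N}}"
proof -
  have fin: "finite {n\<in>A. n \<le> N}" by (rule finite_subset[of _ "{..N}"]) auto
  have mono: "strict_mono (enumerate A)" using A by (rule strict_mono_enumerate)
  define B where "B = {j. enumerate A j \<le> N}"
  have img: "enumerate A ` B = {n\<in>A. n \<le> N}"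
    using enumerate_Ex[OF A] enumerate_in_set[OF A] by (auto simp: B_def image_iff)
  have inj: "inj_on (enumerate A) B" using mono by (meson inj_on_subset strict_mono_imp_inj_on subset_UNIV)
  have finB: "finite B" using fin inj img by (metis finite_image_iff)
  have "B = {..<card B}"
  proof (rule card_subset_eq[symmetric])
    show "{..<card B} \<subseteq> B"
    proof
      fix j assume j: "j \<in> {..<card B}"
      show "j \<in> B"
      proof (rule ccontr)
        assume "j \<notin> B"
        hence "B \<subseteq> {..<j}"
          using mono by (auto simp: B_def not_le) (meson less_le_trans not_le strict_mono_less_eq le_less_trans)
        hence "card B \<le> j" using card_mono[of "{..<j}" B] by simp
        thus False using j by simp
      qed
    qed
  qed (use finB in auto)
  moreover have "card B = card {n\<in>A. n \<le> N}" using card_image[OF inj] img by simp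
  ultimately show ?thesis using img by simp
qed

text \<open>The sum of a twist up to N is the Weyl sum over the first T N nonvanishing terms. As T N
  lies between N / C and N, the two averages differ by a bounded factor.\<close>

lemma strong_benford_iff_mean_zero:
  fixes h :: "nat \<Rightarrow> real"
  assumes C: "\<And>N. N \<ge> 1 \<Longrightarrow> 0 < nonzero_count h N \<and> real N / real (nonzero_count h N) \<le> C"
  shows "strong_benford h \<longleftrightarrow>
    (\<forall>l::int. l \<noteq> 0 \<longrightarrow> (\<lambda>N. (\<Sum>n=1..N. benford_twist h l n) / of_nat N) \<longlonglongrightarrow> 0)"
proof -
  define A where "A = {n. 0 < n \<and> h n \<noteq> 0}"
  define T where "T = nonzero_count h"
  have TA: "T N = card {n\<in>A. n \<le> N}" for N
    unfolding T_def nonzero_count_def A_def by (intro arg_cong[where f=card]) auto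
  have TN: "real N \<le> C * real (T N)" if "N \<ge> 1" for N
    using C[OF that] by (simp add: T_def divide_le_eq)
  have TleN: "T N \<le> N" for N
    unfolding T_def nonzero_count_def by (rule order.trans[OF card_mono[of "{1..N}"]]) auto
  have C0: "C > 0" using TN[of 1] TleN[of 1] by (cases "T 1") (auto simp: not_less zero_less_mult_iff)
  have Tlim: "filterlim T at_top sequentially"
  proof -
    have "filterlim (\<lambda>N. real N * (1 / C)) at_top sequentially"
      using C0 by (intro filterlim_at_top_mult_tendsto_pos[OF tendsto_const] filterlim_real_sequentially) auto
    moreover have "eventually (\<lambda>N. real N * (1 / C) \<le> real (T N)) sequentially"
      using eventually_ge_at_top[of 1] by eventually_elim (use TN C0 in \<open>simp add: divide_le_eq mult.commute\<close>)
    ultimately have "filterlim (\<lambda>N. real (T N)) at_top sequentially" by (rule filterlim_at_top_mono)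
    thus ?thesis by (simp add: filterlim_sequentially_iff_filterlim_real)
  qed
  have inf: "infinite A"
  proof
    assume fin: "finite A"
    have "eventually (\<lambda>N. T N \<ge> Suc (card A)) sequentially" using Tlim by (auto simp: filterlim_at_top)
    then obtain N where "T N \<ge> Suc (card A)" by (auto simp: eventually_sequentially)
    moreover have "T N \<le> card A" unfolding TA using fin by (intro card_mono) auto
    ultimately show False by simp
  qed
  define b where "b k = \<bar>h (enumerate A (k - 1))\<bar>" for k
  have hA: "h (enumerate A j) \<noteq> 0" for j using enumerate_in_set[OF inf, of j] by (auto simp: A_def)
  have b: "b k > 0" for k using hA by (simp add: b_def)
  have "strong_benford h \<longleftrightarrow> weyl (\<lambda>k. log 10 (b k))"
    unfolding strong_benford_def A_def[symmetric] using inf strong_benford_pos_iff_weyl[of b, OF b] by (simp add: b_def[abs_def])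
  also have "\<dots> \<longleftrightarrow> (\<forall>l::int. l \<noteq> 0 \<longrightarrow> (\<lambda>N. (\<Sum>n=1..N. benford_twist h l n) / of_nat N) \<longlonglongrightarrow> 0)"
    unfolding weyl_def
  proof (intro iff_allI imp_cong refl)
    fix l :: int
    define W where "W K = (\<Sum>k=1..K. cis (2 * pi * (of_int l * log 10 (b k))))" for K
    define S where "S N = (\<Sum>n=1..N. benford_twist h l n)" for N
    have W: "W K = (\<Sum>j<K. benford_twist h l (enumerate A j))" for K
      unfolding W_def by (rule sum.reindex_bij_witness[of _ Suc "\<lambda>k. k - 1"]) (auto simp: b_def benford_twist_eq hA)
    have SW: "S N = W (T N)" for N
    proof -
      have "S N = (\<Sum>n\<in>{n\<in>A. n \<le> N}. benford_twist h l n)"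
        unfolding S_def by (intro sum.mono_neutral_right) (auto simp: A_def benford_twist_eq)
      also have "\<dots> = (\<Sum>j<T N. benford_twist h l (enumerate A j))"
        unfolding TA by (subst enumerate_initial_segment[OF inf], subst sum.reindex)
          (auto intro: inj_on_subset[OF strict_mono_imp_inj_on[OF strict_mono_enumerate[OF inf]]])
      finally show ?thesis by (simp add: W)
    qed
    have "(\<lambda>K. W K / of_nat K) \<longlonglongrightarrow> 0 \<longleftrightarrow> (\<lambda>N. S N / of_nat N) \<longlonglongrightarrow> 0"
    proof
      assume lim: "(\<lambda>K. W K / of_nat K) \<longlonglongrightarrow> 0"
      have "(\<lambda>N. norm (W (T N) / of_nat (T N))) \<longlonglongrightarrow> 0"
        using tendsto_norm[OF filterlim_compose[OF lim Tlim]] by simp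
      thus "(\<lambda>N. S N / of_nat N) \<longlonglongrightarrow> 0"
      proof (rule Lim_null_comparison[rotated])
        show "eventually (\<lambda>N. norm (S N / of_nat N) \<le> norm (W (T N) / of_nat (T N))) sequentially"
          using eventually_ge_at_top[of 1]
        proof eventually_elim
          case (elim N)
          have "T N > 0" using C[OF elim] by (simp add: T_def)
          thus ?case unfolding SW norm_divide using TleN[of N] by (simp add: frac_le)
        qed
      qed
    next
      assume lim: "(\<lambda>N. S N / of_nat N) \<longlonglongrightarrow> 0"
      \<comment> \<open>The position of the K-th nonvanishing term, which inverts T: T (n K) = K for
        K >= 1, hence n K <= C K. The shift by 1 reflects that \<open>enumerate\<close> counts from
        0.\<close>
      define n where "n K = enumerate A (K - 1)" for K
      have nK: "T (n K) = K" if "K \<ge> 1" for K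
      proof -
        have "{m\<in>A. m \<le> n K} = enumerate A ` {..<K}"
        proof -
          have "enumerate A j \<le> enumerate A (K - 1) \<longleftrightarrow> j < K" for j
            using that strict_mono_less_eq[OF strict_mono_enumerate[OF inf], of j "K - 1"] by auto
          note iff = this
          show ?thesis
          proof safe
            fix m assume m: "m \<in> A" "m \<le> n K"
            then obtain j where "enumerate A j = m" using enumerate_Ex[OF inf] by blast
            thus "m \<in> enumerate A ` {..<K}" using m(2) iff by (auto simp: n_def)
          qed (use iff enumerate_in_set[OF inf] in \<open>auto simp: n_def\<close>)
        qed
        moreover have "inj_on (enumerate A) {..<K}"
          by (rule strict_mono_imp_inj_on[OF strict_mono_enumerate[OF inf]])
        ultimately show ?thesis unfolding TA by (simp add: card_image)
      qed
      have "eventually (\<lambda>K. K \<le> n K) sequentially"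
        using eventually_ge_at_top[of 1] by eventually_elim (use nK TleN in metis)
      hence nlim: "filterlim n at_top sequentially"
        by (rule filterlim_at_top_mono[OF filterlim_ident])
      have "(\<lambda>K. C * norm (S (n K) / of_nat (n K))) \<longlonglongrightarrow> 0"
        using tendsto_mult_left[OF tendsto_norm[OF filterlim_compose[OF lim nlim]], of C] by simp
      thus "(\<lambda>K. W K / of_nat K) \<longlonglongrightarrow> 0"
      proof (rule Lim_null_comparison[rotated])
        show "eventually (\<lambda>K. norm (W K / of_nat K) \<le> C * norm (S (n K) / of_nat (n K))) sequentially"
          using eventually_ge_at_top[of 1]
        proof eventually_elim
          case (elim K)
          have n1: "n K \<ge> 1" using TleN[of "n K"] nK[OF elim] elim by simp
          have "real (n K) \<le> C * real K" using TN[OF n1] nK[OF elim] by simp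
          hence "norm (W K) / real K \<le> C * (norm (W K) / real (n K))"
            using n1 elim mult_right_mono[of "real (n K)" "C * real K" "norm (W K)"] by (simp add: field_simps)
          thus ?case unfolding SW nK[OF elim] norm_divide by simp
        qed
      qed
    qed
    thus "(\<lambda>N. (\<Sum>k=1..N. cis (2 * pi * (of_int l * log 10 (b k)))) / of_nat N) \<longlonglongrightarrow> 0 \<longleftrightarrow>
          (\<lambda>N. (\<Sum>n=1..N. benford_twist h l n) / of_nat N) \<longlonglongrightarrow> 0"
      unfolding W_def S_def .
  qed
  finally show ?thesis .
qed

theorem theorem2p3:
  fixes h :: "nat \<Rightarrow> real"
  assumes "multiplicative h"
    and "\<exists>C::real. \<forall>N\<ge>1. 0 < nonzero_count h N \<and> real N / real (nonzero_count h N) \<le> C"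
  shows "strong_benford h \<longleftrightarrow>
    (\<forall>(\<alpha>::real) (l::int). l \<noteq> 0 \<longrightarrow>
       pretentious_dist_inf (benford_twist h l) (\<lambda>n. of_nat n powr (\<i> * complex_of_real \<alpha>)) = \<infinity>)"
proof -
  obtain C :: real where C: "\<And>N. N \<ge> 1 \<Longrightarrow> 0 < nonzero_count h N \<and> real N / real (nonzero_count h N) \<le> C"
    using assms(2) by blast
  \<comment> \<open>At N = 1 the density hypothesis excludes h 1 = 0, and then h 1 = h 1 * h 1
    leaves only h 1 = 1.\<close>
  have "0 < nonzero_count h 1" using C[of 1] by simp
  hence "h 1 \<noteq> 0" by (auto simp: nonzero_count_def card_gt_0_iff)
  moreover have "h (1 * 1) = h 1 * h 1" using assms(1) unfolding multiplicative_def by (metis coprime_1_left zero_less_one)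
  ultimately have "h 1 = 1" by simp
  thus ?thesis
    using strong_benford_iff_mean_zero[OF C] mean_zero_iff_divergent[OF assms(1)] by simp
qed

end
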